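(* Consider the feedback loop of $N$ agents, a linear filter $\mathcal F$ and a linear controller $\mathcal C$ described in the context. Assume that the set $\mathbb A_i$ of possible states of agent $i$ is finite for each $i\in\{1,\dots,N\}$. Assume that each agent $i$ has a state governed by the non-linear stochastic difference equations $$x_i(k+1)=\mathcal W_{ij}(x_i(k)),\qquad y_i(k)=\mathcal H_{i\ell}(x_i(k)),$$ with maps $\mathcal W_{ij}$ ($j=1,\dots,w_i$) and $\mathcal H_{i\ell}$ ($\ell=1,\dots,h_i$). Assume we have Dini continuous probability functions $p_{ij},p'_{i\ell}:\Pi\to[0,1]$ so that $$\mathbb P\big(x_i(k+1)=\mathcal W_{ij}(x_i(k))\big)=p_{ij}(\pi(k)),\qquad \mathbb P\big(y_i(k)=\mathcal H_{i\ell}(x_i(k))\big)=p'_{i\ell}(\pi(k)),$$ and $\sum_{j=1}^{w_i}p_{ij}(\pi)=\sum_{\ell=1}^{h_i}p'_{i\ell}(\pi)=1$ for all $\pi\in\Pi$ and all $i$. Assume furthermore that there are scalars $\delta,\delta'>0$ such that $p_{ij}(\pi)\ge\delta>0$ for all $(i,j)$ and $p'_{i\ell}(\pi)\ge\delta'>0$ for all $(i,\ell)$ and all $\pi\in\Pi$. Let $\mathbb X_S=\prod_{i=1}^N\mathbb A_i$ and let $G=(\mathbb X_S,E)$ be the directed graph with an arc from $(x_i)_{i=1}^N$ to $(z_i)_{i=1}^N$ if there is a choice of indices $j_1,\dots,j_N$ with $\mathcal W_{ij_i}(x_i)=z_i$ for all $i$. Then, for every stable linear controller $\mathcal C$ and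 every stable linear filter $\mathcal F$, the following holds: if the graph $G$ is strongly connected, then there exists an invariant measure for the feedback loop. If, in addition, the adjacency matrix of $G$ is primitive, then the invariant measure is attractive and the system is uniquely ergodic.
   Context: Closed loop (discrete time). Agent $i$ has finite state space $\mathbb A_i\subset\mathbb R^{n_i}$, with finitely many maps $\mathcal W_{ij}:\mathbb A_i\to\mathbb A_i$ and $\mathcal H_{i\ell}:\mathbb A_i\to\mathbb R$. The aggregate output is $y(k)=\sum_{i=1}^N y_i(k)$. The linear filter is $$\mathcal F:\quad x_f(k+1)=A_fx_f(k)+B_fy(k),\qquad \hat y(k)=C_fx_f(k),\qquad x_f(k)\in\mathbb R^{n_f}.$$ The error is $e(k)=r-\hat y(k)$ with $r$ a constant reference value. The linear controller is $$\mathcal C:\quad x_c(k+1)=A_cx_c(k)+B_ce(k),\qquad \pi(k)=C_cx_c(k)+D_ce(k),\qquad x_c(k)\in\mathbb R^{n_c}.$$ Signals $y,\hat y,e,\pi$ are scalar, and matrices have compatible dimensions. $\Pi\subseteq\mathbb R$ is the set of admissible broadcast signals, containing all values of $\pi(k)$. "Stable" controller/filter means that $A_c$, respectively $A_f$, is Schur (all eigenvalues in the open unit disc). Conditioned on the current overall state (hence on $\pi(k)$), the choices of the transition maps and output maps of all agents at time $k$ are stochastically independent, so the joint choice of $\mathcal W_{ij_i},\mathcal H_{i\ell_i}$, $i=1,\dots,N$, has probability $\prod_i p_{ij_i}(\pi(k))\prod_i p'_{i\ell_i}(\pi(k))$. The closed loop is thus a time-homogeneous Markov chain $X(k)$ on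 $\mathbb X=\mathbb X_S\times\mathbb R^{n_f}\times\mathbb R^{n_c}$; "invariant measure" means invariant probability measure of this chain. A function $p$ is Dini continuous if its modulus of continuity $\omega(t)=\sup_{|s-s'|\le t}|p(s)-p(s')|$ satisfies $\int_0^{1}\omega(t)/t\,dt<\infty$. A nonnegative square matrix is primitive if some power of it has all entries strictly positive. An invariant probability measure $\mu$ is attractive if, for every initial probability distribution, the law of $X(k)$ converges to $\mu$ in distribution. The system is called uniquely ergodic if it has an attractive, unique, ergodic, invariant probability measure $\mu$ such that for every deterministic initial condition $x_0\in\mathbb X$ and every continuous $g:\mathbb X\to\mathbb R$, $$\lim_{k\to\infty}\frac1{k+1}\sum_{\nu=0}^k g(X(\nu))=\mathbb E_\mu(g)$$ almost surely (with respect to the path measure started at $x_0$). *)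

theory Defs
  imports "HOL-Probability.Probability" "Graph_Theory.Graph_Theory"
begin

section \<open>Dini continuity, Schur matrices, primitive matrices\<close>

text \<open>The modulus of continuity takes values in the extended nonnegative reals, so that the
  supremum is meaningful for every function.\<close>

definition modulus_of_continuity :: "real set \<Rightarrow> (real \<Rightarrow> real) \<Rightarrow> real \<Rightarrow> ennreal" where
  "modulus_of_continuity D p t =
     (SUP (s, s') \<in> {(s, s'). s \<in> D \<and> s' \<in> D \<and> \<bar>s - s'\<bar> \<le> t}. ennreal \<bar>p s - p s'\<bar>)"

definition dini_continuous_on :: "real set \<Rightarrow> (real \<Rightarrow> real) \<Rightarrow> bool" where
  "dini_continuous_on D p \<longleftrightarrow>
     (\<integral>\<^sup>+ t \<in> {0<..1}. modulus_of_continuity D p t / ennreal t \<partial>lborel) < \<infinity>"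

definition complex_eigenvalue :: "real ^ 'n ^ 'n \<Rightarrow> complex \<Rightarrow> bool" where
  "complex_eigenvalue A z \<longleftrightarrow>
     (\<exists>v :: complex ^ 'n. v \<noteq> 0 \<and> map_matrix complex_of_real A *v v = z *s v)"

definition schur :: "real ^ 'n ^ 'n \<Rightarrow> bool" where
  "schur A \<longleftrightarrow> (\<forall>z. complex_eigenvalue A z \<longrightarrow> cmod z < 1)"

text \<open>Square matrices whose rows and columns are indexed by a finite set \<open>V\<close>.\<close>

fun matrix_power_on :: "'v set \<Rightarrow> ('v \<Rightarrow> 'v \<Rightarrow> real) \<Rightarrow> nat \<Rightarrow> 'v \<Rightarrow> 'v \<Rightarrow> real" where
  "matrix_power_on V M 0 = (\<lambda>x y. if x = y then 1 else 0)"
| "matrix_power_on V M (Suc k) = (\<lambda>x y. \<Sum>z\<in>V. matrix_power_on V M k x z * M z y)"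

definition primitive_matrix_on :: "'v set \<Rightarrow> ('v \<Rightarrow> 'v \<Rightarrow> real) \<Rightarrow> bool" where
  "primitive_matrix_on V M \<longleftrightarrow>
     (\<forall>x\<in>V. \<forall>y\<in>V. M x y \<ge> 0) \<and> (\<exists>k>0. \<forall>x\<in>V. \<forall>y\<in>V. matrix_power_on V M k x y > 0)"

definition adjacency_matrix :: "'v pair_pre_digraph \<Rightarrow> 'v \<Rightarrow> 'v \<Rightarrow> real" where
  "adjacency_matrix G x y = (if (x, y) \<in> parcs G then 1 else 0)"


section \<open>Time-homogeneous Markov chains\<close>

text \<open>In this section \<open>S\<close> is the measurable state space and \<open>K\<close> the one-step transition kernel.
  The path measure started from the distribution \<open>\<nu>\<close> is the infinite product of the
  Ionescu-Tulcea theorem for the conditional laws \<open>\<nu>\<close> at time 0 and \<open>K (\<omega> n)\<close> at time \<open>n + 1\<close>.\<close>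

definition path_kernel ::
  "('s \<Rightarrow> 's measure) \<Rightarrow> 's measure \<Rightarrow> nat \<Rightarrow> (nat \<Rightarrow> 's) \<Rightarrow> 's measure" where
  "path_kernel K \<nu> k \<omega> = (case k of 0 \<Rightarrow> \<nu> | Suc n \<Rightarrow> K (\<omega> n))"

definition path_measure ::
  "'s measure \<Rightarrow> ('s \<Rightarrow> 's measure) \<Rightarrow> 's measure \<Rightarrow> (nat \<Rightarrow> 's) measure" where
  "path_measure S K \<nu> =
     projective_family.lim UNIV (Ionescu_Tulcea.CI (path_kernel K \<nu>) (\<lambda>_. S)) (\<lambda>_. S)"

definition law_at ::
  "'s measure \<Rightarrow> ('s \<Rightarrow> 's measure) \<Rightarrow> 's measure \<Rightarrow> nat \<Rightarrow> 's measure" where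
  "law_at S K \<nu> k = distr (path_measure S K \<nu>) S (\<lambda>\<omega>. \<omega> k)"

definition probability_on :: "'s measure \<Rightarrow> 's measure \<Rightarrow> bool" where
  "probability_on S \<mu> \<longleftrightarrow> prob_space \<mu> \<and> sets \<mu> = sets S"

definition invariant_measure :: "'s measure \<Rightarrow> ('s \<Rightarrow> 's measure) \<Rightarrow> 's measure \<Rightarrow> bool" where
  "invariant_measure S K \<mu> \<longleftrightarrow> probability_on S \<mu> \<and>
     (\<forall>B \<in> sets S. (\<integral>\<^sup>+ x. emeasure (K x) B \<partial>\<mu>) = emeasure \<mu> B)"

text \<open>An invariant measure is ergodic if it is trivial on the sets that are invariant
  for the chain up to null sets.\<close>

definition ergodic_measure :: "'s measure \<Rightarrow> ('s \<Rightarrow> 's measure) \<Rightarrow> 's measure \<Rightarrow> bool" where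
  "ergodic_measure S K \<mu> \<longleftrightarrow> invariant_measure S K \<mu> \<and>
     (\<forall>B \<in> sets S. (AE x in \<mu>. emeasure (K x) B = indicator B x) \<longrightarrow>
        measure \<mu> B = 0 \<or> measure \<mu> B = 1)"

definition converges_in_distribution ::
  "'s::topological_space measure \<Rightarrow> (nat \<Rightarrow> 's measure) \<Rightarrow> 's measure \<Rightarrow> bool" where
  "converges_in_distribution S M \<mu> \<longleftrightarrow>
     (\<forall>f :: 's \<Rightarrow> real. continuous_on (space S) f \<and> bounded (f ` space S) \<longrightarrow>
        (\<lambda>k. integral\<^sup>L (M k) f) \<longlonglongrightarrow> integral\<^sup>L \<mu> f)"

definition attractive_measure ::
  "'s::topological_space measure \<Rightarrow> ('s \<Rightarrow> 's measure) \<Rightarrow> 's measure \<Rightarrow> bool" where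
  "attractive_measure S K \<mu> \<longleftrightarrow> invariant_measure S K \<mu> \<and>
     (\<forall>\<nu>. probability_on S \<nu> \<longrightarrow> converges_in_distribution S (law_at S K \<nu>) \<mu>)"

text \<open>Integrability of \<open>g\<close> is demanded explicitly because the Bochner integral of a
  non-integrable function is 0 by convention.\<close>

definition time_averages_converge ::
  "'s::topological_space measure \<Rightarrow> ('s \<Rightarrow> 's measure) \<Rightarrow> 's measure \<Rightarrow> bool" where
  "time_averages_converge S K \<mu> \<longleftrightarrow>
     (\<forall>x0 \<in> space S. \<forall>g :: 's \<Rightarrow> real. continuous_on (space S) g \<longrightarrow>
        integrable \<mu> g \<and>
        (AE \<omega> in path_measure S K (return S x0).
           (\<lambda>k. (\<Sum>\<nu>\<le>k. g (\<omega> \<nu>)) / (real k + 1)) \<longlonglongrightarrow> integral\<^sup>L \<mu> g))"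

definition uniquely_ergodic ::
  "'s::topological_space measure \<Rightarrow> ('s \<Rightarrow> 's measure) \<Rightarrow> bool" where
  "uniquely_ergodic S K \<longleftrightarrow>
     (\<exists>\<mu>. invariant_measure S K \<mu> \<and> (\<forall>\<mu>'. invariant_measure S K \<mu>' \<longrightarrow> \<mu>' = \<mu>) \<and>
          ergodic_measure S K \<mu> \<and> attractive_measure S K \<mu> \<and> time_averages_converge S K \<mu>)"


section \<open>The feedback loop\<close>

text \<open>The agents are indexed by a finite type \<open>'i\<close>. Since the dimension of the state of an agent
  depends on the agent, a vector with \<open>n\<close> real components is a function in
  \<open>{..<n} \<rightarrow>\<^sub>E UNIV\<close>; the product topology of \<open>nat \<Rightarrow> real\<close> induces the usual topology there.
  Transition maps and output maps are numbered from 1.\<close>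

record 'i ensemble =
  agent_dim    :: "'i \<Rightarrow> nat"
  agent_states :: "'i \<Rightarrow> (nat \<Rightarrow> real) set"
  num_trans    :: "'i \<Rightarrow> nat"
  num_out      :: "'i \<Rightarrow> nat"
  trans_map    :: "'i \<Rightarrow> nat \<Rightarrow> (nat \<Rightarrow> real) \<Rightarrow> (nat \<Rightarrow> real)"
  out_map      :: "'i \<Rightarrow> nat \<Rightarrow> (nat \<Rightarrow> real) \<Rightarrow> real"
  trans_prob   :: "'i \<Rightarrow> nat \<Rightarrow> real \<Rightarrow> real"
  out_prob     :: "'i \<Rightarrow> nat \<Rightarrow> real \<Rightarrow> real"

text \<open>All signals are scalar, so input and output matrices are column and row vectors.\<close>

record ('f::finite) linear_filter =
  filt_A :: "real ^ 'f ^ 'f"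
  filt_B :: "real ^ 'f"
  filt_C :: "real ^ 'f"

record ('c::finite) linear_controller =
  ctrl_A :: "real ^ 'c ^ 'c"
  ctrl_B :: "real ^ 'c"
  ctrl_C :: "real ^ 'c"
  ctrl_D :: real

definition stable_filter :: "'f::finite linear_filter \<Rightarrow> bool" where
  "stable_filter F \<longleftrightarrow> schur (filt_A F)"

definition stable_controller :: "'c::finite linear_controller \<Rightarrow> bool" where
  "stable_controller C \<longleftrightarrow> schur (ctrl_A C)"

type_synonym ('i, 'f, 'c) loop_state = "('i \<Rightarrow> nat \<Rightarrow> real) \<times> (real ^ 'f) \<times> (real ^ 'c)"

definition agent_product :: "'i ensemble \<Rightarrow> ('i \<Rightarrow> nat \<Rightarrow> real) set" where
  "agent_product A = (\<Pi>\<^sub>E i\<in>UNIV. agent_states A i)"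

definition agent_graph :: "'i ensemble \<Rightarrow> ('i \<Rightarrow> nat \<Rightarrow> real) pair_pre_digraph" where
  "agent_graph A =
     \<lparr> pverts = agent_product A,
       parcs = {(x, z). x \<in> agent_product A \<and> z \<in> agent_product A \<and>
                  (\<exists>j. \<forall>i. j i \<in> {1..num_trans A i} \<and> trans_map A i (j i) (x i) = z i)} \<rparr>"

definition loop_space :: "'i::finite ensemble \<Rightarrow> ('i, 'f::finite, 'c::finite) loop_state measure" where
  "loop_space A = restrict_space borel (agent_product A \<times> UNIV \<times> UNIV)"

definition loop_error :: "'f::finite linear_filter \<Rightarrow> real \<Rightarrow> real ^ 'f \<Rightarrow> real" where
  "loop_error F r xf = r - filt_C F \<bullet> xf"

definition broadcast ::
  "'f::finite linear_filter \<Rightarrow> 'c::finite linear_controller \<Rightarrow> real \<Rightarrow>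
   ('i, 'f, 'c) loop_state \<Rightarrow> real" where
  "broadcast F C r = (\<lambda>(x, xf, xc). ctrl_C C \<bullet> xc + ctrl_D C * loop_error F r xf)"

text \<open>Joint choices of a transition map and an output map for every agent.\<close>

definition loop_choices :: "'i ensemble \<Rightarrow> (('i \<Rightarrow> nat) \<times> ('i \<Rightarrow> nat)) set" where
  "loop_choices A =
     (\<Pi>\<^sub>E i\<in>UNIV. {1..num_trans A i}) \<times> (\<Pi>\<^sub>E i\<in>UNIV. {1..num_out A i})"

definition choice_prob ::
  "'i::finite ensemble \<Rightarrow> real \<Rightarrow> ('i \<Rightarrow> nat) \<times> ('i \<Rightarrow> nat) \<Rightarrow> real" where
  "choice_prob A \<pi> =
     (\<lambda>(j, l). (\<Prod>i\<in>UNIV. trans_prob A i (j i) \<pi>) * (\<Prod>i\<in>UNIV. out_prob A i (l i) \<pi>))"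

definition loop_step ::
  "'i::finite ensemble \<Rightarrow> 'f::finite linear_filter \<Rightarrow> 'c::finite linear_controller \<Rightarrow> real \<Rightarrow>
   ('i, 'f, 'c) loop_state \<Rightarrow> ('i \<Rightarrow> nat) \<times> ('i \<Rightarrow> nat) \<Rightarrow> ('i, 'f, 'c) loop_state" where
  "loop_step A F C r = (\<lambda>(x, xf, xc) (j, l).
     (\<lambda>i. trans_map A i (j i) (x i),
      filt_A F *v xf + (\<Sum>i\<in>UNIV. out_map A i (l i) (x i)) *\<^sub>R filt_B F,
      ctrl_A C *v xc + loop_error F r xf *\<^sub>R ctrl_B C))"

definition loop_kernel ::
  "'i::finite ensemble \<Rightarrow> 'f::finite linear_filter \<Rightarrow> 'c::finite linear_controller \<Rightarrow> real \<Rightarrow>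
   ('i, 'f, 'c) loop_state \<Rightarrow> ('i, 'f, 'c) loop_state measure" where
  "loop_kernel A F C r s =
     distr (point_measure (loop_choices A) (\<lambda>c. ennreal (choice_prob A (broadcast F C r s) c)))
       (loop_space A) (loop_step A F C r s)"

end

theory Submission
  imports Defs "HOL-Computational_Algebra.Fundamental_Theorem_Algebra"
begin

text \<open>
  The agents together have finitely many states, and the pair \<open>v\<close> of the
  filter state and the controller state is moved by an affine map whose linear part \<open>M\<close> is the same
  for every choice of the agents. The matrix of \<open>M\<close> is block triangular with the two Schur matrices on the
  diagonal, so \<open>M\<close> contracts a suitable norm \<open>N\<close> by a factor \<open>\<rho> < 1\<close>
  (\<open>ex_adapted_norm\<close>, \<open>cascade_adapted_norm\<close>). Large \<open>N\<close>-balls are therefore invariant, and every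
  trajectory stays in a compact region.

  Let \<open>Q\<close> be the transition operator, which maps a function \<open>f\<close> to its mean after one step.
  Two states with the same agent states and with \<open>v\<close> and \<open>v'\<close> at distance \<open>t\<close> make the same choice
  up to an error given by the modulus of continuity of the choice probabilities at \<open>t\<close>, and after a common choice
  their distance is at most \<open>\<rho> t\<close>. Over arbitrarily many steps the errors add up to
  the sum of the modulus over the scales \<open>t \<rho>\<^sup>k\<close>, which is finite by the Dini condition.
  Hence the iterates \<open>Q\<^sup>n f\<close> of a continuous function are equicontinuous in \<open>v\<close>
  (\<open>equicontinuous_mean_op\<close>).

  If the adjacency matrix is primitive, then any two states can be steered, by choice sequences of a
  common length and with probability bounded below, first to a common agent state and then, by
  repeating one choice, arbitrarily close to each other. By equicontinuity this
  reduces the oscillation of \<open>Q\<^sup>n f\<close> on the region by a fixed factor, up to a small error. So \<open>Q\<^sup>n f\<close>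
  converges to a constant, uniformly on the region (\<open>uniform_limit_mean_op\<close>).

  An invariant measure comes from the argument of Krylov and Bogoliubov: \<open>Q\<close> preserves continuity, so
  a weak limit of averaged laws of a trajectory is invariant. The weak limit exists because the laws live on a
  compact set (\<open>compact_weakly_convergent_subsequence\<close>); this is derived from Helly's selection theorem on
  the real line by coding the compact set in a Cantor set.
  Attractivity and uniqueness are dominated convergence applied to \<open>Q\<^sup>n f\<close>, and
  uniqueness implies ergodicity. For the time averages, \<open>f (X (k + 1)) - Q f (X k)\<close> is a bounded
  martingale difference, so the averages of \<open>f\<close> and of \<open>Q\<^sup>j f\<close> along a trajectory have almost surely
  the same limit for every \<open>j\<close>, and \<open>Q\<^sup>j f\<close> is almost constant for large \<open>j\<close> (\<open>strong_law\<close>).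
\<close>

section \<open>Dini continuity along geometric scales\<close>

lemma modulus_of_continuity_mono:
  "s \<le> t \<Longrightarrow> modulus_of_continuity D p s \<le> modulus_of_continuity D p t"
  unfolding modulus_of_continuity_def by (rule SUP_subset_mono) auto

lemma modulus_of_continuity_le_1:
  assumes "p \<in> D \<rightarrow> {0..1}"
  shows "modulus_of_continuity D p t \<le> 1"
  unfolding modulus_of_continuity_def
proof (rule SUP_least, clarify)
  fix s s' assume "s \<in> D" "s' \<in> D"
  then have "p s \<in> {0..1}" "p s' \<in> {0..1}" using assms by auto
  then have "\<bar>p s - p s'\<bar> \<le> 1" by auto
  then show "ennreal \<bar>p s - p s'\<bar> \<le> 1" by (simp add: ennreal_le_1)
qed

text \<open>For a function with values in the unit interval the modulus of continuity is finite, and sums over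
  scales are handled more easily with real terms.\<close>

definition real_modulus :: "real set \<Rightarrow> (real \<Rightarrow> real) \<Rightarrow> real \<Rightarrow> real" where
  "real_modulus D p t = enn2real (modulus_of_continuity D p t)"

lemma ennreal_real_modulus:
  assumes "p \<in> D \<rightarrow> {0..1}"
  shows "ennreal (real_modulus D p t) = modulus_of_continuity D p t"
  unfolding real_modulus_def using modulus_of_continuity_le_1[OF assms, of t]
  by (metis ennreal_enn2real ennreal_one_less_top le_less_trans)

lemma real_modulus_nonneg: "0 \<le> real_modulus D p t"
  by (simp add: real_modulus_def)

lemma real_modulus_mono:
  assumes "p \<in> D \<rightarrow> {0..1}" "s \<le> t"
  shows "real_modulus D p s \<le> real_modulus D p t"
  using modulus_of_continuity_mono[OF assms(2), of D p] ennreal_real_modulus[OF assms(1)]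
  by (metis ennreal_le_iff real_modulus_nonneg)

lemma real_modulus_bound:
  assumes "p \<in> D \<rightarrow> {0..1}" "s \<in> D" "s' \<in> D" "\<bar>s - s'\<bar> \<le> t"
  shows "\<bar>p s - p s'\<bar> \<le> real_modulus D p t"
proof -
  have "ennreal \<bar>p s - p s'\<bar> \<le> modulus_of_continuity D p t"
    unfolding modulus_of_continuity_def
    using assms by (intro SUP_upper2[of "(s, s')"]) auto
  then show ?thesis
    unfolding ennreal_real_modulus[OF assms(1), symmetric]
    using real_modulus_nonneg ennreal_le_iff by blast
qed

text \<open>On the interval between \<open>\<rho>\<^sup>k\<^sup>+\<^sup>1\<close> and \<open>\<rho>\<^sup>k\<close>, which has length \<open>(1 - \<rho>) \<rho>\<^sup>k\<close>, the integrand is at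
  least \<open>w (\<rho>\<^sup>k\<^sup>+\<^sup>1) / \<rho>\<^sup>k\<close>.\<close>

lemma geometric_sum_le_nn_integral:
  fixes w :: "real \<Rightarrow> ennreal"
  assumes mono: "\<And>s t. s \<le> t \<Longrightarrow> w s \<le> w t" and "0 < \<rho>" "\<rho> < 1"
  shows "(\<Sum>k<n. ennreal (1 - \<rho>) * w (\<rho> ^ Suc k)) \<le> (\<integral>\<^sup>+ t \<in> {0<..1}. w t / ennreal t \<partial>lborel)"
proof -
  define I where "I k = {\<rho> ^ Suc k <.. \<rho> ^ k}" for k
  have pw: "(\<Sum>k<n. w (\<rho> ^ Suc k) / ennreal (\<rho> ^ k) * indicator (I k) t)
      \<le> w t / ennreal t * indicator {\<rho> ^ n <.. 1} t" for t
  proof (induction n)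
    case 0 show ?case by simp
  next
    case (Suc n)
    have le1: "\<rho> ^ n \<le> 1" "\<rho> ^ Suc n \<le> \<rho> ^ n"
      using assms by (auto intro: power_le_one simp: mult_le_cancel_right1)
    show ?case
    proof (cases "t \<in> I n")
      case True
      then have t: "\<rho> ^ Suc n < t" "t \<le> \<rho> ^ n" by (auto simp: I_def)
      then have "0 < t" using assms by (meson less_trans zero_less_power)
      have "(\<Sum>k<n. w (\<rho> ^ Suc k) / ennreal (\<rho> ^ k) * indicator (I k) t) = 0"
        using Suc t by (simp add: indicator_def split: if_splits)
      moreover have "w (\<rho> ^ Suc n) / ennreal (\<rho> ^ n) \<le> w t / ennreal t"
        unfolding divide_ennreal_def using mono[of "\<rho> ^ Suc n" t] t \<open>0 < t\<close> assms
        by (intro mult_mono) (auto simp: inverse_ennreal ennreal_leI simp del: ennreal_power power_Suc)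
      ultimately show ?thesis using True t le1
        by (simp del: power_Suc) 
    next
      case False
      have "indicator {\<rho> ^ n <.. 1} t \<le> (indicator {\<rho> ^ Suc n <.. 1} t :: ennreal)"
        using le1 by (auto simp: indicator_def)
      then have "w t / ennreal t * indicator {\<rho> ^ n <.. 1} t
          \<le> w t / ennreal t * indicator {\<rho> ^ Suc n <.. 1} t"
        by (intro mult_left_mono) auto
      then show ?thesis using Suc False by (simp del: power_Suc)
    qed
  qed
  have "(\<Sum>k<n. ennreal (1 - \<rho>) * w (\<rho> ^ Suc k))
      = (\<Sum>k<n. \<integral>\<^sup>+ t. w (\<rho> ^ Suc k) / ennreal (\<rho> ^ k) * indicator (I k) t \<partial>lborel)"
  proof (rule sum.cong[OF refl])
    fix k
    have p: "0 < \<rho> ^ k" using assms by simp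
    have "(\<integral>\<^sup>+ t. w (\<rho> ^ Suc k) / ennreal (\<rho> ^ k) * indicator (I k) t \<partial>lborel)
        = w (\<rho> ^ Suc k) / ennreal (\<rho> ^ k) * emeasure lborel (I k)"
      by (rule nn_integral_cmult_indicator) (simp add: I_def)
    also have "emeasure lborel (I k) = ennreal (\<rho> ^ k * (1 - \<rho>))"
      using assms p unfolding I_def
      by (subst emeasure_lborel_Ioc) (auto simp: algebra_simps mult_le_cancel_right1)
    also have "w (\<rho> ^ Suc k) / ennreal (\<rho> ^ k) * ennreal (\<rho> ^ k * (1 - \<rho>))
        = w (\<rho> ^ Suc k) * (ennreal (\<rho> ^ k) / ennreal (\<rho> ^ k)) * ennreal (1 - \<rho>)"
      using assms p by (simp add: ennreal_mult divide_ennreal_def mult_ac del: power_Suc)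
    also have "ennreal (\<rho> ^ k) / ennreal (\<rho> ^ k) = 1"
      using p by (intro ennreal_divide_self) (simp_all add: ennreal_eq_0_iff del: ennreal_power)
    finally show "ennreal (1 - \<rho>) * w (\<rho> ^ Suc k) =
        (\<integral>\<^sup>+ t. w (\<rho> ^ Suc k) / ennreal (\<rho> ^ k) * indicator (I k) t \<partial>lborel)"
      by (simp add: mult.commute)
  qed
  also have "\<dots> = (\<integral>\<^sup>+ t. (\<Sum>k<n. w (\<rho> ^ Suc k) / ennreal (\<rho> ^ k) * indicator (I k) t) \<partial>lborel)"
    by (rule nn_integral_sum[symmetric]) (simp add: I_def)
  also have "\<dots> \<le> (\<integral>\<^sup>+ t. w t / ennreal t * indicator {0<..1} t \<partial>lborel)"
  proof (rule nn_integral_mono)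
    fix t
    have "indicator {\<rho> ^ n <.. 1} t \<le> (indicator {0 <.. 1} t :: ennreal)"
      using zero_less_power[OF \<open>0 < \<rho>\<close>, of n] by (auto simp: indicator_def)
    then show "(\<Sum>k<n. w (\<rho> ^ Suc k) / ennreal (\<rho> ^ k) * indicator (I k) t)
        \<le> w t / ennreal t * indicator {0<..1} t"
      by (intro order.trans[OF pw]) (auto intro: mult_left_mono)
  qed
  finally show ?thesis .
qed

text \<open>The form in which the Dini condition is used: a contraction by \<open>\<rho>\<close> passes through the
  scales \<open>T \<rho>\<^sup>k\<close>, and the errors made at these scales have a finite sum. For large \<open>T\<close> the
  comparison with the integral over the unit interval holds after a shift of the index.\<close>

lemma dini_summable:
  assumes dini: "dini_continuous_on D p" and p: "p \<in> D \<rightarrow> {0..1}" and \<rho>: "0 < \<rho>" "\<rho> < 1"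
  shows "summable (\<lambda>k. real_modulus D p (T * \<rho> ^ k))"
proof -
  define J where "J = (\<integral>\<^sup>+ t \<in> {0<..1}. modulus_of_continuity D p t / ennreal t \<partial>lborel)"
  have J: "J < \<infinity>" using dini by (simp add: dini_continuous_on_def J_def)
  have "summable (\<lambda>k. (1 - \<rho>) * real_modulus D p (\<rho> ^ Suc k))"
  proof (rule bounded_imp_summable)
    fix k show "0 \<le> (1 - \<rho>) * real_modulus D p (\<rho> ^ Suc k)"
      using \<rho> by (simp add: real_modulus_nonneg)
  next
    fix n
    have "ennreal (\<Sum>k<Suc n. (1 - \<rho>) * real_modulus D p (\<rho> ^ Suc k))
        = (\<Sum>k<Suc n. ennreal (1 - \<rho>) * modulus_of_continuity D p (\<rho> ^ Suc k))"
      using \<rho> by (subst sum_ennreal[symmetric])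
        (auto simp: ennreal_mult real_modulus_nonneg ennreal_real_modulus[OF p] simp del: sum.lessThan_Suc)
    also have "\<dots> \<le> J"
      unfolding J_def
      by (rule geometric_sum_le_nn_integral) (use \<rho> in \<open>auto intro: modulus_of_continuity_mono\<close>)
    also have "J = ennreal (enn2real J)" using J by (simp add: less_top)
    finally show "(\<Sum>k\<le>n. (1 - \<rho>) * real_modulus D p (\<rho> ^ Suc k)) \<le> enn2real J"
      by (simp add: lessThan_Suc_atMost)
  qed
  then have "summable (\<lambda>k. real_modulus D p (\<rho> ^ Suc k))"
    using \<rho> by (subst (asm) summable_cmult_iff) auto
  then have *: "summable (\<lambda>k. real_modulus D p (\<rho> ^ k))"
    by (rule summable_Suc_iff[THEN iffD1])
  obtain m where m: "\<rho> ^ m * \<bar>T\<bar> \<le> 1"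
  proof -
    have "(\<lambda>m. \<rho> ^ m * \<bar>T\<bar>) \<longlonglongrightarrow> 0 * \<bar>T\<bar>"
      using \<rho> by (intro tendsto_mult LIMSEQ_power_zero tendsto_const) auto
    then have "\<forall>\<^sub>F m in sequentially. \<rho> ^ m * \<bar>T\<bar> < 1"
      by (intro order_tendstoD(2)) auto
    then show ?thesis using that by (auto simp: eventually_sequentially intro: less_imp_le)
  qed
  have "summable (\<lambda>k. real_modulus D p (T * \<rho> ^ (k + m)))"
  proof (rule summable_comparison_test'[OF *])
    fix k
    have "T * \<rho> ^ (k + m) \<le> \<rho> ^ k * (\<rho> ^ m * \<bar>T\<bar>)"
      using \<rho> by (simp add: power_add mult_ac mult_left_mono)
    also have "\<dots> \<le> \<rho> ^ k" using m \<rho> by (intro mult_left_le) auto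
    finally show "norm (real_modulus D p (T * \<rho> ^ (k + m))) \<le> real_modulus D p (\<rho> ^ k)"
      using p by (simp add: real_modulus_nonneg real_modulus_mono)
  qed
  then show ?thesis by (rule summable_iff_shift[THEN iffD1])
qed

section \<open>Powers of Schur matrices and adapted norms\<close>

text \<open>For \<open>a i = B\<^sup>i v\<close> this is the vector \<open>p(B) v\<close>.\<close>

definition poly_combination :: "(nat \<Rightarrow> complex ^ 'n) \<Rightarrow> complex poly \<Rightarrow> complex ^ 'n" where
  "poly_combination a p = (\<Sum>i\<le>degree p. coeff p i *s a i)"

lemma poly_combination_eq:
  assumes "degree p \<le> m"
  shows "poly_combination a p = (\<Sum>i\<le>m. coeff p i *s a i)"
  unfolding poly_combination_def using assms
  by (intro sum.mono_neutral_left) (auto simp: coeff_eq_0)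

lemma poly_combination_linear_factor:
  fixes B :: "complex ^ 'n ^ 'n"
  assumes a: "\<And>i. a (Suc i) = B *v a i"
  shows "poly_combination a ([:- z, 1:] * q) = B *v poly_combination a q - z *s poly_combination a q"
proof -
  let ?p = "[:- z, 1:] * q" and ?d = "degree q"
  have p: "?p = smult (- z) q + pCons 0 q" by simp
  have "degree ?p \<le> Suc ?d"
    by (rule order.trans[OF degree_mult_le]) auto
  then have "poly_combination a ?p = (\<Sum>i\<le>Suc ?d. coeff ?p i *s a i)"
    by (rule poly_combination_eq)
  also have "\<dots> = (\<Sum>i\<le>Suc ?d. (- z) *s (coeff q i *s a i)) + (\<Sum>i\<le>Suc ?d. coeff (pCons 0 q) i *s a i)"
    unfolding p coeff_add coeff_smult vector_sadd_rdistrib sum.distrib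
    by (simp add: vector_smult_assoc)
  also have "(\<Sum>i\<le>Suc ?d. (- z) *s (coeff q i *s a i)) = (- z) *s poly_combination a q"
    unfolding vec.scale_sum_right[symmetric] by (subst poly_combination_eq[of q "Suc ?d"]) auto
  also have "(\<Sum>i\<le>Suc ?d. coeff (pCons 0 q) i *s a i) = (\<Sum>i\<le>?d. coeff q i *s a (Suc i))"
    by (subst sum.atMost_Suc_shift) simp
  also have "\<dots> = B *v poly_combination a q"
    unfolding poly_combination_def a
    by (simp add: vec.linear_sum[OF matrix_vector_mul_linear_gen] matrix_vector_mult_scaleR vec.linear_scale[OF matrix_vector_mul_linear_gen])
  finally show ?thesis by (simp add: vec.scale_minus_left)
qed

text \<open>More vectors than the dimension are either not distinct or linearly dependent.\<close>

lemma ex_annihilating_poly: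
  fixes a :: "nat \<Rightarrow> complex ^ 'n"
  obtains p where "p \<noteq> 0" "poly_combination a p = 0"
proof (cases "inj_on a {..CARD('n)}")
  case False
  then obtain i j where ij: "i \<noteq> j" "a i = a j" by (auto simp: inj_on_def)
  let ?p = "monom 1 i - monom 1 j :: complex poly"
  have "poly_combination a ?p = (\<Sum>k\<le>max i j. coeff ?p k *s a k)"
    by (intro poly_combination_eq degree_diff_le) (auto intro: order.trans[OF degree_monom_le])
  also have "\<dots> = (\<Sum>k\<le>max i j. (if k = i then a k else 0)) - (\<Sum>k\<le>max i j. (if k = j then a k else 0))"
    unfolding sum_subtractf[symmetric] by (intro sum.cong refl) (auto simp: coeff_monom)
  also have "\<dots> = a i - a j"
    by (subst (1 2) sum.delta) auto
  finally have "poly_combination a ?p = 0" using ij by simp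
  moreover have "?p \<noteq> 0"
    using ij by (metis coeff_diff coeff_monom diff_zero one_neq_zero coeff_0)
  ultimately show ?thesis using that by blast
next
  case True
  let ?n = "CARD('n)"
  let ?S = "a ` {..?n}"
  have "card ?S = Suc ?n" using True by (simp add: card_image)
  then have "vec.dependent ?S"
    using vec.dim_subset_UNIV[of ?S] by (intro vec.dependent_biggerset_general) (simp add: vec.dimension_def card_cart_basis)
  then obtain u where u: "\<exists>v\<in>?S. u v \<noteq> 0" "(\<Sum>v\<in>?S. u v *s v) = 0"
    by (subst (asm) vec.dependent_finite) auto
  define p where "p = (\<Sum>i\<le>?n. monom (u (a i)) i)"
  have coeff: "coeff p i = (if i \<le> ?n then u (a i) else 0)" for i
    unfolding p_def coeff_sum coeff_monom by (simp add: sum.delta')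
  have "degree p \<le> ?n" by (rule degree_le) (simp add: coeff)
  then have "poly_combination a p = (\<Sum>i\<le>?n. u (a i) *s a i)"
    by (subst poly_combination_eq) (auto simp: coeff)
  also have "\<dots> = (\<Sum>v\<in>?S. u v *s v)" using True by (simp add: sum.reindex)
  finally have "poly_combination a p = 0" using u by simp
  moreover have "p \<noteq> 0" using u(1) coeff by (metis atMost_iff coeff_0 imageE)
  ultimately show ?thesis using that by blast
qed

text \<open>A nonzero polynomial \<open>p\<close> of least degree with \<open>p(B) v \<in> V\<close> is not constant, so it has a root \<open>z\<close>.
  The quotient \<open>q\<close> of \<open>p\<close> by the linear factor of \<open>z\<close> has smaller degree, hence
  \<open>w = q(B) v\<close> lies outside \<open>V\<close>.\<close>

lemma ex_eigenvector_mod_subspace: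
  fixes B :: "complex ^ 'n ^ 'n"
  assumes V: "vec.subspace V" "v \<notin> V"
  obtains z w where "w \<notin> V" "B *v w - z *s w \<in> V"
proof -
  define a where "a i = (((*v) B) ^^ i) v" for i
  have a: "a (Suc i) = B *v a i" for i by (simp add: a_def)
  let ?P = "\<lambda>p. p \<noteq> 0 \<and> poly_combination a p \<in> V"
  obtain p0 where "p0 \<noteq> 0" "poly_combination a p0 = 0" by (rule ex_annihilating_poly)
  then have "?P p0" using V by (simp add: vec.subspace_0)
  then obtain p where p: "?P p" and min: "\<And>q. ?P q \<Longrightarrow> degree p \<le> degree q"
    using ex_has_least_nat[of ?P p0 degree] by blast
  have "degree p \<noteq> 0"
  proof
    assume "degree p = 0"
    then obtain c where c: "p = [:c:]" by (rule degree_eq_zeroE)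
    then have "c *s v \<in> V" "c \<noteq> 0" using p by (auto simp: poly_combination_def a_def)
    have "inverse c *s (c *s v) \<in> V" by (rule vec.subspace_scale[OF V(1) \<open>c *s v \<in> V\<close>])
    moreover have "inverse c *s (c *s v) = v" using \<open>c \<noteq> 0\<close> by (simp add: vector_smult_assoc)
    ultimately show False using V by metis
  qed
  then have "\<not> constant (poly p)" by (simp add: constant_degree)
  then obtain z where "poly p z = 0" using fundamental_theorem_of_algebra by blast
  then obtain q where q: "p = [:- z, 1:] * q" by (auto simp: poly_eq_0_iff_dvd dvd_def)
  have "q \<noteq> 0" using p q by auto
  then have "degree p = Suc (degree q)" unfolding q by (subst degree_mult_eq) auto
  then have "poly_combination a q \<notin> V" using min[of q] \<open>q \<noteq> 0\<close> by auto
  moreover have "B *v poly_combination a q - z *s poly_combination a q \<in> V"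
    using p unfolding q poly_combination_linear_factor[where a=a and B=B, OF a] by simp
  ultimately show ?thesis by (rule that)
qed

lemma norm_vector_smult: "norm (c *s (x :: complex ^ 'n)) = cmod c * norm x"
  by (simp add: norm_vec_def norm_mult L2_set_right_distrib)

lemma perturbed_geometric_tendsto_0:
  fixes x e :: "nat \<Rightarrow> real"
  assumes x: "\<And>n. 0 \<le> x n" and rec: "\<And>n. x (Suc n) \<le> q * x n + e n" and q: "0 \<le> q" "q < 1" and e: "e \<longlonglongrightarrow> 0"
  shows "x \<longlonglongrightarrow> 0"
proof (rule LIMSEQ_I)
  fix \<epsilon> :: real assume "0 < \<epsilon>"
  then have "0 < \<epsilon> / 2 * (1 - q)" using q by simp
  then have "\<forall>\<^sub>F n in sequentially. e n < \<epsilon> / 2 * (1 - q)" using e by (rule order_tendstoD(2)[rotated])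
  then obtain M where M: "\<And>n. n \<ge> M \<Longrightarrow> e n < \<epsilon> / 2 * (1 - q)" by (auto simp: eventually_sequentially)
  have bound: "x (M + k) \<le> q ^ k * x M + \<epsilon> / 2" for k
  proof (induction k)
    case 0 then show ?case using \<open>0 < \<epsilon>\<close> by simp
  next
    case (Suc k)
    have "x (M + Suc k) \<le> q * x (M + k) + \<epsilon> / 2 * (1 - q)"
      using rec[of "M + k"] M[of "M + k"] by simp
    also have "\<dots> \<le> q * (q ^ k * x M + \<epsilon> / 2) + \<epsilon> / 2 * (1 - q)"
      using Suc q by (intro add_right_mono mult_left_mono) auto
    also have "\<dots> = q ^ Suc k * x M + \<epsilon> / 2" by (simp add: field_simps)
    finally show ?case .
  qed
  have "(\<lambda>k. q ^ k * x M) \<longlonglongrightarrow> 0 * x M"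
    using q by (intro tendsto_mult LIMSEQ_power_zero tendsto_const) auto
  then have "\<forall>\<^sub>F k in sequentially. q ^ k * x M < \<epsilon> / 2"
    using \<open>0 < \<epsilon>\<close> by (intro order_tendstoD(2)) auto
  then obtain k0 where k0: "\<And>k. k \<ge> k0 \<Longrightarrow> q ^ k * x M < \<epsilon> / 2" by (auto simp: eventually_sequentially)
  have "norm (x n - 0) < \<epsilon>" if "n \<ge> M + k0" for n
  proof -
    have n: "n = M + (n - M)" using that by simp
    show ?thesis using bound[of "n - M"] k0[of "n - M"] x[of n] that n by simp
  qed
  then show "\<exists>no. \<forall>n\<ge>no. norm (x n - 0) < \<epsilon>" by blast
qed

text \<open>The vectors whose images under the powers of \<open>B\<close> tend to 0 form an invariant subspace \<open>V\<close>. If it were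
  proper, \<open>B\<close> would have an eigenvector \<open>w\<close> modulo \<open>V\<close> with eigenvalue \<open>z\<close>. If \<open>|z| < 1\<close>,
  then \<open>B\<^sup>n w\<close> satisfies a contracting recursion with a perturbation that tends to 0, so \<open>w \<in> V\<close>.
  Otherwise \<open>z\<close> is not an eigenvalue, so \<open>B - z\<close> is injective and maps \<open>V\<close> onto itself, which again
  puts \<open>w\<close> into \<open>V\<close>.\<close>

lemma complex_powers_tendsto_0:
  fixes B :: "complex ^ 'n ^ 'n"
  assumes eigen: "\<And>z v. v \<noteq> 0 \<Longrightarrow> B *v v = z *s v \<Longrightarrow> cmod z < 1"
  shows "(\<lambda>n. (((*v) B) ^^ n) v) \<longlonglongrightarrow> 0"
proof (rule ccontr)
  define P where "P n = (((*v) B) ^^ n)" for n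
  define V where "V = {v. (\<lambda>n. P n v) \<longlonglongrightarrow> 0}"
  have lin: "Vector_Spaces.linear (*s) (*s) (P n)" for n
    unfolding P_def
  proof (induction n)
    case 0 then show ?case by (simp add: vec.linear_id id_def[symmetric])
  next
    case (Suc n)
    show ?case unfolding funpow.simps(2)
      by (rule Vector_Spaces.linear_compose[OF Suc matrix_vector_mul_linear_gen])
  qed
  have P_Suc: "P (Suc n) v = P n (B *v v)" for n v by (simp add: P_def funpow_swap1)
  have V: "vec.subspace V"
    unfolding vec.subspace_def
  proof (intro conjI ballI allI)
    show "0 \<in> V" by (simp add: V_def vec.linear_0[OF lin])
    show "x + y \<in> V" if "x \<in> V" "y \<in> V" for x y
      using tendsto_add[of "\<lambda>n. P n x" 0 _ "\<lambda>n. P n y" 0] that by (simp add: V_def vec.linear_add[OF lin])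
    show "c *s x \<in> V" if "x \<in> V" for c x
    proof -
      have "(\<lambda>n. cmod c * norm (P n x)) \<longlonglongrightarrow> cmod c * 0"
        using that by (intro tendsto_mult tendsto_const tendsto_norm_zero) (simp add: V_def)
      then have "(\<lambda>n. norm (P n (c *s x))) \<longlonglongrightarrow> 0"
        by (simp add: vec.linear_scale[OF lin] norm_vector_smult)
      then show ?thesis unfolding V_def by (simp add: tendsto_norm_zero_iff)
    qed
  qed
  have inv: "B *v x \<in> V" if "x \<in> V" for x
    using LIMSEQ_Suc[of "\<lambda>n. P n x" 0] that by (simp add: V_def P_Suc)
  assume "\<not> (\<lambda>n. (((*v) B) ^^ n) v) \<longlonglongrightarrow> 0"
  then have "v \<notin> V" by (simp add: V_def P_def)
  then obtain z w where w: "w \<notin> V" "B *v w - z *s w \<in> V"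
    using ex_eigenvector_mod_subspace[OF V] by blast
  define T where "T x = B *v x - z *s x" for x
  have T: "Vector_Spaces.linear (*s) (*s) T"
    unfolding T_def by (intro vec.linear_compose_sub matrix_vector_mul_linear_gen vec.linear_scale_self)
  show False
  proof (cases "cmod z < 1")
    case True
    have "(\<lambda>n. norm (P n w)) \<longlonglongrightarrow> 0"
    proof (rule perturbed_geometric_tendsto_0[where q="cmod z" and e="\<lambda>n. norm (P n (T w))"])
      show "(\<lambda>n. norm (P n (T w))) \<longlonglongrightarrow> 0"
        using w by (intro tendsto_norm_zero) (simp add: V_def T_def)
      fix n
      have "P (Suc n) w = z *s P n w + P n (T w)"
        unfolding P_Suc T_def by (simp add: vec.linear_diff[OF lin] vec.linear_scale[OF lin])
      then show "norm (P (Suc n) w) \<le> cmod z * norm (P n w) + norm (P n (T w))"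
        by (metis norm_triangle_ineq norm_vector_smult)
    qed (use True in auto)
    then show False using w by (simp add: V_def tendsto_norm_zero_iff)
  next
    case False
    have inj: "inj T"
      unfolding vec.linear_inj_iff_eq_0[OF T] T_def using eigen False by auto
    have sub: "T ` V \<subseteq> V"
      using inv V by (auto simp: T_def intro!: vec.subspace_diff vec.subspace_scale)
    have "T ` V = V"
    proof (rule vec.subspace_dim_equal[OF _ V sub])
      show "vec.subspace (T ` V)" by (rule vec.linear_subspace_image[OF T V])
      show "vec.dim V \<le> vec.dim (T ` V)"
        using vec.dim_image_eq[OF T inj_on_subset[OF inj subset_UNIV]] by simp
    qed
    moreover have "T w \<in> V" using w by (simp add: T_def)
    ultimately obtain x where "x \<in> V" "T w = T x" by blast
    then show False using inj w by (auto dest: injD)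
  qed
qed

lemma schur_powers_tendsto_0:
  fixes A :: "real ^ 'n ^ 'n"
  assumes "schur A"
  shows "(\<lambda>n. (((*v) A) ^^ n) v) \<longlonglongrightarrow> 0"
proof -
  define B where "B = map_matrix complex_of_real A"
  define cv where "cv = (\<lambda>v :: real ^ 'n. \<chi> i. complex_of_real (v $ i))"
  have step: "B *v cv v = cv (A *v v)" for v
    by (simp add: B_def cv_def vec_eq_iff matrix_vector_mult_def)
  have "(((*v) B) ^^ n) (cv v) = cv ((((*v) A) ^^ n) v)" for n
    by (induction n) (simp_all add: step)
  moreover have "norm (cv v) = norm v" for v by (simp add: cv_def norm_vec_def)
  moreover have "(\<lambda>n. norm ((((*v) B) ^^ n) (cv v))) \<longlonglongrightarrow> 0"
  proof (intro tendsto_norm_zero complex_powers_tendsto_0)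
    show "cmod z < 1" if "w \<noteq> 0" "B *v w = z *s w" for z w
      using assms that unfolding schur_def complex_eigenvalue_def B_def by blast
  qed
  ultimately show ?thesis by (simp add: tendsto_norm_zero_iff)
qed

text \<open>A Schur matrix need not contract the Euclidean norm. In an equivalent norm it contracts
  in every single step, which is what trajectories with random inputs require.\<close>

definition adapted_norm :: "('v::real_normed_vector \<Rightarrow> 'v) \<Rightarrow> real \<Rightarrow> ('v \<Rightarrow> real) \<Rightarrow> bool" where
  "adapted_norm f \<rho> N \<longleftrightarrow>
     (\<forall>u v. N (u + v) \<le> N u + N v) \<and> (\<forall>c v. N (c *\<^sub>R v) = \<bar>c\<bar> * N v) \<and>
     (\<forall>v. norm v \<le> N v) \<and> (\<exists>c. \<forall>v. N v \<le> c * norm v) \<and> (\<forall>v. N (f v) \<le> \<rho> * N v)"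

lemma adapted_normD:
  assumes "adapted_norm f \<rho> N"
  shows "N (u + v) \<le> N u + N v" "N (c *\<^sub>R v) = \<bar>c\<bar> * N v" "norm v \<le> N v" "N (f v) \<le> \<rho> * N v"
    "N 0 = 0" "0 \<le> N v" "N (u - v) \<le> N u + N v"
proof -
  show add: "N (u + v) \<le> N u + N v" and scale: "N (c *\<^sub>R v) = \<bar>c\<bar> * N v"
    and "norm v \<le> N v" "N (f v) \<le> \<rho> * N v" for u v c
    using assms by (auto simp: adapted_norm_def)
  then show "0 \<le> N v" using norm_ge_zero[of v] by (meson order.trans)
  show "N 0 = 0" using scale[of 0 0] by simp
  show "N (u - v) \<le> N u + N v" using add[of u "- 1 *\<^sub>R v"] scale[of "- 1" v] by simp
qed

lemma compact_adapted_ball: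
  fixes N :: "'v::euclidean_space \<Rightarrow> real"
  assumes N: "adapted_norm f \<rho> N"
  shows "compact {v. N v \<le> R}"
proof -
  obtain c where c: "\<And>v. N v \<le> c * norm v" using N by (auto simp: adapted_norm_def)
  have "0 \<le> \<bar>c\<bar>" by simp
  have lip: "\<bar>N u - N v\<bar> \<le> \<bar>c\<bar> * dist u v" for u v
  proof -
    have *: "N a - N b \<le> \<bar>c\<bar> * dist a b" for a b
    proof -
      have "N a \<le> N b + N (a - b)" using adapted_normD(1)[OF N, of b "a - b"] by simp
      moreover have "N (a - b) \<le> \<bar>c\<bar> * dist a b"
        unfolding dist_norm by (rule order.trans[OF c mult_right_mono]) auto
      ultimately show ?thesis by linarith
    qed
    show ?thesis using *[of u v] *[of v u] by (simp add: dist_commute abs_le_iff)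
  qed
  have "\<bar>c\<bar>-lipschitz_on UNIV N"
    by (rule lipschitz_onI) (use lip in \<open>auto simp: dist_real_def\<close>)
  then have "continuous_on UNIV N" by (rule lipschitz_on_continuous_on)
  then have "closed {v. N v \<le> R}"
    by (intro closed_Collect_le continuous_on_const)
  moreover have "bounded {v. N v \<le> R}"
    using adapted_normD(3)[OF N] unfolding bounded_iff by (auto intro: order.trans)
  ultimately show ?thesis by (simp add: compact_eq_bounded_closed)
qed

text \<open>Some power \<open>f\<^sup>m\<close> halves the norm. With \<open>\<rho>\<^sup>m = 1/2\<close>, the weighted sum of the first \<open>m\<close> iterates
  contracts: applying \<open>f\<close> shifts the sum by one place, and the new last term is at
  most the first term, which is lost.\<close>

lemma ex_adapted_norm:
  fixes f :: "'v::euclidean_space \<Rightarrow> 'v"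
  assumes f: "linear f" and powers: "\<And>v. (\<lambda>n. (f ^^ n) v) \<longlonglongrightarrow> 0"
  obtains \<rho> N where "0 < \<rho>" "\<rho> < 1" "adapted_norm f \<rho> N"
proof -
  have lin: "linear (f ^^ n)" for n
  proof (induction n)
    case 0 show ?case by (simp add: linear_iff)
  next
    case (Suc n) show ?case unfolding funpow.simps(2) by (rule linear_compose[OF Suc f])
  qed
  have "(\<lambda>n. \<Sum>b\<in>Basis. norm ((f ^^ n) b)) \<longlonglongrightarrow> (\<Sum>b\<in>(Basis :: 'v set). 0)"
    by (intro tendsto_sum tendsto_norm_zero powers)
  then have "\<forall>\<^sub>F n in sequentially. (\<Sum>b\<in>Basis. norm ((f ^^ n) b)) < 1/2"
    by (intro order_tendstoD(2)) auto
  then obtain m0 where m0: "\<And>n. n \<ge> m0 \<Longrightarrow> (\<Sum>b\<in>Basis. norm ((f ^^ n) b)) < 1/2"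
    by (auto simp: eventually_sequentially)
  define m where "m = Suc m0"
  have half: "norm ((f ^^ m) v) \<le> 1/2 * norm v" for v
  proof -
    have "(f ^^ m) v = (\<Sum>b\<in>Basis. (v \<bullet> b) *\<^sub>R (f ^^ m) b)"
      by (subst euclidean_representation[of v, symmetric])
        (simp add: linear_sum[OF lin] linear_scale[OF lin])
    also have "norm \<dots> \<le> (\<Sum>b\<in>Basis. norm v * norm ((f ^^ m) b))"
      by (intro sum_norm_le) (auto intro!: mult_right_mono Basis_le_norm)
    also have "\<dots> = norm v * (\<Sum>b\<in>Basis. norm ((f ^^ m) b))" by (simp add: sum_distrib_left)
    also have "\<dots> \<le> norm v * (1/2)" using m0[of m] by (intro mult_left_mono) (auto simp: m_def)
    finally show ?thesis by simp
  qed
  define \<rho> where "\<rho> = root m (1/2)"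
  have "0 < m" by (simp add: m_def)
  then have \<rho>: "0 < \<rho>" "\<rho> < 1" "\<rho> ^ m = 1/2" unfolding \<rho>_def by (simp_all add: real_root_pow_pos2)
  define N where "N v = (\<Sum>k<m. norm ((f ^^ k) v) / \<rho> ^ k)" for v
  have "adapted_norm f \<rho> N"
    unfolding adapted_norm_def
  proof (intro conjI allI)
    show "N (u + v) \<le> N u + N v" for u v
      unfolding N_def sum.distrib[symmetric] using \<rho>
      by (intro sum_mono) (auto simp: linear_add[OF lin] add_divide_distrib[symmetric] intro!: divide_right_mono norm_triangle_ineq)
    show "N (c *\<^sub>R v) = \<bar>c\<bar> * N v" for c v
      unfolding N_def sum_distrib_left by (simp add: linear_scale[OF lin])
    show "norm v \<le> N v" for v
      unfolding N_def using member_le_sum[of 0 "{..<m}" "\<lambda>k. norm ((f ^^ k) v) / \<rho> ^ k"] \<rho> by (auto simp: m_def)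
    have "\<exists>c. \<forall>v. norm ((f ^^ k) v) \<le> c * norm v" for k
      using linear_bounded[OF lin] by blast
    then obtain c where c: "\<And>k v. norm ((f ^^ k) v) \<le> c k * norm v" by metis
    show "\<exists>c. \<forall>v. N v \<le> c * norm v"
    proof (intro exI allI)
      show "N v \<le> (\<Sum>k<m. c k / \<rho> ^ k) * norm v" for v
        unfolding N_def sum_distrib_right using c \<rho>
        by (intro sum_mono) (auto simp: field_simps)
    qed
    show "N (f v) \<le> \<rho> * N v" for v
    proof -
      have "N (f v) = (\<Sum>k<m. \<rho> * (norm ((f ^^ Suc k) v) / \<rho> ^ Suc k))"
        unfolding N_def using \<rho> by (intro sum.cong refl) (simp add: funpow_swap1)
      also have "\<dots> = \<rho> * (\<Sum>k<m. norm ((f ^^ Suc k) v) / \<rho> ^ Suc k)" by (simp add: sum_distrib_left)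
      also have "(\<Sum>k<m. norm ((f ^^ Suc k) v) / \<rho> ^ Suc k) = (\<Sum>k<Suc m. norm ((f ^^ k) v) / \<rho> ^ k) - norm v"
        by (subst sum.lessThan_Suc_shift) simp
      also have "\<dots> = N v + (norm ((f ^^ m) v) / \<rho> ^ m - norm v)"
        by (simp add: N_def)
      also have "\<dots> \<le> N v" using half[of v] unfolding \<rho>(3) by simp
      finally show ?thesis using \<rho> by simp
    qed
  qed
  then show ?thesis using \<rho> that by blast
qed

lemma adapted_norm_mono:
  assumes "adapted_norm f \<rho> N" "\<rho> \<le> \<rho>'"
  shows "adapted_norm f \<rho>' N"
proof -
  have "\<rho> * N v \<le> \<rho>' * N v" for v
    using assms order.trans[OF norm_ge_zero[of v], of "N v"] unfolding adapted_norm_def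
    by (intro mult_right_mono) auto
  then show ?thesis using assms unfolding adapted_norm_def by (meson order.trans)
qed

text \<open>The filter drives the controller but not conversely. A large weight \<open>l\<close> on the filter component makes the
  coupling small compared with the gap between \<open>\<rho>0\<close> and \<open>\<rho>\<close>.\<close>

lemma cascade_adapted_norm:
  fixes f :: "'u::euclidean_space \<Rightarrow> 'u" and g :: "'v::euclidean_space \<Rightarrow> 'v"
  assumes f: "adapted_norm f \<rho>1 N1" "0 < \<rho>1" "\<rho>1 < 1" and g: "adapted_norm g \<rho>2 N2" "0 < \<rho>2" "\<rho>2 < 1"
  obtains \<rho> N where "0 < \<rho>" "\<rho> < 1" "adapted_norm (\<lambda>(u, v). (f u, g v - (c \<bullet> u) *\<^sub>R b)) \<rho> N"
proof -
  define \<rho>0 where "\<rho>0 = max \<rho>1 \<rho>2"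
  have \<rho>0: "0 < \<rho>0" "\<rho>0 < 1" using f g by (auto simp: \<rho>0_def)
  note N1 = adapted_normD[OF adapted_norm_mono[OF f(1) max.cobounded1[of \<rho>1 \<rho>2], folded \<rho>0_def]]
  note N2 = adapted_normD[OF adapted_norm_mono[OF g(1) max.cobounded2[of \<rho>2 \<rho>1], folded \<rho>0_def]]
  note nonneg = N1(6) N2(6)
  obtain c1 c2 where c1: "\<And>u. N1 u \<le> c1 * norm u" and c2: "\<And>v. N2 v \<le> c2 * norm v"
    using f(1) g(1) unfolding adapted_norm_def by blast
  define \<kappa> where "\<kappa> = norm c * N2 b"
  have \<kappa>: "0 \<le> \<kappa>" unfolding \<kappa>_def using nonneg by simp
  define \<rho> where "\<rho> = (1 + \<rho>0) / 2"
  have \<rho>: "0 < \<rho>" "\<rho> < 1" "\<rho>0 \<le> \<rho>" using \<rho>0 by (auto simp: \<rho>_def)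
  define l where "l = max 1 (\<kappa> / (\<rho> - \<rho>0))"
  have l: "1 \<le> l" "\<kappa> \<le> (\<rho> - \<rho>0) * l"
  proof -
    have "\<rho> - \<rho>0 > 0" using \<rho>0 by (simp add: \<rho>_def)
    moreover have "\<kappa> / (\<rho> - \<rho>0) \<le> l" by (simp add: l_def)
    ultimately show "\<kappa> \<le> (\<rho> - \<rho>0) * l" by (simp add: pos_divide_le_eq mult.commute)
  qed (simp add: l_def)
  define N where "N = (\<lambda>(u, v). l * N1 u + N2 v)"
  have "adapted_norm (\<lambda>(u, v). (f u, g v - (c \<bullet> u) *\<^sub>R b)) \<rho> N"
    unfolding adapted_norm_def
  proof (intro conjI allI)
    show "N (x + y) \<le> N x + N y" for x y
    proof -
      have "l * N1 (fst x + fst y) \<le> l * (N1 (fst x) + N1 (fst y))"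
        using l N1(1) by (intro mult_left_mono) auto
      then show ?thesis using N2(1)[of "snd x" "snd y"]
        by (simp add: N_def split_beta algebra_simps)
    qed
    show "N (t *\<^sub>R x) = \<bar>t\<bar> * N x" for t x
      by (simp add: N_def split_beta N1(2) N2(2) algebra_simps)
    show "norm x \<le> N x" for x
    proof -
      have "norm x \<le> norm (fst x) + norm (snd x)"
        using norm_Pair_le[of "fst x" "snd x"] by simp
      also have "\<dots> \<le> l * N1 (fst x) + N2 (snd x)"
        using N1(3)[of "fst x"] N2(3)[of "snd x"] mult_right_mono[OF l(1) nonneg(1)[of "fst x"]] by linarith
      finally show ?thesis by (simp add: N_def split_beta)
    qed
    show "\<exists>k. \<forall>x. N x \<le> k * norm x"
    proof (intro exI allI)
      fix x :: "'u \<times> 'v"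
      have "N1 (fst x) \<le> \<bar>c1\<bar> * norm x"
        using norm_fst_le[of "fst x" "snd x"] by (intro order.trans[OF c1] mult_mono) auto
      moreover have "N2 (snd x) \<le> \<bar>c2\<bar> * norm x"
        using norm_snd_le[of "snd x" "fst x"] by (intro order.trans[OF c2] mult_mono) auto
      moreover have "l * N1 (fst x) \<le> l * (\<bar>c1\<bar> * norm x)"
        using l \<open>N1 (fst x) \<le> \<bar>c1\<bar> * norm x\<close> by (intro mult_left_mono) auto
      ultimately show "N x \<le> (l * \<bar>c1\<bar> + \<bar>c2\<bar>) * norm x"
        by (simp add: N_def split_beta algebra_simps)
    qed
    fix x :: "'u \<times> 'v"
    obtain u v where x: "x = (u, v)" by force
    have "N2 (g v - (c \<bullet> u) *\<^sub>R b) \<le> N2 (g v) + \<bar>c \<bullet> u\<bar> * N2 b"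
      using N2(1)[of "g v" "(- (c \<bullet> u)) *\<^sub>R b"] N2(2)[of "- (c \<bullet> u)" b] by simp
    also have "\<bar>c \<bullet> u\<bar> * N2 b \<le> (norm c * N1 u) * N2 b"
      using Cauchy_Schwarz_ineq2[of c u] N1(3)[of u] nonneg
      by (intro mult_right_mono order.trans[OF Cauchy_Schwarz_ineq2] mult_left_mono) auto
    also have "\<dots> = \<kappa> * N1 u" by (simp add: \<kappa>_def)
    also have "\<dots> \<le> ((\<rho> - \<rho>0) * l) * N1 u" using l nonneg by (intro mult_right_mono) auto
    finally have "N2 (g v - (c \<bullet> u) *\<^sub>R b) \<le> \<rho>0 * N2 v + ((\<rho> - \<rho>0) * l) * N1 u"
      using N2(4)[of v] by simp
    moreover have "l * N1 (f u) \<le> l * (\<rho>0 * N1 u)" using l N1(4) by (intro mult_left_mono) auto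
    moreover have "\<rho>0 * N2 v \<le> \<rho> * N2 v" using \<rho> nonneg by (intro mult_right_mono) auto
    ultimately show "N (case x of (u, v) \<Rightarrow> (f u, g v - (c \<bullet> u) *\<^sub>R b)) \<le> \<rho> * N x"
      by (simp add: N_def x algebra_simps)
  qed
  then show ?thesis using \<rho> that by blast
qed

section \<open>Weak compactness of probability measures on a compact set\<close>

text \<open>The indicator of a closed set is a decreasing limit of continuous functions with values in the
  unit interval.\<close>

lemma borel_measures_eqI_continuous:
  fixes M N :: "'a::metric_space measure"
  assumes M: "prob_space M" "sets M = sets borel" and N: "prob_space N" "sets N = sets borel"
    and eq: "\<And>f :: 'a \<Rightarrow> real. continuous_on UNIV f \<Longrightarrow> (\<And>x. 0 \<le> f x \<and> f x \<le> 1) \<Longrightarrow> integral\<^sup>L M f = integral\<^sup>L N f"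
  shows "M = N"
proof (rule measure_eqI_generator_eq[where E="Collect closed" and \<Omega>=UNIV and A="\<lambda>_. UNIV"])
  interpret M: prob_space M by (rule M)
  interpret N: prob_space N by (rule N)
  show "Int_stable (Collect closed)" by (auto simp: Int_stable_def)
  show "sets M = sigma_sets UNIV (Collect closed)" "sets N = sigma_sets UNIV (Collect closed)"
    using M N by (simp_all add: borel_eq_closed)
  show "emeasure M X = emeasure N X" if "X \<in> Collect closed" for X
  proof (cases "X = {}")
    case False
    have X: "closed X" "X \<in> sets M" "X \<in> sets N" using that M N by auto
    define f where "f n x = max 0 (1 - real n * infdist x X)" for n x
    have f_cont: "continuous_on UNIV (f n)" for n
      unfolding f_def by (intro continuous_intros)
    have f_bounds: "0 \<le> f n x \<and> f n x \<le> 1" for n x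
      unfolding f_def using infdist_nonneg[of x X] by (auto simp: max_def)
    have f_lim: "(\<lambda>n. f n x) \<longlonglongrightarrow> indicator X x" for x
    proof (cases "x \<in> X")
      case True then show ?thesis by (simp add: f_def)
    next
      case False
      then have "0 < infdist x X"
        using infdist_pos_not_in_closed[OF X(1)] \<open>X \<noteq> {}\<close> by auto
      then obtain n0 where n0: "1 < real n0 * infdist x X"
        using reals_Archimedean3 by blast
      have "f n x = 0" if "n \<ge> n0" for n
      proof -
        have "real n0 * infdist x X \<le> real n * infdist x X"
          using that by (intro mult_right_mono infdist_nonneg) auto
        then show ?thesis using n0 by (simp add: f_def)
      qed
      then have "\<forall>\<^sub>F n in sequentially. f n x = indicator X x"
        using False by (auto simp: eventually_sequentially)
      then show ?thesis by (rule tendsto_eventually)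
    qed
    have lim: "(\<lambda>n. integral\<^sup>L Q (f n)) \<longlonglongrightarrow> measure Q X"
      if Q: "prob_space Q" "sets Q = sets borel" for Q :: "'a measure"
    proof -
      interpret Q: prob_space Q by (rule Q)
      have [measurable]: "X \<in> sets Q" using X Q by simp
      have "(\<lambda>n. integral\<^sup>L Q (f n)) \<longlonglongrightarrow> integral\<^sup>L Q (indicator X)"
      proof (rule integral_dominated_convergence[where w="\<lambda>_. 1"])
        show "f n \<in> borel_measurable Q" for n
          using borel_measurable_continuous_onI[OF f_cont] Q by (simp cong: measurable_cong_sets)
      qed (use f_lim f_bounds X Q in auto)
      then show ?thesis using X Q by simp
    qed
    have "measure M X = measure N X"
      using lim[OF M] lim[OF N] eq[OF f_cont f_bounds] by (auto intro: LIMSEQ_unique)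
    then show ?thesis by (simp add: M.emeasure_eq_measure N.emeasure_eq_measure)
  qed simp
  show "emeasure M UNIV \<noteq> \<infinity>" by simp
qed auto

text \<open>The truncated distance to \<open>C\<close> is bounded and continuous. Its integral passes to weak limits, and so
  does, by this lemma, the property of being carried by \<open>C\<close>.\<close>

lemma AE_mem_closed_if_infdist_zero:
  fixes M :: "real measure"
  assumes M: "prob_space M" and sets: "sets M = sets borel" and C: "closed C" "C \<noteq> {}"
    and zero: "(\<integral>u. min 1 (infdist u C) \<partial>M) = 0"
  shows "AE u in M. u \<in> C"
proof -
  interpret prob_space M by (rule M)
  have "(\<lambda>u. min 1 (infdist u C)) \<in> borel_measurable borel"
    by (intro borel_measurable_continuous_onI continuous_intros)
  then have [measurable]: "(\<lambda>u. min 1 (infdist u C)) \<in> borel_measurable M"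
    using sets by (simp cong: measurable_cong_sets)
  have "integrable M (\<lambda>u. min 1 (infdist u C))"
    by (intro integrable_const_bound[of _ 1] AE_I2) (auto simp: infdist_nonneg)
  then have "AE u in M. min 1 (infdist u C) = 0"
    using zero by (subst (asm) integral_nonneg_eq_0_iff_AE) (auto simp: infdist_nonneg)
  then show ?thesis
  proof (rule AE_mp, intro AE_I2 impI)
    fix u assume "min 1 (infdist u C) = 0"
    then have "infdist u C = 0" by (auto simp: min_def split: if_splits)
    then show "u \<in> C" using in_closed_iff_infdist_zero[OF C] by simp
  qed
qed

text \<open>A point of a Cantor set records in which of the sets \<open>U j\<close> the argument lies. The base 3 leaves gaps,
  so that two points with close codes belong to the same sets up to a large index.\<close>

definition ternary_code :: "(nat \<Rightarrow> 'a set) \<Rightarrow> 'a \<Rightarrow> real" where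
  "ternary_code U x = (\<Sum>j. (1/3) ^ j * indicator (U j) x)"

lemma summable_ternary_digits: "summable (\<lambda>j. (1/3) ^ j * indicator (U j) x :: real)"
  by (rule summable_comparison_test'[OF summable_geometric[of "1/3::real"]]) (auto simp: indicator_def)

lemma ternary_code_bounds: "0 \<le> ternary_code U x" "ternary_code U x \<le> 3/2"
proof -
  show "0 \<le> ternary_code U x"
    unfolding ternary_code_def by (intro suminf_nonneg summable_ternary_digits) auto
  have "ternary_code U x \<le> (\<Sum>j. (1/3) ^ j)"
    unfolding ternary_code_def
    by (intro suminf_le summable_ternary_digits summable_geometric) (auto simp: indicator_def)
  then show "ternary_code U x \<le> 3/2" by (simp add: suminf_geometric)
qed

lemma borel_measurable_ternary_code:
  fixes U :: "nat \<Rightarrow> 'a::topological_space set"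
  assumes "\<And>j. open (U j)"
  shows "ternary_code U \<in> borel_measurable borel"
  unfolding ternary_code_def[abs_def] using assms by (intro borel_measurable_suminf) auto

text \<open>At the first index \<open>j\<close> where the digits differ the codes move apart by \<open>3\<^sup>-\<^sup>j\<close>, and all later digits
  together can undo at most half of this.\<close>

lemma ternary_code_separates:
  assumes close: "\<bar>ternary_code U x - ternary_code U y\<bar> \<le> (1/3) ^ m" and "j < m"
  shows "x \<in> U j \<longleftrightarrow> y \<in> U j"
  using \<open>j < m\<close>
proof (induction j rule: less_induct)
  case (less j)
  define d where "d i = ((1/3) ^ i * indicator (U i) x - (1/3) ^ i * indicator (U i) y :: real)" for i
  have d: "summable d" unfolding d_def by (intro summable_diff summable_ternary_digits)
  have d_le: "\<bar>d i\<bar> \<le> (1/3) ^ i" for i by (auto simp: d_def indicator_def)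
  show ?case
  proof (rule ccontr)
    assume neq: "\<not> ?case"
    have "d i = 0" if "i < j" for i using less.IH[OF that] that less.prems by (auto simp: d_def indicator_def)
    then have "(\<Sum>i<Suc j. d i) = d j" by simp
    moreover have "suminf d = (\<Sum>i. d (i + Suc j)) + (\<Sum>i<Suc j. d i)"
      by (rule suminf_split_initial_segment[OF d])
    ultimately have sd: "suminf d = (\<Sum>i. d (i + Suc j)) + d j" by simp
    have geo: "(\<lambda>i. (1/3) ^ (i + Suc j)) sums ((1/3) ^ j / 2 :: real)"
      using sums_mult2[OF geometric_sums[of "1/3::real"], of "(1/3) ^ Suc j"] by (simp add: power_add)
    have "\<bar>\<Sum>i. d (i + Suc j)\<bar> \<le> (\<Sum>i. (1/3) ^ (i + Suc j))"
      by (rule norm_suminf_le[where 'a=real, unfolded real_norm_def]) (rule d_le, rule sums_summable[OF geo])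
    also have "\<dots> = (1/3) ^ j / 2" using geo by (simp add: sums_iff)
    finally have "\<bar>suminf d\<bar> \<ge> \<bar>d j\<bar> - (1/3) ^ j / 2" using sd by linarith
    moreover have "\<bar>d j\<bar> = (1/3) ^ j" using neq by (auto simp: d_def indicator_def)
    moreover have "suminf d = ternary_code U x - ternary_code U y"
      unfolding ternary_code_def d_def by (rule suminf_diff[symmetric]) (rule summable_ternary_digits)+
    ultimately have "(1/3) ^ j / 2 \<le> ((1/3) ^ m :: real)" using close by linarith
    also have "\<dots> \<le> (1/3) ^ Suc j" using less.prems by (intro power_decreasing) auto
    finally show False by simp
  qed
qed

text \<open>The balls of finite nets at all scales \<open>1 / (k + 1)\<close>, listed in one sequence.\<close>

lemma compact_separating_open_sets:
  fixes S :: "'a::metric_space set"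
  assumes "compact S"
  obtains U :: "nat \<Rightarrow> 'a set" where "\<And>j. open (U j)"
    "\<And>e. 0 < e \<Longrightarrow> \<exists>m. \<forall>x\<in>S. \<forall>y\<in>S. (\<forall>j<m. x \<in> U j \<longleftrightarrow> y \<in> U j) \<longrightarrow> dist x y < e"
proof -
  have "\<exists>D. finite D \<and> S \<subseteq> (\<Union>x\<in>D. ball x (inverse (real (Suc k))))" for k
    using compact_eq_totally_bounded[THEN iffD1, OF assms] by (metis inverse_positive_iff_positive of_nat_0_less_iff zero_less_Suc)
  then obtain D where D: "\<And>k. finite (D k)" "\<And>k. S \<subseteq> (\<Union>x\<in>D k. ball x (inverse (real (Suc k))))"
    by metis
  define Fam where "Fam = insert {} (\<Union>k. (\<lambda>x. ball x (inverse (real (Suc k)))) ` D k)"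
  have Fam: "countable Fam" "Fam \<noteq> {}" using D by (auto simp: Fam_def intro: countable_finite)
  define U where "U = from_nat_into Fam"
  have U: "range U = Fam" unfolding U_def by (rule range_from_nat_into[OF Fam(2,1)])
  show thesis
  proof (rule that[of U])
    fix j
    have "U j \<in> Fam" using U by auto
    then show "open (U j)" by (auto simp: Fam_def)
  next
    fix e :: real assume "0 < e"
    then obtain k where k: "inverse (real (Suc k)) < e / 2" using reals_Archimedean[of "e/2"] by auto
    let ?B = "\<lambda>x. ball x (inverse (real (Suc k)))"
    have "\<forall>x\<in>D k. \<exists>j. U j = ?B x"
    proof
      fix x assume "x \<in> D k"
      then have "?B x \<in> Fam" by (auto simp: Fam_def)
      then show "\<exists>j. U j = ?B x" using U by (metis imageE)
    qed
    then obtain i where i: "\<And>x. x \<in> D k \<Longrightarrow> U (i x) = ?B x" by metis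
    obtain m where m: "\<And>x. x \<in> D k \<Longrightarrow> i x < m"
      using finite_nat_set_iff_bounded[THEN iffD1, of "i ` D k"] D(1) by auto
    have "dist x y < e" if xy: "x \<in> S" "y \<in> S" "\<forall>j<m. x \<in> U j \<longleftrightarrow> y \<in> U j" for x y
    proof -
      obtain c where c: "c \<in> D k" "x \<in> ?B c" using D(2)[of k] xy by auto
      then have "y \<in> ?B c" using xy(3) m[OF c(1)] i[OF c(1)] by metis
      then have "dist c x < e / 2" "dist c y < e / 2" using c k by auto
      then show ?thesis using dist_triangle3[of x y c] by linarith
    qed
    then show "\<exists>m. \<forall>x\<in>S. \<forall>y\<in>S. (\<forall>j<m. x \<in> U j \<longleftrightarrow> y \<in> U j) \<longrightarrow> dist x y < e" by blast
  qed
qed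

text \<open>The code moves the measures to a bounded part of the real line, where Helly's selection theorem
  applies. On the image of \<open>S\<close> the code has a uniformly continuous inverse, which extends to the closure
  \<open>C\<close> of the image. The weak limit is carried by \<open>C\<close> and is moved back by the extended inverse \<open>g\<close>.
  A continuous function \<open>f\<close> on \<open>S\<close> becomes \<open>f \<circ> g\<close> on \<open>C\<close>, and Tietze's theorem extends it to a bounded continuous
  function on the line.\<close>

theorem compact_weakly_convergent_subsequence:
  fixes \<mu> :: "nat \<Rightarrow> 'a::complete_space measure"
  assumes S: "compact S"
    and \<mu>: "\<And>n. prob_space (\<mu> n)" "\<And>n. sets (\<mu> n) = sets borel" "\<And>n. AE x in \<mu> n. x \<in> S"
  obtains r M where "strict_mono (r :: nat \<Rightarrow> nat)" "prob_space M" "sets M = sets borel" "AE x in M. x \<in> S"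
    "\<And>f :: 'a \<Rightarrow> real. continuous_on S f \<Longrightarrow>
       (\<lambda>n. LINT x:S|\<mu> (r n). f x) \<longlonglongrightarrow> (LINT x:S|M. f x)"
proof -
  obtain U :: "nat \<Rightarrow> 'a set" where U: "\<And>j. open (U j)"
    "\<And>e. 0 < e \<Longrightarrow> \<exists>m. \<forall>x\<in>S. \<forall>y\<in>S. (\<forall>j<m. x \<in> U j \<longleftrightarrow> y \<in> U j) \<longrightarrow> dist x y < e"
    using compact_separating_open_sets[OF S] by blast
  define code where "code = ternary_code U"
  define E where "E = code ` S"
  define \<psi> where "\<psi> = inv_into S code"
  have \<psi>: "\<psi> u \<in> S" "code (\<psi> u) = u" if "u \<in> E" for u
    using that unfolding E_def \<psi>_def by (auto intro: inv_into_into f_inv_into_f)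
  have close: "\<exists>\<delta>>0. \<forall>x\<in>S. \<forall>y\<in>S. \<bar>code x - code y\<bar> < \<delta> \<longrightarrow> dist x y < e" if "0 < e" for e
  proof -
    obtain m where m: "\<forall>x\<in>S. \<forall>y\<in>S. (\<forall>j<m. x \<in> U j \<longleftrightarrow> y \<in> U j) \<longrightarrow> dist x y < e"
      using U(2)[OF \<open>0 < e\<close>] by blast
    show ?thesis
      using m ternary_code_separates[of U _ _ m] unfolding code_def
      by (intro exI[of _ "(1/3) ^ m"] conjI ballI impI) (auto dest: less_imp_le)
  qed
  have "uniformly_continuous_on E \<psi>"
    unfolding uniformly_continuous_on_def
  proof (intro allI impI)
    fix e :: real assume "0 < e"
    then obtain \<delta> where "\<delta> > 0" and \<delta>: "\<forall>x\<in>S. \<forall>y\<in>S. \<bar>code x - code y\<bar> < \<delta> \<longrightarrow> dist x y < e"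
      using close by blast
    have "dist (\<psi> v) (\<psi> u) < e" if "u \<in> E" "v \<in> E" "dist v u < \<delta>" for u v
      using that \<delta> \<psi> by (auto simp: dist_real_def)
    then show "\<exists>\<delta>>0. \<forall>u\<in>E. \<forall>v\<in>E. dist v u < \<delta> \<longrightarrow> dist (\<psi> v) (\<psi> u) < e"
      using \<open>\<delta> > 0\<close> by blast
  qed
  then obtain g where g_uc: "uniformly_continuous_on (closure E) g" and g: "\<And>u. u \<in> E \<Longrightarrow> \<psi> u = g u"
    by (rule uniformly_continuous_on_extension_on_closure) blast
  define C where "C = closure E"
  have C: "closed C" "E \<subseteq> C" unfolding C_def by (auto simp: closure_subset)
  have g_cont: "continuous_on C g"
    unfolding C_def by (rule uniformly_continuous_imp_continuous[OF g_uc])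
  have g_S: "g u \<in> S" if "u \<in> C" for u
  proof -
    have "g ` closure E \<subseteq> S"
      using g_cont compact_imp_closed[OF S] \<psi>(1) g
      by (intro image_closure_subset) (auto simp: C_def)
    then show ?thesis using that by (auto simp: C_def)
  qed
  have g_code: "g (code x) = x" if "x \<in> S" for x
  proof -
    have E: "code x \<in> E" using that by (simp add: E_def)
    have "dist (\<psi> (code x)) x < e" if "0 < e" for e
      using close[OF that] \<psi>[OF E] \<open>x \<in> S\<close> by force
    then have "dist (\<psi> (code x)) x = 0" by (metis dist_not_less_zero less_irrefl linorder_cases)
    then show ?thesis using g[OF E] by simp
  qed
  have code_C: "code x \<in> C" if "x \<in> S" for x using that C by (auto simp: E_def)
  have code_borel[measurable]: "code \<in> borel_measurable borel"
    unfolding code_def by (rule borel_measurable_ternary_code[OF U(1)])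
  have code_\<mu>[measurable]: "code \<in> borel_measurable (\<mu> n)" for n
    using code_borel \<mu>(2) by (simp cong: measurable_cong_sets)
  define L where "L n = distr (\<mu> n) borel code" for n
  interpret \<mu>: prob_space "\<mu> n" for n by (rule \<mu>)
  have L: "real_distribution (L n)" for n
    unfolding L_def real_distribution_def real_distribution_axioms_def
    by (auto intro: \<mu>.prob_space_distr)
  have L_mass: "measure (L n) {-1<..2} = 1" for n
  proof -
    have "measure (L n) {-1<..2} = measure (\<mu> n) (code -` {-1<..2} \<inter> space (\<mu> n))"
      unfolding L_def by (rule measure_distr) auto
    also have "code -` {-1<..2} \<inter> space (\<mu> n) = space (\<mu> n)"
    proof -
      have "-1 < code x \<and> code x \<le> 2" for x
        using ternary_code_bounds[of U x] unfolding code_def by linarith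
      then show ?thesis by auto
    qed
    finally show ?thesis by (simp add: \<mu>.prob_space)
  qed
  have "tight L"
    unfolding tight_def
  proof (intro conjI allI impI L)
    fix \<epsilon> :: real assume "0 < \<epsilon>"
    then show "\<exists>a b. a < b \<and> (\<forall>n. 1 - \<epsilon> < measure (L n) {a<..b})"
      using L_mass by (intro exI[of _ "-1"] exI[of _ 2]) auto
  qed
  from tight_imp_convergent_subsubsequence[OF this strict_mono_id]
  obtain r L' where r: "strict_mono r" and L': "real_distribution L'" and conv: "weak_conv_m (L \<circ> id \<circ> r) L'"
    by blast
  interpret L': real_distribution L' by (rule L')
  have lim: "(\<lambda>n. integral\<^sup>L (L (r n)) F) \<longlonglongrightarrow> integral\<^sup>L L' F"
    if "continuous_on UNIV F" "\<And>u. \<bar>F u\<bar> \<le> B" for F :: "real \<Rightarrow> real" and B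
    using weak_conv_imp_integral_bdd_continuous_conv[of "\<lambda>n. L (r n)" L' F B] L L' conv that
    by (simp add: comp_def continuous_on_eq_continuous_at)
  have L_int: "integral\<^sup>L (L n) F = (LINT x:S|\<mu> n. F (code x))" if [measurable]: "F \<in> borel_measurable borel" for n and F :: "real \<Rightarrow> real"
  proof -
    have "S \<in> sets borel" using compact_imp_closed[OF S] by simp
    then have [measurable]: "S \<in> sets (\<mu> n)" using \<mu>(2) by simp
    have "integral\<^sup>L (L n) F = (\<integral>x. F (code x) \<partial>\<mu> n)"
      unfolding L_def by (rule integral_distr) auto
    also have "\<dots> = (\<integral>x. indicator S x *\<^sub>R F (code x) \<partial>\<mu> n)"
      using \<mu>(3)[of n] by (intro integral_cong_AE) (auto simp: indicator_def)
    finally show ?thesis by (simp add: set_lebesgue_integral_def)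
  qed
  have "S \<noteq> {}"
    using \<mu>(3)[of 0] \<mu>.AE_False[of 0] by auto
  then have C_ne: "C \<noteq> {}" using C(2) by (auto simp: E_def)
  have L'_C: "AE u in L'. u \<in> C"
  proof (rule AE_mem_closed_if_infdist_zero[OF L'.prob_space_axioms _ C(1) C_ne])
    let ?h = "\<lambda>u. min 1 (infdist u C)"
    have h_cont: "continuous_on UNIV ?h" by (intro continuous_intros)
    have "integral\<^sup>L (L n) ?h = 0" for n
      using C_ne code_C by (subst L_int[OF borel_measurable_continuous_onI[OF h_cont]])
        (auto simp: set_lebesgue_integral_def indicator_def intro!: integral_eq_zero_AE)
    moreover have "(\<lambda>n. integral\<^sup>L (L (r n)) ?h) \<longlonglongrightarrow> integral\<^sup>L L' ?h"
      by (rule lim[OF h_cont, of 1]) (auto simp: infdist_nonneg)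
    ultimately show "integral\<^sup>L L' ?h = 0" by (simp add: LIMSEQ_const_iff)
  qed simp
  obtain s0 where "s0 \<in> S" using \<open>S \<noteq> {}\<close> by auto
  \<comment> \<open>\<open>L'\<close> gives no mass to the complement of \<open>C\<close>, so any value in \<open>S\<close> serves there.\<close>
  define G where "G u = (if u \<in> C then g u else s0)" for u
  have G_borel: "G \<in> borel_measurable borel"
    unfolding G_def using C g_cont by (intro borel_measurable_continuous_on_if) auto
  then have [measurable]: "G \<in> borel_measurable L'" by simp
  have G_S: "G u \<in> S" for u using g_S \<open>s0 \<in> S\<close> by (simp add: G_def)
  define M where "M = distr L' borel G"
  show thesis
  proof (rule that[of r M])
    show "strict_mono r" by fact
    show "prob_space M" unfolding M_def by (rule L'.prob_space_distr) simp
    show "sets M = sets borel" by (simp add: M_def)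
    have S_borel: "S \<in> sets borel" using compact_imp_closed[OF S] by simp
    show "AE x in M. x \<in> S"
      unfolding M_def using S_borel G_S by (subst AE_distr_iff) auto
    fix f :: "'a \<Rightarrow> real" assume f: "continuous_on S f"
    have "compact (f ` S)" by (rule compact_continuous_image[OF f S])
    then obtain B where B: "\<And>x. x \<in> S \<Longrightarrow> \<bar>f x\<bar> \<le> B"
      using compact_imp_bounded[of "f ` S"] by (auto simp: bounded_iff)
    have "0 \<le> B" using B[OF \<open>s0 \<in> S\<close>] by linarith
    have fg: "continuous_on C (\<lambda>u. f (g u))"
      by (rule continuous_on_compose2[OF f g_cont]) (use g_S in auto)
    obtain F where F: "continuous_on UNIV F" "\<And>u. u \<in> C \<Longrightarrow> F u = f (g u)" "\<And>u. \<bar>F u\<bar> \<le> B"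
      using Tietze[OF fg, of UNIV B] C \<open>0 \<le> B\<close> B g_S by auto
    have F_borel: "F \<in> borel_measurable borel" by (rule borel_measurable_continuous_onI[OF F(1)])
    have "integral\<^sup>L (L n) F = (LINT x:S|\<mu> n. f x)" for n
      unfolding L_int[OF F_borel] using F(2) code_C g_code
      by (auto simp: set_lebesgue_integral_def indicator_def intro!: Bochner_Integration.integral_cong)
    moreover have "integral\<^sup>L L' F = (LINT x:S|M. f x)"
    proof -
      have fS: "(\<lambda>x. indicator S x *\<^sub>R f x) \<in> borel_measurable borel"
        by (rule borel_measurable_continuous_on_indicator[OF S_borel f])
      have "(LINT x:S|M. f x) = (\<integral>u. indicator S (G u) *\<^sub>R f (G u) \<partial>L')"
        unfolding set_lebesgue_integral_def M_def by (rule integral_distr) (use fS in auto)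
      also have "\<dots> = integral\<^sup>L L' F"
      proof (rule integral_cong_AE)
        show "F \<in> borel_measurable L'" using F_borel by simp
        show "(\<lambda>u. indicator S (G u) *\<^sub>R f (G u)) \<in> borel_measurable L'"
          using measurable_compose[OF _ fS, of G L'] by simp
        show "AE u in L'. indicator S (G u) *\<^sub>R f (G u) = F u"
          using L'_C by eventually_elim (use g_S F(2) in \<open>auto simp: G_def\<close>)
      qed
      finally show ?thesis by simp
    qed
    ultimately show "(\<lambda>n. LINT x:S|\<mu> (r n). f x) \<longlonglongrightarrow> (LINT x:S|M. f x)"
      using lim[OF F(1,3)] by simp
  qed
qed

section \<open>Path measures of Markov chains and a strong law\<close>

lemma bounded_divide_Suc_tendsto_0:
  fixes x :: "nat \<Rightarrow> real"
  assumes "\<And>n. \<bar>x n\<bar> \<le> B"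
  shows "(\<lambda>n. x n / real (Suc n)) \<longlonglongrightarrow> 0"
proof (rule Lim_null_comparison[OF always_eventually])
  show "\<forall>n. norm (x n / real (Suc n)) \<le> B * inverse (real (Suc n))"
    using assms by (simp add: divide_inverse abs_mult mult_right_mono del: of_nat_Suc)
  show "(\<lambda>n. B * inverse (real (Suc n))) \<longlonglongrightarrow> 0"
    using tendsto_mult[OF tendsto_const[of B] LIMSEQ_inverse_real_of_nat] by simp
qed

text \<open>Between consecutive squares \<open>m\<^sup>2\<close> and \<open>(m + 1)\<^sup>2\<close> the sum of bounded terms changes by \<open>O(m)\<close> only,
  which is negligible against \<open>m\<^sup>2\<close>.\<close>

lemma time_average_tendsto_0_of_squares:
  fixes d :: "nat \<Rightarrow> real"
  assumes bounded: "\<And>k. \<bar>d k\<bar> \<le> B"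
    and squares: "(\<lambda>m. (\<Sum>k<(Suc m)^2. d k) / real ((Suc m)^2)) \<longlonglongrightarrow> 0"
  shows "(\<lambda>n. (\<Sum>k<Suc n. d k) / real (Suc n)) \<longlonglongrightarrow> 0"
proof -
  define a where "a m = \<bar>(\<Sum>k<(Suc m)^2. d k) / real ((Suc m)^2)\<bar>" for m
  \<comment> \<open>\<open>(Suc (q n))\<^sup>2\<close> is the largest square up to \<open>Suc n\<close>.\<close>
  define q where "q n = floor_sqrt (Suc n) - 1" for n
  have B: "0 \<le> B" using bounded[of 0] by simp
  have q: "Suc (q n) = floor_sqrt (Suc n)" for n
    unfolding q_def by (simp add: Suc_leI)
  have q_le: "(Suc (q n))^2 \<le> Suc n" for n
    using q floor_sqrt_power2_le by metis
  have q_gt: "Suc n < (Suc (Suc (q n)))^2" for n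
    using q[of n] Suc_floor_sqrt_power2_gt[of "Suc n"] by simp
  have q_top: "filterlim q at_top sequentially"
    unfolding filterlim_at_top
  proof
    fix Z
    have "Z \<le> q n" if "(Suc (Suc Z))^2 \<le> n" for n
    proof (rule ccontr)
      assume "\<not> Z \<le> q n"
      then have "(Suc (Suc (q n)))^2 \<le> (Suc (Suc Z))^2" by (intro power_mono) auto
      then show False using q_gt[of n] that by linarith
    qed
    then show "\<forall>\<^sub>F n in sequentially. Z \<le> q n"
      unfolding eventually_sequentially by blast
  qed
  have bound: "\<bar>(\<Sum>k<Suc n. d k) / real (Suc n)\<bar> \<le> a (q n) + 3 * B * inverse (real (Suc (q n)))" for n
  proof -
    let ?m = "Suc (q n)"
    have "(\<Sum>k<Suc n. d k) = (\<Sum>k<?m^2. d k) + (\<Sum>k\<in>{?m^2..<Suc n}. d k)"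
      using sum.atLeastLessThan_concat[of 0 "?m^2" "Suc n" d] q_le[of n] by (simp only: lessThan_atLeast0)
    moreover have "\<bar>\<Sum>k\<in>{?m^2..<Suc n}. d k\<bar> \<le> 3 * B * real ?m"
    proof -
      have "\<bar>\<Sum>k\<in>{?m^2..<Suc n}. d k\<bar> \<le> (\<Sum>k\<in>{?m^2..<Suc n}. B)"
        by (rule order.trans[OF sum_abs]) (intro sum_mono bounded)
      also have "\<dots> = real (Suc n - ?m^2) * B" by simp
      also have "\<dots> \<le> real (3 * ?m) * B"
        using q_gt[of n] B by (intro mult_right_mono) (auto simp: power2_eq_square)
      finally show ?thesis by (simp add: mult_ac)
    qed
    ultimately have "\<bar>\<Sum>k<Suc n. d k\<bar> \<le> \<bar>\<Sum>k<?m^2. d k\<bar> + 3 * B * real ?m" by linarith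
    then have "\<bar>(\<Sum>k<Suc n. d k) / real (Suc n)\<bar> \<le> (\<bar>\<Sum>k<?m^2. d k\<bar> + 3 * B * real ?m) / real (Suc n)"
      by (simp add: divide_right_mono)
    also have "\<dots> \<le> (\<bar>\<Sum>k<?m^2. d k\<bar> + 3 * B * real ?m) / real (?m^2)"
      using q_le[of n] B by (intro divide_left_mono) (auto simp del: of_nat_Suc of_nat_power)
    also have "\<dots> = a (q n) + 3 * B * inverse (real ?m)"
    proof -
      have "(P + 3 * B * x) / (x * x) = P / (x * x) + 3 * B * inverse x" if "x > 0" for P x :: real
        using that by (simp add: field_simps)
      from this[of "real ?m" "\<bar>\<Sum>k<?m^2. d k\<bar>"] show ?thesis
        unfolding a_def abs_divide of_nat_power abs_of_nat power_abs
        by (simp add: power2_eq_square del: of_nat_Suc)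
    qed
    finally show ?thesis .
  qed
  have "a \<longlonglongrightarrow> 0"
    unfolding a_def using squares by (rule tendsto_rabs_zero)
  moreover have "(\<lambda>m. 3 * B * inverse (real (Suc m))) \<longlonglongrightarrow> 3 * B * 0"
    by (intro tendsto_mult tendsto_const LIMSEQ_inverse_real_of_nat)
  ultimately have "(\<lambda>m. a m + 3 * B * inverse (real (Suc m))) \<longlonglongrightarrow> 0 + 3 * B * 0"
    by (rule tendsto_add)
  from filterlim_compose[OF this q_top]
  have lim: "(\<lambda>n. a (q n) + 3 * B * inverse (real (Suc (q n)))) \<longlonglongrightarrow> 0" by simp
  show ?thesis
    by (rule Lim_null_comparison[OF always_eventually lim]) (use bound in auto)
qed

text \<open>By orthogonality the average of \<open>n\<close> terms has second moment at most \<open>B\<^sup>2 / n\<close>. Along the squares these bounds are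
  summable, so the squared averages are almost surely summable there.\<close>

lemma (in prob_space) bounded_orthogonal_strong_law:
  fixes D :: "nat \<Rightarrow> 'a \<Rightarrow> real"
  assumes meas[measurable]: "\<And>k. D k \<in> borel_measurable M"
    and bounded: "\<And>k \<omega>. \<omega> \<in> space M \<Longrightarrow> \<bar>D k \<omega>\<bar> \<le> B"
    and orthogonal: "\<And>j k. j < k \<Longrightarrow> expectation (\<lambda>\<omega>. D j \<omega> * D k \<omega>) = 0"
  shows "AE \<omega> in M. (\<lambda>n. (\<Sum>k<Suc n. D k \<omega>) / real (Suc n)) \<longlonglongrightarrow> 0"
proof -
  obtain \<omega>0 where "\<omega>0 \<in> space M" using not_empty by auto
  then have B: "0 \<le> B" using bounded[of \<omega>0 0] by linarith
  have int: "integrable M (\<lambda>\<omega>. D j \<omega> * D k \<omega>)" for j k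
    using bounded B
    by (intro integrable_const_bound[of _ "B * B"] AE_I2) (auto simp: abs_mult intro!: mult_mono)
  have orth: "expectation (\<lambda>\<omega>. D j \<omega> * D k \<omega>) = 0" if "j \<noteq> k" for j k
    using orthogonal[of j k] orthogonal[of k j] that by (cases "j < k") (auto simp: mult.commute)
  have second_moment: "expectation (\<lambda>\<omega>. (\<Sum>k<n. D k \<omega>)^2) \<le> real n * B^2" for n
  proof -
    have "expectation (\<lambda>\<omega>. (\<Sum>k<n. D k \<omega>)^2) = expectation (\<lambda>\<omega>. \<Sum>j<n. \<Sum>k<n. D j \<omega> * D k \<omega>)"
      by (simp add: power2_eq_square sum_product)
    also have "\<dots> = (\<Sum>j<n. \<Sum>k<n. expectation (\<lambda>\<omega>. D j \<omega> * D k \<omega>))"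
      using int by (subst Bochner_Integration.integral_sum) (auto simp: Bochner_Integration.integral_sum intro!: Bochner_Integration.integrable_sum)
    also have "\<dots> = (\<Sum>j<n. \<Sum>k<n. if k = j then expectation (\<lambda>\<omega>. D j \<omega> * D k \<omega>) else 0)"
      by (intro sum.cong refl) (auto simp: orth)
    also have "\<dots> = (\<Sum>j<n. expectation (\<lambda>\<omega>. D j \<omega> * D j \<omega>))"
      by (simp add: sum.delta)
    also have "\<dots> \<le> (\<Sum>j<n. B^2)"
    proof (rule sum_mono)
      fix j
      have "expectation (\<lambda>\<omega>. D j \<omega> * D j \<omega>) \<le> expectation (\<lambda>\<omega>. B^2)"
        using bounded B int
        by (intro integral_mono) (auto simp: power2_eq_square abs_mult[symmetric] intro!: abs_le_square_iff[THEN iffD1, unfolded power2_eq_square])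
      then show "expectation (\<lambda>\<omega>. D j \<omega> * D j \<omega>) \<le> B^2" by (simp add: prob_space)
    qed
    finally show ?thesis by simp
  qed
  define A where "A m \<omega> = ((\<Sum>k<(Suc m)^2. D k \<omega>) / real ((Suc m)^2))^2" for m \<omega>
  have [measurable]: "A m \<in> borel_measurable M" for m unfolding A_def by measurable
  have A_int: "(\<integral>\<^sup>+\<omega>. ennreal (A m \<omega>) \<partial>M) \<le> ennreal (B^2 * inverse ((real (Suc m))^2))" for m
  proof -
    let ?n = "(Suc m)^2"
    have "integrable M (\<lambda>\<omega>. (\<Sum>k<?n. D k \<omega>)^2)"
      unfolding power2_eq_square[of "sum _ _"] sum_product
      by (intro Bochner_Integration.integrable_sum int)
    then have i: "integrable M (A m)" unfolding A_def power_divide by simp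
    have "(\<integral>\<^sup>+\<omega>. ennreal (A m \<omega>) \<partial>M) = ennreal (expectation (A m))"
      by (rule nn_integral_eq_integral[OF i]) (simp add: A_def)
    also have "expectation (A m) = expectation (\<lambda>\<omega>. (\<Sum>k<?n. D k \<omega>)^2) / (real ?n)^2"
      unfolding A_def power_divide by simp
    also have "\<dots> \<le> (real ?n * B^2) / (real ?n)^2"
      by (intro divide_right_mono second_moment) simp
    also have "\<dots> = B^2 * inverse ((real (Suc m))^2)"
      unfolding of_nat_power by (simp add: power2_eq_square divide_simps del: of_nat_Suc)
    finally show ?thesis by (simp add: ennreal_leI)
  qed
  have "(\<integral>\<^sup>+\<omega>. (\<Sum>m. ennreal (A m \<omega>)) \<partial>M) = (\<Sum>m. \<integral>\<^sup>+\<omega>. ennreal (A m \<omega>) \<partial>M)"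
    by (rule nn_integral_suminf) simp
  also have "\<dots> \<le> (\<Sum>m. ennreal (B^2 * inverse ((real (Suc m))^2)))"
    by (intro suminf_le A_int) auto
  also have "\<dots> < \<infinity>"
  proof -
    have "summable (\<lambda>m. B^2 * inverse ((real (Suc m))^2))"
      using inverse_squares_sums by (intro summable_mult) (auto simp: sums_iff inverse_eq_divide add.commute)
    then show ?thesis by (subst suminf_ennreal2) auto
  qed
  finally have "AE \<omega> in M. (\<Sum>m. ennreal (A m \<omega>)) \<noteq> \<infinity>"
    by (intro nn_integral_noteq_infinite) auto
  then show ?thesis
  proof (rule AE_mp, intro AE_I2 impI)
    fix \<omega> assume \<omega>: "\<omega> \<in> space M" and fin: "(\<Sum>m. ennreal (A m \<omega>)) \<noteq> \<infinity>"
    have "summable (\<lambda>m. A m \<omega>)"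
      using fin by (intro summable_suminf_not_top) (auto simp: A_def)
    then have "(\<lambda>m. A m \<omega>) \<longlonglongrightarrow> 0" by (rule summable_LIMSEQ_zero)
    then have "(\<lambda>m. sqrt (A m \<omega>)) \<longlonglongrightarrow> sqrt 0" by (rule tendsto_real_sqrt)
    then have "(\<lambda>m. \<bar>(\<Sum>k<(Suc m)^2. D k \<omega>) / real ((Suc m)^2)\<bar>) \<longlonglongrightarrow> 0"
      unfolding A_def real_sqrt_abs by simp
    then have "(\<lambda>m. (\<Sum>k<(Suc m)^2. D k \<omega>) / real ((Suc m)^2)) \<longlonglongrightarrow> 0"
      by (rule tendsto_rabs_zero_cancel)
    then show "(\<lambda>n. (\<Sum>k<Suc n. D k \<omega>) / real (Suc n)) \<longlonglongrightarrow> 0"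
      by (rule time_average_tendsto_0_of_squares[OF bounded[OF \<omega>]])
  qed
qed

locale markov_kernel =
  fixes S :: "'s measure" and K :: "'s \<Rightarrow> 's measure"
  assumes kernel_prob_algebra[measurable]: "K \<in> S \<rightarrow>\<^sub>M prob_algebra S"
begin

lemma kernel_subprob_algebra[measurable]: "K \<in> S \<rightarrow>\<^sub>M subprob_algebra S"
  by (rule measurable_prob_algebraD) measurable

lemma prob_space_kernel: "s \<in> space S \<Longrightarrow> prob_space (K s)"
  using measurable_space[OF kernel_prob_algebra] by (auto simp: space_prob_algebra)

lemma sets_kernel: "s \<in> space S \<Longrightarrow> sets (K s) = sets S"
  using measurable_space[OF kernel_prob_algebra] by (auto simp: space_prob_algebra)

lemma space_kernel: "s \<in> space S \<Longrightarrow> space (K s) = space S"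
  by (rule sets_eq_imp_space_eq[OF sets_kernel])

definition next_mean :: "('s \<Rightarrow> real) \<Rightarrow> 's \<Rightarrow> real" where
  "next_mean f s = integral\<^sup>L (K s) f"

lemma borel_measurable_next_mean[measurable]:
  assumes [measurable]: "f \<in> borel_measurable S"
  shows "next_mean f \<in> borel_measurable S"
  unfolding next_mean_def[abs_def] by measurable

lemma next_mean_bounded:
  assumes [measurable]: "f \<in> borel_measurable S" and b: "\<And>s. s \<in> space S \<Longrightarrow> \<bar>f s\<bar> \<le> B" and s: "s \<in> space S"
  shows "\<bar>next_mean f s\<bar> \<le> B"
proof -
  interpret K: prob_space "K s" by (rule prob_space_kernel[OF s])
  have "f \<in> borel_measurable (K s)" using sets_kernel[OF s] by (simp cong: measurable_cong_sets)
  then have int: "integrable (K s) f"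
    using b by (intro K.integrable_const_bound[of _ B] AE_I2) (auto simp: space_kernel[OF s])
  have "\<bar>next_mean f s\<bar> \<le> integral\<^sup>L (K s) (\<lambda>x. \<bar>f x\<bar>)"
    unfolding next_mean_def by (rule integral_abs_bound)
  also have "\<dots> \<le> B"
    using int b by (intro K.integral_le_const AE_I2) (auto simp: space_kernel[OF s])
  finally show ?thesis .
qed

lemma Ionescu_Tulcea_path:
  assumes "probability_on S \<nu>"
  shows "Ionescu_Tulcea (path_kernel K \<nu>) (\<lambda>_. S)"
proof -
  have \<nu>: "\<nu> \<in> space (prob_algebra S)"
    using assms by (auto simp: probability_on_def space_prob_algebra)
  have *: "path_kernel K \<nu> i \<in> PiM {0..<i} (\<lambda>_. S) \<rightarrow>\<^sub>M prob_algebra S" for i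
  proof (cases i)
    case 0 then show ?thesis using \<nu> by (simp add: path_kernel_def[abs_def])
  next
    case (Suc n)
    have "(\<lambda>\<omega>. \<omega> n) \<in> PiM {0..<i} (\<lambda>_. S) \<rightarrow>\<^sub>M S"
      using Suc by (intro measurable_component_singleton) auto
    then show ?thesis using Suc by (simp add: path_kernel_def[abs_def])
  qed
  show ?thesis
    unfolding Ionescu_Tulcea_def
  proof (intro conjI allI impI)
    show "path_kernel K \<nu> i \<in> PiM {0..<i} (\<lambda>_. S) \<rightarrow>\<^sub>M subprob_algebra S" for i
      by (rule measurable_prob_algebraD[OF *])
    show "prob_space (path_kernel K \<nu> i x)" if "x \<in> space (PiM {0..<i} (\<lambda>_. S))" for i x
      using measurable_space[OF * that] by (auto simp: space_prob_algebra)
  qed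
qed

end

locale markov_chain = markov_kernel S K for S :: "'s measure" and K +
  fixes \<nu> :: "'s measure"
  assumes initial_law: "probability_on S \<nu>"
begin

sublocale IT: Ionescu_Tulcea "path_kernel K \<nu>" "\<lambda>_. S"
  by (rule Ionescu_Tulcea_path[OF initial_law])

abbreviation path :: "(nat \<Rightarrow> 's) measure" where "path \<equiv> path_measure S K \<nu>"

lemma path_eq: "path = IT.PF.lim"
  unfolding path_measure_def ..

lemma sets_path[measurable_cong, simp]: "sets path = sets (PiM UNIV (\<lambda>_. S))"
  by (simp add: path_eq)

lemma measurable_coordinate[measurable]: "(\<lambda>\<omega>. \<omega> k) \<in> path \<rightarrow>\<^sub>M S"
  by (simp cong: measurable_cong_sets)

lemma coordinate_space: "\<omega> \<in> space path \<Longrightarrow> \<omega> k \<in> space S"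
  by (rule measurable_space[OF measurable_coordinate])

text \<open>Reduces statements about finitely many states of the path to the iterated kernels.\<close>

lemma distr_prefix:
  "distr path (PiM {0..<n} (\<lambda>_. S)) (\<lambda>\<omega>. restrict \<omega> {0..<n}) = IT.C 0 n (\<lambda>_. undefined)"
proof -
  have "distr path (PiM {0..<n} (\<lambda>_. S)) (\<lambda>\<omega>. restrict \<omega> {0..<n}) = IT.CI {0..<n}"
    unfolding path_eq by (rule IT.distr_lim) simp
  also have "\<dots> = distr (IT.C 0 n (\<lambda>_. undefined)) (PiM {0..<n} (\<lambda>_. S)) (\<lambda>f. restrict f {0..<n})"
  proof -
    have "IT.up_to {0..<n} = n"
      using IT.up_to_iff_Ico[of "{0..<n}" n] IT.up_to_iff_Ico[of "{0..<n}" "IT.up_to {0..<n}"]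
      by (intro antisym) auto
    then show ?thesis by (simp add: IT.CI_def)
  qed
  also have "\<dots> = IT.C 0 n (\<lambda>_. undefined)"
    using IT.distr_C[of n n "\<lambda>_. undefined" 0] by simp
  finally show ?thesis .
qed

lemma prob_space_path: "prob_space path"
proof -
  have "(\<lambda>\<omega>. restrict \<omega> {0..<0}) \<in> path \<rightarrow>\<^sub>M PiM {0..<0::nat} (\<lambda>_. S)"
    by measurable
  moreover have "prob_space (distr path (PiM {0..<0} (\<lambda>_. S)) (\<lambda>\<omega>. restrict \<omega> {0..<0}))"
    unfolding distr_prefix by (rule IT.prob_space_C) simp
  ultimately show ?thesis by (rule prob_space_distrD)
qed

sublocale path: prob_space path by (rule prob_space_path)

lemma expectation_prefix:
  fixes f :: "(nat \<Rightarrow> 's) \<Rightarrow> real"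
  assumes "f \<in> borel_measurable (PiM {0..<n} (\<lambda>_. S))"
  shows "path.expectation (\<lambda>\<omega>. f (restrict \<omega> {0..<n})) = integral\<^sup>L (IT.C 0 n (\<lambda>_. undefined)) f"
  unfolding distr_prefix[symmetric] using assms by (subst integral_distr) auto

text \<open>The next state may be averaged out against any function of the past.\<close>

lemma markov_property:
  fixes g :: "(nat \<Rightarrow> 's) \<Rightarrow> real" and h :: "'s \<Rightarrow> real"
  assumes g[measurable]: "g \<in> borel_measurable (PiM {0..<Suc n} (\<lambda>_. S))"
    and g_bounded: "\<And>x. x \<in> space (PiM {0..<Suc n} (\<lambda>_. S)) \<Longrightarrow> \<bar>g x\<bar> \<le> G"
    and h[measurable]: "h \<in> borel_measurable S"
    and h_bounded: "\<And>s. s \<in> space S \<Longrightarrow> \<bar>h s\<bar> \<le> B"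
  shows "path.expectation (\<lambda>\<omega>. g (restrict \<omega> {0..<Suc n}) * h (\<omega> (Suc n)))
       = path.expectation (\<lambda>\<omega>. g (restrict \<omega> {0..<Suc n}) * next_mean h (\<omega> n))"
proof -
  let ?u = "\<lambda>_::nat. undefined :: 's" and ?P = "\<lambda>n. PiM {0..<n::nat} (\<lambda>_. S)"
  define F where "F x = g (restrict x {0..<Suc n}) * h (x (Suc n))" for x
  have [measurable]: "(\<lambda>x. restrict x {0..<Suc n}) \<in> ?P (Suc (Suc n)) \<rightarrow>\<^sub>M ?P (Suc n)"
    by (rule measurable_restrict_subset) auto
  have [measurable]: "(\<lambda>x. x (Suc n)) \<in> ?P (Suc (Suc n)) \<rightarrow>\<^sub>M S"
    by (rule measurable_component_singleton) auto
  have comp_n[measurable]: "(\<lambda>x. x n) \<in> ?P (Suc n) \<rightarrow>\<^sub>M S"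
    by (rule measurable_component_singleton) auto
  have F[measurable]: "F \<in> borel_measurable (?P (Suc (Suc n)))"
    unfolding F_def by measurable
  have F_bounded: "\<bar>F x\<bar> \<le> G * B" if x: "x \<in> space (?P (Suc (Suc n)))" for x
  proof -
    have "restrict x {0..<Suc n} \<in> space (?P (Suc n))" "x (Suc n) \<in> space S"
      using x by (auto simp: space_PiM PiE_iff)
    then have "\<bar>g (restrict x {0..<Suc n})\<bar> \<le> G" "\<bar>h (x (Suc n))\<bar> \<le> B"
      using g_bounded h_bounded by blast+
    then show ?thesis unfolding F_def abs_mult by (intro mult_mono) auto
  qed
  interpret C: prob_space "IT.C 0 (Suc n) ?u" by (rule IT.prob_space_C) simp
  have space_C: "space (IT.C 0 (Suc n) ?u) = space (?P (Suc n))"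
    using IT.space_C[of ?u 0 "Suc n"] by (simp del: IT.C.simps)
  have eP: "IT.eP (Suc n) \<in> IT.C 0 (Suc n) ?u \<rightarrow>\<^sub>M subprob_algebra (?P (Suc (Suc n)))"
    using IT.measurable_eP[of "Suc n"] IT.sets_C[of ?u 0 "Suc n"]
    by (simp cong: measurable_cong_sets del: IT.C.simps)
  have inner: "integral\<^sup>L (IT.eP (Suc n) x) F = g x * next_mean h (x n)" if x: "x \<in> space (?P (Suc n))" for x
  proof -
    have xn: "x n \<in> space S" using x by (auto simp: space_PiM PiE_iff)
    have K: "path_kernel K \<nu> (Suc n) x = K (x n)" by (simp add: path_kernel_def)
    have upd: "fun_upd x (Suc n) \<in> K (x n) \<rightarrow>\<^sub>M ?P (Suc (Suc n))"
    proof -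
      have "fun_upd x (Suc n) \<in> S \<rightarrow>\<^sub>M ?P (Suc (Suc n))"
        by (rule measurable_fun_upd[where J="{0..<Suc n}"]) (use x in auto)
      then show ?thesis using sets_kernel[OF xn] by (simp cong: measurable_cong_sets)
    qed
    have "integral\<^sup>L (IT.eP (Suc n) x) F = (\<integral>y. F (x(Suc n := y)) \<partial>K (x n))"
      unfolding IT.eP_def K using upd by (subst integral_distr) auto
    also have "\<dots> = (\<integral>y. g x * h y \<partial>K (x n))"
    proof -
      have "restrict (x(Suc n := y)) {0..<Suc n} = x" for y
        using x by (auto simp: space_PiM PiE_iff extensional_def restrict_def fun_eq_iff)
      then show ?thesis by (simp add: F_def)
    qed
    also have "\<dots> = g x * next_mean h (x n)" by (simp add: next_mean_def)
    finally show ?thesis .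
  qed
  have "path.expectation (\<lambda>\<omega>. g (restrict \<omega> {0..<Suc n}) * h (\<omega> (Suc n)))
      = path.expectation (\<lambda>\<omega>. F (restrict \<omega> {0..<Suc (Suc n)}))"
    by (rule Bochner_Integration.integral_cong) (auto simp: F_def Int_absorb1)
  also have "\<dots> = integral\<^sup>L (IT.C 0 (Suc (Suc n)) ?u) F"
    by (rule expectation_prefix) (rule F)
  also have "\<dots> = integral\<^sup>L (IT.C 0 (Suc n) ?u \<bind> IT.eP (Suc n)) F"
    by simp
  also have "\<dots> = (\<integral>x. integral\<^sup>L (IT.eP (Suc n) x) F \<partial>IT.C 0 (Suc n) ?u)"
  proof (rule integral_bind[OF F F_bounded eP])
    show "finite_measure (IT.C 0 (Suc n) ?u)" by unfold_locales
    show "AE x in IT.C 0 (Suc n) ?u. emeasure (IT.eP (Suc n) x) (space (IT.eP (Suc n) x)) \<le> ennreal 1"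
      using IT.prob_space_eP prob_space.emeasure_space_1 by (intro AE_I2) (fastforce simp: space_C simp del: IT.C.simps)
  qed
  also have "\<dots> = (\<integral>x. g x * next_mean h (x n) \<partial>IT.C 0 (Suc n) ?u)"
    by (rule Bochner_Integration.integral_cong) (auto simp: space_C inner simp del: IT.C.simps)
  also have "\<dots> = path.expectation (\<lambda>\<omega>. g (restrict \<omega> {0..<Suc n}) * next_mean h (restrict \<omega> {0..<Suc n} n))"
    by (rule expectation_prefix[symmetric]) measurable
  finally show ?thesis by simp
qed

lemma initial_distribution: "distr path S (\<lambda>\<omega>. \<omega> 0) = \<nu>"
proof -
  let ?u = "\<lambda>_::nat. undefined :: 's"
  have \<nu>: "sets \<nu> = sets S" using initial_law by (simp add: probability_on_def)
  have u: "?u \<in> space (PiM {0..<0} (\<lambda>_. S))" by (simp add: space_PiM)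
  have "distr path S (\<lambda>\<omega>. \<omega> 0)
      = distr (distr path (PiM {0..<Suc 0} (\<lambda>_. S)) (\<lambda>\<omega>. restrict \<omega> {0..<Suc 0})) S (\<lambda>x. x 0)"
    by (subst distr_distr) (auto simp: comp_def)
  also have "\<dots> = distr (IT.eP 0 ?u) S (\<lambda>x. x 0)"
  proof -
    have "IT.C 0 (Suc 0) ?u = return (PiM {0..<0} (\<lambda>_. S)) ?u \<bind> IT.eP 0"
      by (simp only: IT.C.simps add_0)
    also have "\<dots> = IT.eP 0 ?u"
      by (rule bind_return[OF IT.measurable_eP u])
    finally show ?thesis unfolding distr_prefix by simp
  qed
  also have "\<dots> = distr \<nu> S (\<lambda>y. y)"
  proof -
    have "fun_upd ?u 0 \<in> \<nu> \<rightarrow>\<^sub>M PiM {0..<Suc 0} (\<lambda>_. S)"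
    proof -
      have "fun_upd ?u 0 \<in> S \<rightarrow>\<^sub>M PiM {0..<Suc 0} (\<lambda>_. S)"
        by (rule measurable_fun_upd[where J="{0..<0}"]) (use u in auto)
      then show ?thesis using \<nu> by (simp cong: measurable_cong_sets)
    qed
    then show ?thesis
      unfolding IT.eP_def by (subst distr_distr) (auto simp: comp_def path_kernel_def)
  qed
  also have "\<dots> = \<nu>" using \<nu> by (simp add: distr_id2)
  finally show ?thesis .
qed

lemma integral_law_at:
  fixes f :: "'s \<Rightarrow> real"
  assumes "f \<in> borel_measurable S" "\<And>s. s \<in> space S \<Longrightarrow> \<bar>f s\<bar> \<le> B"
  shows "integral\<^sup>L (law_at S K \<nu> n) f = integral\<^sup>L \<nu> ((next_mean ^^ n) f)"
  using assms
proof (induction n arbitrary: f)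
  case 0
  then show ?case by (simp add: law_at_def initial_distribution)
next
  case (Suc n)
  note [measurable] = Suc.prems(1)
  have "integral\<^sup>L (law_at S K \<nu> (Suc n)) f = path.expectation (\<lambda>\<omega>. 1 * f (\<omega> (Suc n)))"
    unfolding law_at_def by (subst integral_distr) auto
  also have "\<dots> = path.expectation (\<lambda>\<omega>. 1 * next_mean f (\<omega> n))"
    by (rule markov_property[where G=1]) (use Suc.prems in auto)
  also have "\<dots> = integral\<^sup>L (law_at S K \<nu> n) (next_mean f)"
    unfolding law_at_def by (subst integral_distr) auto
  also have "\<dots> = integral\<^sup>L \<nu> ((next_mean ^^ n) (next_mean f))"
    by (rule Suc.IH) (use Suc.prems in \<open>auto intro: next_mean_bounded\<close>)
  finally show ?case by (simp add: funpow_swap1)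
qed

text \<open>The difference at time \<open>j\<close> is a function of the past at any later time \<open>k\<close>, so the Markov property makes
  it orthogonal to the difference at time \<open>k\<close>.\<close>

lemma martingale_strong_law:
  assumes h[measurable]: "h \<in> borel_measurable S" and h_bounded: "\<And>s. s \<in> space S \<Longrightarrow> \<bar>h s\<bar> \<le> B"
  shows "AE \<omega> in path. (\<lambda>n. (\<Sum>k<Suc n. h (\<omega> (Suc k)) - next_mean h (\<omega> k)) / real (Suc n)) \<longlonglongrightarrow> 0"
proof (rule path.bounded_orthogonal_strong_law[where B="2 * B"])
  show "(\<lambda>\<omega>. h (\<omega> (Suc k)) - next_mean h (\<omega> k)) \<in> borel_measurable path" for k
    by measurable
  have bound: "\<bar>h s - next_mean h s'\<bar> \<le> 2 * B" if "s \<in> space S" "s' \<in> space S" for s s'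
    using h_bounded[OF that(1)] next_mean_bounded[OF h h_bounded that(2)] by linarith
  show "\<bar>h (\<omega> (Suc k)) - next_mean h (\<omega> k)\<bar> \<le> 2 * B" if "\<omega> \<in> space path" for k \<omega>
    using that by (intro bound coordinate_space)
  fix j k :: nat assume jk: "j < k"
  define g where "g x = h (x (Suc j)) - next_mean h (x j)" for x
  have [measurable]: "(\<lambda>x. x i) \<in> PiM {0..<Suc k} (\<lambda>_. S) \<rightarrow>\<^sub>M S" if "i \<le> k" for i
    using that by (intro measurable_component_singleton) auto
  have [measurable]: "g \<in> borel_measurable (PiM {0..<Suc k} (\<lambda>_. S))"
    unfolding g_def using jk
    by (intro borel_measurable_diff measurable_compose[OF _ h]
        measurable_compose[OF _ borel_measurable_next_mean[OF h]]) auto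
  have g_bounded: "\<bar>g x\<bar> \<le> 2 * B" if "x \<in> space (PiM {0..<Suc k} (\<lambda>_. S))" for x
    unfolding g_def using that jk by (intro bound) (auto simp: space_PiM PiE_iff)
  have g_restrict: "g (restrict \<omega> {0..<Suc k}) = g \<omega>" for \<omega>
    using jk by (simp add: g_def)
  have [measurable]: "g \<in> borel_measurable path"
    unfolding g_def by measurable
  have g_bounded': "\<bar>g \<omega>\<bar> \<le> 2 * B" if "\<omega> \<in> space path" for \<omega>
    unfolding g_def using that by (intro bound coordinate_space)
  have int: "integrable path (\<lambda>\<omega>. g \<omega> * f (\<omega> i))"
    if [measurable]: "f \<in> borel_measurable S" and "\<And>s. s \<in> space S \<Longrightarrow> \<bar>f s\<bar> \<le> B" for f :: "'s \<Rightarrow> real" and i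
    using that(2) g_bounded' coordinate_space
    by (intro path.integrable_const_bound[of _ "2 * B * B"] AE_I2)
      (auto simp: abs_mult intro!: mult_mono order.trans[OF abs_ge_zero g_bounded'])
  have "path.expectation (\<lambda>\<omega>. g \<omega> * h (\<omega> (Suc k))) = path.expectation (\<lambda>\<omega>. g \<omega> * next_mean h (\<omega> k))"
    using markov_property[of g k "2 * B" h B] g_bounded h_bounded by (simp add: g_restrict)
  then show "path.expectation (\<lambda>\<omega>. (h (\<omega> (Suc j)) - next_mean h (\<omega> j)) * (h (\<omega> (Suc k)) - next_mean h (\<omega> k))) = 0"
    using int[OF h h_bounded] int[OF borel_measurable_next_mean[OF h] next_mean_bounded[OF h h_bounded]]
    unfolding g_def[symmetric] right_diff_distrib by (subst Bochner_Integration.integral_diff) auto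
qed

end

section \<open>Invariant measures of Markov kernels\<close>

text \<open>The inclusion of \<open>\<Omega>\<close> turns both measures into Borel measures on the whole space.\<close>

lemma restricted_borel_measures_eqI_continuous:
  fixes M N :: "'a::metric_space measure"
  assumes \<Omega>: "\<Omega> \<in> sets borel"
    and M: "probability_on (restrict_space borel \<Omega>) M" and N: "probability_on (restrict_space borel \<Omega>) N"
    and eq: "\<And>f :: 'a \<Rightarrow> real. continuous_on UNIV f \<Longrightarrow> (\<And>x. 0 \<le> f x \<and> f x \<le> 1) \<Longrightarrow> integral\<^sup>L M f = integral\<^sup>L N f"
  shows "M = N"
proof -
  have sets: "sets M = sets (restrict_space borel \<Omega>)" "sets N = sets (restrict_space borel \<Omega>)"
    and ps: "prob_space M" "prob_space N" using M N by (auto simp: probability_on_def)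
  have id[measurable]: "(\<lambda>x. x) \<in> Q \<rightarrow>\<^sub>M borel" if "sets Q = sets (restrict_space borel \<Omega>)" for Q :: "'a measure"
    using measurable_restrict_space1[OF measurable_ident, of borel \<Omega>] that
    by (simp add: id_def cong: measurable_cong_sets)
  have D: "distr M borel (\<lambda>x. x) = distr N borel (\<lambda>x. x)"
  proof (rule borel_measures_eqI_continuous)
    fix f :: "'a \<Rightarrow> real" assume f: "continuous_on UNIV f" "\<And>x. 0 \<le> f x \<and> f x \<le> 1"
    have "integral\<^sup>L (distr Q borel (\<lambda>x. x)) f = integral\<^sup>L Q f" if "sets Q = sets (restrict_space borel \<Omega>)" for Q :: "'a measure"
      using id[OF that] borel_measurable_continuous_onI[OF f(1)] by (subst integral_distr) auto
    then show "integral\<^sup>L (distr M borel (\<lambda>x. x)) f = integral\<^sup>L (distr N borel (\<lambda>x. x)) f"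
      using eq[OF f] sets by simp
  qed (use ps id sets in \<open>auto intro: prob_space.prob_space_distr\<close>)
  show ?thesis
  proof (rule measure_eqI)
    show "sets M = sets N" using sets by simp
    fix B assume B: "B \<in> sets M"
    then have B': "B \<in> sets borel" "B \<subseteq> \<Omega>"
      using sets(1) \<Omega> by (auto simp: sets_restrict_space_iff)
    have "emeasure (distr Q borel (\<lambda>x. x)) B = emeasure Q B" if "sets Q = sets (restrict_space borel \<Omega>)" for Q :: "'a measure"
      using id[OF that] B' sets_eq_imp_space_eq[OF that]
      by (subst emeasure_distr) (auto simp: space_restrict_space Int_absorb2)
    then show "emeasure M B = emeasure N B" using D sets by metis
  qed
qed

context markov_kernel
begin

lemma markov_chainI: "probability_on S \<nu> \<Longrightarrow> markov_chain S K \<nu>"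
  by (simp add: markov_chain_def markov_chain_axioms_def markov_kernel_axioms)

lemma
  assumes \<nu>: "probability_on S \<nu>"
  shows probability_on_bind: "probability_on S (\<nu> \<bind> K)"
    and emeasure_bind_kernel: "B \<in> sets S \<Longrightarrow> emeasure (\<nu> \<bind> K) B = (\<integral>\<^sup>+x. emeasure (K x) B \<partial>\<nu>)"
    and integral_bind_kernel: "f \<in> borel_measurable S \<Longrightarrow> (\<And>s. s \<in> space S \<Longrightarrow> \<bar>f s\<bar> \<le> b) \<Longrightarrow>
          integral\<^sup>L (\<nu> \<bind> K) f = integral\<^sup>L \<nu> (next_mean f)"
proof -
  interpret \<nu>: prob_space \<nu> using \<nu> by (simp add: probability_on_def)
  have sets: "sets \<nu> = sets S" using \<nu> by (simp add: probability_on_def)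
  then have space: "space \<nu> = space S" by (rule sets_eq_imp_space_eq)
  have K: "K \<in> \<nu> \<rightarrow>\<^sub>M subprob_algebra S"
    using kernel_subprob_algebra sets by (simp cong: measurable_cong_sets)
  have "prob_space (\<nu> \<bind> K)"
    by (rule \<nu>.prob_space_bind[OF AE_I2 K]) (simp add: prob_space_kernel space)
  then show "probability_on S (\<nu> \<bind> K)"
    using \<nu>.not_empty by (simp add: probability_on_def sets_bind_measurable[OF K])
  show "emeasure (\<nu> \<bind> K) B = (\<integral>\<^sup>+x. emeasure (K x) B \<partial>\<nu>)" if "B \<in> sets S"
    by (rule emeasure_bind[OF \<nu>.not_empty K that])
  show "integral\<^sup>L (\<nu> \<bind> K) f = integral\<^sup>L \<nu> (next_mean f)"
    if f: "f \<in> borel_measurable S" "\<And>s. s \<in> space S \<Longrightarrow> \<bar>f s\<bar> \<le> b"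
    unfolding next_mean_def[abs_def]
  proof (rule integral_bind[OF f K])
    show "finite_measure \<nu>" by unfold_locales
    show "AE x in \<nu>. emeasure (K x) (space (K x)) \<le> ennreal 1"
      by (rule AE_I2) (simp add: space prob_space.emeasure_space_1[OF prob_space_kernel])
  qed
qed

lemma invariant_measure_iff:
  "invariant_measure S K \<mu> \<longleftrightarrow> probability_on S \<mu> \<and> \<mu> \<bind> K = \<mu>"
proof (cases "probability_on S \<mu>")
  case True
  have "\<mu> \<bind> K = \<mu> \<longleftrightarrow> (\<forall>B\<in>sets S. emeasure (\<mu> \<bind> K) B = emeasure \<mu> B)"
    using True probability_on_bind[OF True] by (auto simp: probability_on_def intro!: measure_eqI)
  then show ?thesis
    using True emeasure_bind_kernel[OF True] by (simp add: invariant_measure_def)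
qed (simp add: invariant_measure_def)

lemma integral_funpow_next_mean_invariant:
  assumes \<mu>: "invariant_measure S K \<mu>"
    and f: "f \<in> borel_measurable S" "\<And>s. s \<in> space S \<Longrightarrow> \<bar>f s\<bar> \<le> b"
  shows "integral\<^sup>L \<mu> ((next_mean ^^ n) f) = integral\<^sup>L \<mu> f"
  using f
proof (induction n arbitrary: f)
  case (Suc n)
  have "integral\<^sup>L \<mu> ((next_mean ^^ Suc n) f) = integral\<^sup>L \<mu> ((next_mean ^^ n) (next_mean f))"
    by (simp add: funpow_swap1)
  also have "\<dots> = integral\<^sup>L \<mu> (next_mean f)"
    by (rule Suc.IH) (use Suc.prems in \<open>auto intro: next_mean_bounded\<close>)
  also have "\<dots> = integral\<^sup>L \<mu> f"
    using integral_bind_kernel[OF _ Suc.prems, of \<mu>] \<mu> by (simp add: invariant_measure_iff)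
  finally show ?case .
qed simp

text \<open>If \<open>B\<close> is invariant up to null sets and not a null set, then conditioning \<open>\<mu>\<close> on \<open>B\<close> gives an invariant
  measure as well. By uniqueness it is \<open>\<mu>\<close>, hence \<open>\<mu>\<close> is carried by \<open>B\<close>.\<close>

lemma ergodic_if_unique_invariant:
  assumes \<mu>: "invariant_measure S K \<mu>" and unique: "\<And>\<mu>'. invariant_measure S K \<mu>' \<Longrightarrow> \<mu>' = \<mu>"
  shows "ergodic_measure S K \<mu>"
  unfolding ergodic_measure_def
proof (intro conjI ballI impI \<mu>)
  have prob: "prob_space \<mu>" and sets: "sets \<mu> = sets S" and inv: "\<And>B. B \<in> sets S \<Longrightarrow> (\<integral>\<^sup>+x. emeasure (K x) B \<partial>\<mu>) = emeasure \<mu> B"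
    using \<mu> by (auto simp: invariant_measure_def probability_on_def)
  interpret \<mu>: prob_space \<mu> by (rule prob)
  have space: "space \<mu> = space S" by (rule sets_eq_imp_space_eq[OF sets])
  fix B assume B: "B \<in> sets S" and AE_B: "AE x in \<mu>. emeasure (K x) B = indicator B x"
  have B'[measurable]: "B \<in> sets \<mu>" using B sets by simp
  show "measure \<mu> B = 0 \<or> measure \<mu> B = 1"
  proof (rule disjCI)
    assume "measure \<mu> B \<noteq> 1"
    show "measure \<mu> B = 0"
    proof (rule ccontr)
      assume "measure \<mu> B \<noteq> 0"
      then have pos: "emeasure \<mu> B \<noteq> 0" by (simp add: \<mu>.emeasure_eq_measure)
      define \<nu> where "\<nu> = uniform_measure \<mu> B"
      have "prob_space \<nu>" unfolding \<nu>_def by (rule prob_space_uniform_measure[OF pos]) simp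
      moreover have "sets \<nu> = sets S" by (simp add: \<nu>_def sets)
      moreover have "(\<integral>\<^sup>+x. emeasure (K x) A \<partial>\<nu>) = emeasure \<nu> A" if A: "A \<in> sets S" for A
      proof -
        have K_meas: "(\<lambda>x. emeasure (K x) A) \<in> borel_measurable \<mu>" if "A \<in> sets S" for A
          using measurable_compose[OF kernel_subprob_algebra measurable_emeasure_subprob_algebra[OF that]] sets
          by (simp cong: measurable_cong_sets)
        have "(\<integral>\<^sup>+x. emeasure (K x) A * indicator B x \<partial>\<mu>) = (\<integral>\<^sup>+x. emeasure (K x) (B \<inter> A) \<partial>\<mu>)"
        proof (rule nn_integral_cong_AE)
          show "AE x in \<mu>. emeasure (K x) A * indicator B x = emeasure (K x) (B \<inter> A)"
            using AE_B AE_space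
          proof eventually_elim
            case (elim x)
            then have x: "x \<in> space S" using space by simp
            interpret K: prob_space "K x" by (rule prob_space_kernel[OF x])
            have s: "sets (K x) = sets S" by (rule sets_kernel[OF x])
            show ?case
            proof (cases "x \<in> B")
              case True
              then have "K.prob B = 1" using elim by (simp add: K.emeasure_eq_measure)
              then have "AE y in K x. y \<in> B" using B s by (subst K.AE_in_set_eq_1) auto
              then have "emeasure (K x) (B \<inter> A) = emeasure (K x) A"
                using A B s by (intro emeasure_eq_AE) auto
              then show ?thesis using True by simp
            next
              case False
              then have "emeasure (K x) (B \<inter> A) \<le> 0"
                using elim emeasure_mono[of "B \<inter> A" B "K x"] B s by simp
              then show ?thesis using False by simp
            qed
          qed
        qed
        also have "\<dots> = emeasure \<mu> (B \<inter> A)" using A B by (intro inv) auto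
        finally show ?thesis
          unfolding \<nu>_def nn_integral_uniform_measure[OF K_meas[OF A] B']
          using A sets by (simp add: emeasure_uniform_measure[OF B'])
      qed
      ultimately have "\<nu> = \<mu>"
        by (intro unique) (simp add: invariant_measure_def probability_on_def)
      then have "emeasure \<mu> B = emeasure (uniform_measure \<mu> B) B" by (simp add: \<nu>_def)
      also have "\<dots> = 1" using pos by (intro emeasure_uniform_measure_1) auto
      finally show False using \<open>measure \<mu> B \<noteq> 1\<close> by (simp add: \<mu>.emeasure_eq_measure)
    qed
  qed
qed

end

section \<open>Random choices with contracting dynamics\<close>

text \<open>A state has a component in the finite set \<open>X\<close> and a vector component. A choice, drawn with
  probabilities that depend on the vector, moves the first component by \<open>T\<close> and the second by an affine map whose
  linear part \<open>M\<close> does not depend on the choice. The function \<open>w\<close> bounds the sum of the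
  changes of the choice probabilities in terms of the distance of two vectors; its summability along geometric
  scales expresses the Dini condition.\<close>

locale contractive_choice_system =
  fixes X :: "'x::polish_space set"
    and Ch :: "'c set"
    and p :: "'c \<Rightarrow> 'v::euclidean_space \<Rightarrow> real"
    and T :: "'c \<Rightarrow> 'x \<Rightarrow> 'x"
    and M :: "'v \<Rightarrow> 'v"
    and b :: "'x \<Rightarrow> 'c \<Rightarrow> 'v"
    and N :: "'v \<Rightarrow> real"
    and \<rho> \<eta> :: real
    and w :: "real \<Rightarrow> real"
  assumes finite_X: "finite X" and X_nonempty: "X \<noteq> {}" and finite_Ch: "finite Ch"
    and T_closed: "c \<in> Ch \<Longrightarrow> x \<in> X \<Longrightarrow> T c x \<in> X"
    and p_sum: "(\<Sum>c\<in>Ch. p c v) = 1"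
    and p_lower: "c \<in> Ch \<Longrightarrow> \<eta> \<le> p c v" and \<eta>_pos: "0 < \<eta>"
    and linear_M: "linear M" and \<rho>: "0 < \<rho>" "\<rho> < 1" and N: "adapted_norm M \<rho> N"
    and p_modulus: "N (u - v) \<le> t \<Longrightarrow> (\<Sum>c\<in>Ch. \<bar>p c u - p c v\<bar>) \<le> w t"
    and w_summable: "summable (\<lambda>k. w (t * \<rho> ^ k))"
begin

definition step :: "'x \<times> 'v \<Rightarrow> 'c \<Rightarrow> 'x \<times> 'v" where
  "step s c = (T c (fst s), M (snd s) + b (fst s) c)"

text \<open>The transition operator as a finite sum. It is defined for all functions and agrees with
  \<open>next_mean\<close> on measurable ones.\<close>

definition mean_op :: "('x \<times> 'v \<Rightarrow> real) \<Rightarrow> 'x \<times> 'v \<Rightarrow> real" where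
  "mean_op f s = (\<Sum>c\<in>Ch. p c (snd s) * f (step s c))"

definition input_bound :: real where
  "input_bound = Max (insert 0 ((\<lambda>(x, c). N (b x c)) ` (X \<times> Ch)))"

text \<open>For such a radius the contraction compensates every input, so that the ball is forward invariant.\<close>

definition admissible_radius :: "real \<Rightarrow> bool" where
  "admissible_radius R \<longleftrightarrow> input_bound \<le> (1 - \<rho>) * R"

definition region :: "real \<Rightarrow> ('x \<times> 'v) set" where
  "region R = X \<times> {v. N v \<le> R}"

lemmas N_add = adapted_normD(1)[OF N] and N_contract = adapted_normD(4)[OF N]
  and N_0 = adapted_normD(5)[OF N] and N_nonneg = adapted_normD(6)[OF N]
  and N_diff = adapted_normD(7)[OF N] and norm_le_N = adapted_normD(3)[OF N]

lemma p_nonneg: "c \<in> Ch \<Longrightarrow> 0 \<le> p c v"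
  using p_lower[of c v] \<eta>_pos by linarith

lemma Ch_nonempty: "Ch \<noteq> {}"
  using p_sum by force

lemma input_bound_nonneg: "0 \<le> input_bound"
  unfolding input_bound_def using finite_X finite_Ch by (intro Max_ge) auto

lemma input_bound: "x \<in> X \<Longrightarrow> c \<in> Ch \<Longrightarrow> N (b x c) \<le> input_bound"
  unfolding input_bound_def using finite_X finite_Ch by (intro Max_ge) auto

lemma admissible_radius_nonneg:
  assumes "admissible_radius R" shows "0 \<le> R"
proof -
  have "0 \<le> (1 - \<rho>) * R" using assms input_bound_nonneg unfolding admissible_radius_def by linarith
  then show ?thesis using \<rho> by (simp add: zero_le_mult_iff)
qed

lemma ex_admissible_radius: "\<exists>R\<ge>r. admissible_radius R"
proof (intro exI conjI)
  show "r \<le> max r (input_bound / (1 - \<rho>))" by simp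
  have "input_bound / (1 - \<rho>) \<le> max r (input_bound / (1 - \<rho>))" by simp
  then show "admissible_radius (max r (input_bound / (1 - \<rho>)))"
    unfolding admissible_radius_def using \<rho> by (simp add: pos_divide_le_eq mult.commute del: max.cobounded2)
qed

lemma step_region:
  assumes R: "admissible_radius R" and s: "s \<in> region R" and c: "c \<in> Ch"
  shows "step s c \<in> region R"
proof -
  have s': "fst s \<in> X" "N (snd s) \<le> R" using s by (auto simp: region_def)
  have "N (M (snd s) + b (fst s) c) \<le> \<rho> * N (snd s) + input_bound"
    using N_add[of "M (snd s)" "b (fst s) c"] N_contract[of "snd s"] input_bound[OF s'(1) c] by linarith
  also have "\<dots> \<le> \<rho> * R + (1 - \<rho>) * R"
    using R s' \<rho> unfolding admissible_radius_def by (intro add_mono mult_left_mono) auto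
  finally show ?thesis using T_closed[OF c s'(1)] by (simp add: step_def region_def algebra_simps)
qed

lemma region_nonempty: "admissible_radius R \<Longrightarrow> region R \<noteq> {}"
  using X_nonempty admissible_radius_nonneg[of R] N_0 by (auto simp: region_def intro!: exI[of _ "0 :: 'v"])

lemma compact_region: "compact (region R)"
  unfolding region_def
  by (intro compact_Times finite_imp_compact finite_X compact_adapted_ball[OF N])

lemma bounded_on_region:
  fixes f :: "'x \<times> 'v \<Rightarrow> real"
  assumes "continuous_on (region R) f"
  obtains B where "0 \<le> B" "\<And>s. s \<in> region R \<Longrightarrow> \<bar>f s\<bar> \<le> B"
proof -
  have "bounded (f ` region R)"
    by (intro compact_imp_bounded compact_continuous_image assms compact_region)
  then obtain B where "\<And>s. s \<in> region R \<Longrightarrow> \<bar>f s\<bar> \<le> B" by (auto simp: bounded_iff)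
  then show ?thesis by (intro that[of "max 0 B"]) (auto simp: le_max_iff_disj)
qed

lemma mean_op_cong:
  assumes R: "admissible_radius R" and eq: "\<And>s. s \<in> region R \<Longrightarrow> f s = g s" and s: "s \<in> region R"
  shows "mean_op f s = mean_op g s"
  unfolding mean_op_def using eq step_region[OF R s] by (intro sum.cong) auto

lemma funpow_mean_op_cong:
  assumes R: "admissible_radius R" and eq: "\<And>s. s \<in> region R \<Longrightarrow> f s = g s" and s: "s \<in> region R"
  shows "(mean_op ^^ n) f s = (mean_op ^^ n) g s"
  using s by (induction n arbitrary: s) (auto simp: eq intro: mean_op_cong[OF R])

lemma mean_op_le:
  assumes "\<And>c. c \<in> Ch \<Longrightarrow> f (step s c) \<le> B"
  shows "mean_op f s \<le> B"
proof -
  have "mean_op f s \<le> (\<Sum>c\<in>Ch. p c (snd s) * B)"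
    unfolding mean_op_def using assms p_nonneg by (intro sum_mono mult_left_mono) auto
  also have "\<dots> = B" by (simp add: sum_distrib_right[symmetric] p_sum)
  finally show ?thesis .
qed

lemma mean_op_minus: "mean_op (\<lambda>s. - f s) s = - mean_op f s"
  by (simp add: mean_op_def sum_negf)

lemma funpow_mean_op_minus: "(mean_op ^^ n) (\<lambda>s. - f s) s = - (mean_op ^^ n) f s"
  by (induction n arbitrary: s) (simp_all add: mean_op_minus mean_op_def sum_negf)

lemma funpow_mean_op_le:
  assumes R: "admissible_radius R" and le: "\<And>s. s \<in> region R \<Longrightarrow> f s \<le> B" and s: "s \<in> region R"
  shows "(mean_op ^^ n) f s \<le> B"
  using s
proof (induction n arbitrary: s)
  case 0 then show ?case by (simp add: le)
next
  case (Suc n)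
  show ?case unfolding funpow.simps(2) comp_apply
    by (rule mean_op_le) (rule Suc.IH[OF step_region[OF R Suc.prems]])
qed

lemma funpow_mean_op_ge:
  assumes R: "admissible_radius R" and le: "\<And>s. s \<in> region R \<Longrightarrow> B \<le> f s" and s: "s \<in> region R"
  shows "B \<le> (mean_op ^^ n) f s"
  using funpow_mean_op_le[OF R _ s, of "\<lambda>s. - f s" "- B" n] le by (simp add: funpow_mean_op_minus)

lemma funpow_mean_op_abs_le:
  assumes R: "admissible_radius R" and le: "\<And>s. s \<in> region R \<Longrightarrow> \<bar>f s\<bar> \<le> B" and s: "s \<in> region R"
  shows "\<bar>(mean_op ^^ n) f s\<bar> \<le> B"
  using funpow_mean_op_le[OF R _ s, of f B n] funpow_mean_op_ge[OF R _ s, of "- B" f n] le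
  by (auto simp: abs_le_iff minus_le_iff)

text \<open>In one step the difference of the means splits into a part with equal choice probabilities, where
  contraction passes from scale \<open>j\<close> to scale \<open>j + 1\<close>, and a part that is bounded by the variation of the
  choice probabilities at scale \<open>j\<close>.\<close>

lemma funpow_mean_op_modulus:
  assumes R: "admissible_radius R" and B: "\<And>s. s \<in> region R \<Longrightarrow> \<bar>f s\<bar> \<le> B"
    and f: "\<And>x u v. x \<in> X \<Longrightarrow> N u \<le> R \<Longrightarrow> N v \<le> R \<Longrightarrow> N (u - v) \<le> t * \<rho> ^ i \<Longrightarrow> \<bar>f (x, u) - f (x, v)\<bar> \<le> \<epsilon>"
    and t: "0 \<le> t" and ij: "i \<le> j"
    and x: "x \<in> X" "N u \<le> R" "N v \<le> R" "N (u - v) \<le> t * \<rho> ^ j"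
  shows "\<bar>(mean_op ^^ n) f (x, u) - (mean_op ^^ n) f (x, v)\<bar> \<le> \<epsilon> + B * (\<Sum>k<n. w (t * \<rho> ^ (j + k)))"
  using ij x
proof (induction n arbitrary: j x u v)
  case 0
  have "t * \<rho> ^ j \<le> t * \<rho> ^ i" using t \<rho> 0 by (intro mult_left_mono power_decreasing) auto
  then show ?case using 0 f[of x u v] by simp
next
  case (Suc n)
  let ?F = "(mean_op ^^ n) f"
  let ?e = "\<epsilon> + B * (\<Sum>k<n. w (t * \<rho> ^ (Suc j + k)))"
  have reg: "(x, u) \<in> region R" "(x, v) \<in> region R" using Suc.prems by (auto simp: region_def)
  obtain y where "y \<in> region R" using reg by blast
  then have "0 \<le> B" using B[of y] by linarith
  have near: "\<bar>?F (step (x, u) c) - ?F (step (x, v) c)\<bar> \<le> ?e" if c: "c \<in> Ch" for c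
  proof -
    have "N ((M u + b x c) - (M v + b x c)) \<le> t * \<rho> ^ Suc j"
    proof -
      have "N ((M u + b x c) - (M v + b x c)) = N (M (u - v))" by (simp add: linear_diff[OF linear_M])
      also have "\<dots> \<le> \<rho> * N (u - v)" by (rule N_contract)
      also have "\<dots> \<le> \<rho> * (t * \<rho> ^ j)" using Suc.prems \<rho> by (intro mult_left_mono) auto
      finally show ?thesis by (simp add: mult_ac)
    qed
    moreover have "i \<le> Suc j" using Suc.prems by simp
    ultimately show ?thesis
      using step_region[OF R reg(1) c] step_region[OF R reg(2) c]
        Suc.IH[of "Suc j" "T c x" "M u + b x c" "M v + b x c"]
      by (simp add: step_def region_def del: power_Suc)
  qed
  have split: "mean_op ?F (x, u) - mean_op ?F (x, v)
      = (\<Sum>c\<in>Ch. p c u * (?F (step (x, u) c) - ?F (step (x, v) c)) + (p c u - p c v) * ?F (step (x, v) c))"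
    unfolding mean_op_def sum_subtractf[symmetric] by (intro sum.cong refl) (simp add: algebra_simps)
  have "\<bar>mean_op ?F (x, u) - mean_op ?F (x, v)\<bar> \<le> (\<Sum>c\<in>Ch. p c u * ?e + \<bar>p c u - p c v\<bar> * B)"
    unfolding split
  proof (rule order.trans[OF sum_abs], rule sum_mono)
    fix c assume c: "c \<in> Ch"
    have "\<bar>p c u * (?F (step (x, u) c) - ?F (step (x, v) c))\<bar> \<le> p c u * ?e"
      unfolding abs_mult using p_nonneg[OF c] near[OF c] by (intro mult_mono) auto
    moreover have "\<bar>(p c u - p c v) * ?F (step (x, v) c)\<bar> \<le> \<bar>p c u - p c v\<bar> * B"
      unfolding abs_mult
      by (intro mult_left_mono funpow_mean_op_abs_le[OF R B] step_region[OF R reg(2) c]) auto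
    ultimately show "\<bar>p c u * (?F (step (x, u) c) - ?F (step (x, v) c)) + (p c u - p c v) * ?F (step (x, v) c)\<bar>
        \<le> p c u * ?e + \<bar>p c u - p c v\<bar> * B" by linarith
  qed
  also have "\<dots> = ?e + (\<Sum>c\<in>Ch. \<bar>p c u - p c v\<bar>) * B"
  proof -
    have "(\<Sum>c\<in>Ch. p c u * E) = E" for E
      by (simp add: sum_distrib_right[symmetric] p_sum)
    then show ?thesis by (simp only: sum.distrib sum_distrib_right)
  qed
  also have "\<dots> \<le> ?e + w (t * \<rho> ^ j) * B"
    using Suc.prems \<open>0 \<le> B\<close> by (intro add_left_mono mult_right_mono p_modulus) auto
  also have "\<dots> = \<epsilon> + B * (\<Sum>k<Suc n. w (t * \<rho> ^ (j + k)))"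
    unfolding sum.lessThan_Suc_shift by (simp add: distrib_left mult.commute)
  finally show ?case by simp
qed

lemma w_nonneg: "0 \<le> t \<Longrightarrow> 0 \<le> w t"
  using p_modulus[of 0 0 t] N_0 by simp

text \<open>The sum of the errors is a tail of a convergent series, whatever the number \<open>n\<close> of steps is.\<close>

lemma equicontinuous_mean_op:
  assumes f: "continuous_on (X \<times> UNIV) f" and R: "admissible_radius R" and \<epsilon>: "0 < \<epsilon>"
  obtains i where "\<And>n x u v. x \<in> X \<Longrightarrow> N u \<le> R \<Longrightarrow> N v \<le> R \<Longrightarrow> N (u - v) \<le> 2 * R * \<rho> ^ i \<Longrightarrow>
    \<bar>(mean_op ^^ n) f (x, u) - (mean_op ^^ n) f (x, v)\<bar> \<le> \<epsilon>"
proof -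
  have f': "continuous_on (region R) f"
    by (rule continuous_on_subset[OF f]) (auto simp: region_def)
  obtain B where "0 \<le> B" and B: "\<And>s. s \<in> region R \<Longrightarrow> \<bar>f s\<bar> \<le> B"
    using bounded_on_region[OF f'] by blast
  let ?t = "2 * R"
  have t: "0 \<le> ?t" using admissible_radius_nonneg[OF R] by simp
  have "uniformly_continuous_on (region R) f"
    by (rule compact_uniformly_continuous[OF f' compact_region])
  moreover have "0 < \<epsilon> / 2" using \<epsilon> by simp
  ultimately obtain d where "0 < d"
    and d: "\<And>s s'. s \<in> region R \<Longrightarrow> s' \<in> region R \<Longrightarrow> dist s' s < d \<Longrightarrow> dist (f s') (f s) < \<epsilon> / 2"
    unfolding uniformly_continuous_on_def by meson
  have "(\<lambda>i. ?t * \<rho> ^ i) \<longlonglongrightarrow> ?t * 0"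
    using \<rho> by (intro tendsto_mult tendsto_const LIMSEQ_power_zero) auto
  then have ev1: "\<forall>\<^sub>F i in sequentially. ?t * \<rho> ^ i < d" using \<open>0 < d\<close> by (intro order_tendstoD(2)) auto
  \<comment> \<open>\<open>B + 1\<close> instead of \<open>B\<close> avoids a division by 0.\<close>
  have "0 < \<epsilon> / (2 * (B + 1))" using \<epsilon> \<open>0 \<le> B\<close> by simp
  from suminf_exist_split[OF this w_summable]
  obtain i1 where i1: "\<And>i. i \<ge> i1 \<Longrightarrow> norm (\<Sum>k. w (?t * \<rho> ^ (k + i))) < \<epsilon> / (2 * (B + 1))" by blast
  from ev1 obtain i0 where i0: "\<And>i. i \<ge> i0 \<Longrightarrow> ?t * \<rho> ^ i < d" by (auto simp: eventually_sequentially)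
  define i where "i = max i0 i1"
  show thesis
  proof (rule that[of i])
    fix n x u v assume x: "x \<in> X" "N u \<le> R" "N v \<le> R" "N (u - v) \<le> ?t * \<rho> ^ i"
    have fe: "\<bar>f (x, u) - f (x, v)\<bar> \<le> \<epsilon> / 2"
      if "x \<in> X" "N u \<le> R" "N v \<le> R" "N (u - v) \<le> ?t * \<rho> ^ i" for x u v
    proof -
      have "dist (x, u) (x, v) \<le> N (u - v)"
        using norm_le_N[of "u - v"] by (simp add: dist_Pair_Pair dist_norm)
      then have "dist (x, u) (x, v) < d" using that i0[of i] by (simp add: i_def)
      then show ?thesis using d[of "(x, v)" "(x, u)"] that by (simp add: region_def dist_real_def)
    qed
    have "\<bar>(mean_op ^^ n) f (x, u) - (mean_op ^^ n) f (x, v)\<bar> \<le> \<epsilon> / 2 + B * (\<Sum>k<n. w (?t * \<rho> ^ (i + k)))"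
      by (rule funpow_mean_op_modulus[where f=f and i=i and j=i, OF R B fe t order.refl x])
    moreover have "B * (\<Sum>k<n. w (?t * \<rho> ^ (i + k))) \<le> \<epsilon> / 2"
    proof -
      have "(\<Sum>k<n. w (?t * \<rho> ^ (i + k))) \<le> (\<Sum>k. w (?t * \<rho> ^ (k + i)))"
        unfolding add.commute[of i] using t \<rho>
        by (intro sum_le_suminf summable_ignore_initial_segment w_summable) (auto intro!: w_nonneg)
      also have "\<dots> \<le> \<epsilon> / (2 * (B + 1))" using i1[of i] by (simp add: i_def)
      finally have "B * (\<Sum>k<n. w (?t * \<rho> ^ (i + k))) \<le> B * (\<epsilon> / (2 * (B + 1)))"
        using \<open>0 \<le> B\<close> by (rule mult_left_mono)
      also have "\<dots> \<le> (B + 1) * (\<epsilon> / (2 * (B + 1)))"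
        using \<epsilon> \<open>0 \<le> B\<close> by (intro mult_right_mono) auto
      also have "\<dots> = \<epsilon> / 2"
      proof -
        have "B + 1 \<noteq> 0" using \<open>0 \<le> B\<close> by linarith
        then show ?thesis by (simp add: divide_simps)
      qed
      finally show ?thesis .
    qed
    ultimately show "\<bar>(mean_op ^^ n) f (x, u) - (mean_op ^^ n) f (x, v)\<bar> \<le> \<epsilon>"
      by linarith
  qed
qed

abbreviation run :: "'x \<times> 'v \<Rightarrow> 'c list \<Rightarrow> 'x \<times> 'v" where "run \<equiv> foldl step"

lemma run_region:
  "admissible_radius R \<Longrightarrow> s \<in> region R \<Longrightarrow> set cs \<subseteq> Ch \<Longrightarrow> run s cs \<in> region R"
proof (induction cs arbitrary: s)
  case (Cons c cs)
  then show ?case using Cons.IH[OF Cons.prems(1) step_region[OF Cons.prems(1,2), of c]] by simp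
qed simp

lemma fst_run: "fst (run s cs) = foldl (\<lambda>x c. T c x) (fst s) cs"
  by (induction cs arbitrary: s) (auto simp: step_def)

lemma run_contracts:
  "fst s = fst s' \<Longrightarrow> N (snd (run s cs) - snd (run s' cs)) \<le> \<rho> ^ length cs * N (snd s - snd s')"
proof (induction cs arbitrary: s s')
  case (Cons c cs)
  have "N (snd (run s (c # cs)) - snd (run s' (c # cs)))
      \<le> \<rho> ^ length cs * N (snd (step s c) - snd (step s' c))"
  proof -
    have "fst (step s c) = fst (step s' c)" using Cons.prems by (simp add: step_def)
    from Cons.IH[OF this] show ?thesis by (simp only: foldl_Cons)
  qed
  also have "snd (step s c) - snd (step s' c) = M (snd s - snd s')"
    using Cons.prems by (simp add: step_def linear_diff[OF linear_M])
  also have "\<rho> ^ length cs * N (M (snd s - snd s')) \<le> \<rho> ^ length cs * (\<rho> * N (snd s - snd s'))"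
    using \<rho> by (intro mult_left_mono N_contract) auto
  finally show ?case by (simp add: mult_ac)
qed simp

text \<open>The choice sequence \<open>cs\<close> has probability at least \<open>\<eta> ^ length cs\<close>, and \<open>f\<close> is at most \<open>B\<close> at
  the end of all other sequences.\<close>

lemma funpow_mean_op_le_run:
  assumes R: "admissible_radius R" and le: "\<And>s. s \<in> region R \<Longrightarrow> f s \<le> B"
    and s: "s \<in> region R" and cs: "set cs \<subseteq> Ch"
  shows "(mean_op ^^ length cs) f s \<le> B - \<eta> ^ length cs * (B - f (run s cs))"
  using s cs
proof (induction cs arbitrary: s)
  case (Cons c cs)
  let ?F = "(mean_op ^^ length cs) f" and ?g = "\<eta> ^ length cs * (B - f (run s (c # cs)))"
  have c: "c \<in> Ch" using Cons.prems by simp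
  have g: "0 \<le> ?g"
    using le[OF run_region[OF R Cons.prems]] \<eta>_pos by simp
  have "mean_op ?F s = p c (snd s) * ?F (step s c) + (\<Sum>c'\<in>Ch - {c}. p c' (snd s) * ?F (step s c'))"
    unfolding mean_op_def by (rule sum.remove[OF finite_Ch c])
  also have "\<dots> \<le> p c (snd s) * (B - ?g) + (\<Sum>c'\<in>Ch - {c}. p c' (snd s) * B)"
  proof (rule add_mono)
    show "p c (snd s) * ?F (step s c) \<le> p c (snd s) * (B - ?g)"
      using Cons.IH[OF step_region[OF R Cons.prems(1) c]] Cons.prems p_nonneg[OF c]
      by (intro mult_left_mono) auto
    show "(\<Sum>c'\<in>Ch - {c}. p c' (snd s) * ?F (step s c')) \<le> (\<Sum>c'\<in>Ch - {c}. p c' (snd s) * B)"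
      using p_nonneg by (intro sum_mono mult_left_mono funpow_mean_op_le[OF R le] step_region[OF R Cons.prems(1)]) auto
  qed
  also have "\<dots> = (\<Sum>c'\<in>Ch. p c' (snd s) * B) - p c (snd s) * ?g"
    unfolding sum.remove[OF finite_Ch c] by (simp add: algebra_simps)
  also have "\<dots> = B - p c (snd s) * ?g"
    by (simp add: sum_distrib_right[symmetric] p_sum)
  also have "\<dots> \<le> B - \<eta> * ?g"
    using p_lower[OF c] g by (intro diff_left_mono mult_right_mono) auto
  finally show ?case by (simp add: mult_ac)
qed simp

lemma funpow_mean_op_ge_run:
  assumes R: "admissible_radius R" and le: "\<And>s. s \<in> region R \<Longrightarrow> B \<le> f s"
    and s: "s \<in> region R" and cs: "set cs \<subseteq> Ch"
  shows "B + \<eta> ^ length cs * (f (run s cs) - B) \<le> (mean_op ^^ length cs) f s"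
  using funpow_mean_op_le_run[OF R _ s cs, of "\<lambda>s. - f s" "- B"] le
  by (simp add: funpow_mean_op_minus algebra_simps)

end

text \<open>The number \<open>J\<close> of steps is the same for all pairs of states; this is where primitivity goes beyond
  strong connectedness.\<close>

locale mixing_choice_system = contractive_choice_system +
  fixes J :: nat
  assumes reach: "x \<in> X \<Longrightarrow> y \<in> X \<Longrightarrow> \<exists>cs. length cs = J \<and> set cs \<subseteq> Ch \<and> foldl (\<lambda>x c. T c x) x cs = y"
begin

text \<open>The upper and lower bounds \<open>hi n\<close> and \<open>lo n\<close> of the \<open>n\<close>-th iterate on the region are monotone. Two states are steered
  to a common first component in \<open>J\<close> steps and then closer together by \<open>i\<close> equal choices, where \<open>i\<close>
  comes from equicontinuity for \<open>\<epsilon>\<close>. Both choice sequences have probability at least \<open>a = \<eta>\<^sup>J\<^sup>+\<^sup>i\<close>, so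
  the gap satisfies \<open>hi - lo \<le> (1 - a) (hi - lo) + a \<epsilon>\<close> after \<open>J + i\<close> steps. In the limit it is at most \<open>\<epsilon>\<close>.\<close>

lemma uniform_limit_mean_op:
  assumes f: "continuous_on (X \<times> UNIV) f" and R: "admissible_radius R"
  obtains L where "uniform_limit (region R) (\<lambda>n. (mean_op ^^ n) f) (\<lambda>_. L) sequentially"
proof -
  let ?Q = "\<lambda>n. (mean_op ^^ n) f"
  have "continuous_on (region R) f"
    by (rule continuous_on_subset[OF f]) (auto simp: region_def)
  then obtain B where B: "\<And>s. s \<in> region R \<Longrightarrow> \<bar>f s\<bar> \<le> B" using bounded_on_region by blast
  obtain s0 where s0: "s0 \<in> region R" using region_nonempty[OF R] by blast
  have Q_B: "\<bar>?Q n s\<bar> \<le> B" if "s \<in> region R" for n s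
    by (rule funpow_mean_op_abs_le[OF R B that])
  have Q_B': "- B \<le> ?Q n s" if "s \<in> region R" for n s
    using abs_le_D2[OF Q_B[OF that, of n]] by simp
  have bdd: "bdd_above (?Q n ` region R)" "bdd_below (?Q n ` region R)" for n
    by (rule bdd_aboveI2, erule abs_le_D1[OF Q_B]) (rule bdd_belowI2, erule Q_B')
  define hi where "hi n = Sup (?Q n ` region R)" for n
  define lo where "lo n = Inf (?Q n ` region R)" for n
  have hi: "?Q n s \<le> hi n" and lo: "lo n \<le> ?Q n s" if "s \<in> region R" for n s
    unfolding hi_def lo_def using that bdd by (auto intro: cSup_upper cInf_lower)
  have hi_least: "hi n \<le> a" if "\<And>s. s \<in> region R \<Longrightarrow> ?Q n s \<le> a" for n a
    unfolding hi_def using that s0 by (intro cSup_least) auto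
  have lo_greatest: "a \<le> lo n" if "\<And>s. s \<in> region R \<Longrightarrow> a \<le> ?Q n s" for n a
    unfolding lo_def using that s0 by (intro cInf_greatest) auto
  have Q_add: "?Q (n + k) s = (mean_op ^^ k) (?Q n) s" for n k s
    unfolding add.commute[of n k] funpow_add by simp
  have hi_dec: "decseq hi"
  proof (rule decseq_SucI, rule hi_least)
    show "?Q (Suc n) s \<le> hi n" if "s \<in> region R" for n s
      using funpow_mean_op_le[where f="?Q n" and B="hi n" and n=1, OF R hi that] by simp
  qed
  have lo_inc: "incseq lo"
  proof (rule incseq_SucI, rule lo_greatest)
    show "lo n \<le> ?Q (Suc n) s" if "s \<in> region R" for n s
      using funpow_mean_op_ge[where f="?Q n" and B="lo n" and n=1, OF R lo that] by simp
  qed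
  have lo_hi: "lo n \<le> hi n" for n using hi[OF s0, of n] lo[OF s0, of n] by linarith
  have hi_ge: "- B \<le> hi n" and lo_le: "lo n \<le> B" for n
    using hi[OF s0, of n] lo[OF s0, of n] Q_B[OF s0, of n] by auto
  obtain H where H: "hi \<longlonglongrightarrow> H" "\<And>n. H \<le> hi n" using decseq_convergent[OF hi_dec allI[OF hi_ge]] by blast
  obtain L where L: "lo \<longlonglongrightarrow> L" "\<And>n. lo n \<le> L" using incseq_convergent[OF lo_inc allI[OF lo_le]] by blast
  have "H - L \<le> \<epsilon>" if \<epsilon>: "0 < \<epsilon>" for \<epsilon>
  proof -
    obtain i where i: "\<And>n x u v. x \<in> X \<Longrightarrow> N u \<le> R \<Longrightarrow> N v \<le> R \<Longrightarrow> N (u - v) \<le> 2 * R * \<rho> ^ i \<Longrightarrow>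
        \<bar>?Q n (x, u) - ?Q n (x, v)\<bar> \<le> \<epsilon>"
      using equicontinuous_mean_op[OF f R \<epsilon>] by blast
    let ?k = "J + i"
    let ?a = "\<eta> ^ ?k"
    have a: "0 < ?a" using \<eta>_pos by simp
    have contract: "hi (n + ?k) - lo (n + ?k) \<le> (1 - ?a) * (hi n - lo n) + ?a * \<epsilon>" for n
    proof -
      have pair: "?Q (n + ?k) s - ?Q (n + ?k) s' \<le> (1 - ?a) * (hi n - lo n) + ?a * \<epsilon>"
        if s: "s \<in> region R" "s' \<in> region R" for s s'
      proof -
        obtain z where z: "z \<in> X" using X_nonempty by blast
        have "fst s \<in> X" "fst s' \<in> X" using s by (auto simp: region_def)
        then obtain cs cs' where cs: "length cs = J" "set cs \<subseteq> Ch" "foldl (\<lambda>x c. T c x) (fst s) cs = z"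
          and cs': "length cs' = J" "set cs' \<subseteq> Ch" "foldl (\<lambda>x c. T c x) (fst s') cs' = z"
          using reach z by meson
        obtain c where c: "c \<in> Ch" using Ch_nonempty by blast
        define ds where "ds = replicate i c"
        have ds: "set ds \<subseteq> Ch" "length ds = i" using c by (auto simp: ds_def)
        define e where "e = run s (cs @ ds)"
        define e' where "e' = run s' (cs' @ ds)"
        have e: "e \<in> region R" "e' \<in> region R"
          unfolding e_def e'_def using run_region[OF R] s cs(2) cs'(2) ds by auto
        have mid: "run s cs \<in> region R" "run s' cs' \<in> region R" "fst (run s cs) = fst (run s' cs')"
          using run_region[OF R] s cs cs' by (auto simp: fst_run)
        have "fst e = fst e'" unfolding e_def e'_def by (simp add: fst_run cs cs')
        moreover have "N (snd e - snd e') \<le> 2 * R * \<rho> ^ i"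
        proof -
          have "N (snd e - snd e') \<le> \<rho> ^ i * N (snd (run s cs) - snd (run s' cs'))"
            unfolding e_def e'_def using run_contracts[OF mid(3), of ds] ds by simp
          also have "\<dots> \<le> \<rho> ^ i * (R + R)"
            using N_diff[of "snd (run s cs)" "snd (run s' cs')"] mid \<rho>
            by (intro mult_left_mono) (auto simp: region_def)
          finally show ?thesis by (simp add: mult_ac)
        qed
        ultimately have "\<bar>?Q n e - ?Q n e'\<bar> \<le> \<epsilon>"
          using i[of "fst e" "snd e" "snd e'" n] e
          by (metis (no_types, lifting) SigmaE mem_Collect_eq prod.collapse prod.sel region_def)
        then have Qe: "?a * (?Q n e - ?Q n e') \<le> ?a * \<epsilon>"
          using a by (intro mult_left_mono) auto
        have len: "length (cs @ ds) = ?k" "length (cs' @ ds) = ?k" using cs cs' ds by auto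
        have "(mean_op ^^ ?k) (?Q n) s \<le> hi n - ?a * (hi n - ?Q n e)"
          using funpow_mean_op_le_run[where f="?Q n" and B="hi n" and cs="cs @ ds", OF R hi s(1)] cs ds
          unfolding len e_def[symmetric] by simp
        moreover have "lo n + ?a * (?Q n e' - lo n) \<le> (mean_op ^^ ?k) (?Q n) s'"
          using funpow_mean_op_ge_run[where f="?Q n" and B="lo n" and cs="cs' @ ds", OF R lo s(2)] cs' ds
          unfolding len e'_def[symmetric] by simp
        ultimately have "(mean_op ^^ ?k) (?Q n) s - (mean_op ^^ ?k) (?Q n) s' \<le> (1 - ?a) * (hi n - lo n) + ?a * \<epsilon>"
          using Qe by (simp add: algebra_simps)
        then show ?thesis
          by (simp only: Q_add[where n=n and k="?k" and s=s] Q_add[where n=n and k="?k" and s=s'])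
      qed
      have "hi (n + ?k) \<le> lo (n + ?k) + ((1 - ?a) * (hi n - lo n) + ?a * \<epsilon>)"
      proof (rule hi_least)
        fix s assume s: "s \<in> region R"
        have "?Q (n + ?k) s - ((1 - ?a) * (hi n - lo n) + ?a * \<epsilon>) \<le> lo (n + ?k)"
          by (rule lo_greatest) (use pair[OF s] in \<open>auto simp: algebra_simps\<close>)
        then show "?Q (n + ?k) s \<le> lo (n + ?k) + ((1 - ?a) * (hi n - lo n) + ?a * \<epsilon>)" by linarith
      qed
      then show ?thesis by linarith
    qed
    have "(\<lambda>n. hi (n + ?k) - lo (n + ?k)) \<longlonglongrightarrow> H - L"
      by (intro tendsto_diff LIMSEQ_ignore_initial_segment H L)
    moreover have "(\<lambda>n. (1 - ?a) * (hi n - lo n) + ?a * \<epsilon>) \<longlonglongrightarrow> (1 - ?a) * (H - L) + ?a * \<epsilon>"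
      by (intro tendsto_intros H L)
    ultimately have "H - L \<le> (1 - ?a) * (H - L) + ?a * \<epsilon>"
      by (rule LIMSEQ_le) (use contract in auto)
    then have "?a * (H - L) \<le> ?a * \<epsilon>" by (simp add: algebra_simps)
    then show ?thesis using a by simp
  qed
  then have "H \<le> L" using field_le_epsilon[of H L] by (simp add: algebra_simps)
  moreover have "L \<le> H" using lo_hi by (intro LIMSEQ_le[OF L(1) H(1)]) auto
  ultimately have HL: "H = L" by simp
  have "uniform_limit (region R) ?Q (\<lambda>_. L) sequentially"
    unfolding uniform_limit_iff
  proof (intro allI impI)
    fix \<epsilon> :: real assume "0 < \<epsilon>"
    have "(\<lambda>n. hi n - lo n) \<longlonglongrightarrow> H - L" by (intro tendsto_diff H L)
    then have "\<forall>\<^sub>F n in sequentially. hi n - lo n < \<epsilon>"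
      using HL \<open>0 < \<epsilon>\<close> by (intro order_tendstoD(2)) auto
    then show "\<forall>\<^sub>F n in sequentially. \<forall>s\<in>region R. dist (?Q n s) L < \<epsilon>"
    proof eventually_elim
      case (elim n)
      show ?case
      proof
        fix s assume "s \<in> region R"
        then show "dist (?Q n s) L < \<epsilon>"
          using hi[of s n] lo[of s n] H(2)[of n] L(2)[of n] HL elim by (auto simp: dist_real_def)
      qed
    qed
  qed
  then show thesis by (rule that)
qed

end

section \<open>The transition kernel of a choice system\<close>

context contractive_choice_system
begin

definition state_space :: "('x \<times> 'v) measure" where
  "state_space = restrict_space borel (X \<times> UNIV)"

definition kernel :: "'x \<times> 'v \<Rightarrow> ('x \<times> 'v) measure" where
  "kernel s = distr (point_measure Ch (\<lambda>c. ennreal (p c (snd s)))) state_space (step s)"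

lemma space_state_space: "space state_space = X \<times> UNIV"
  by (simp add: state_space_def space_restrict_space)

lemma closed_states: "closed (X \<times> (UNIV :: 'v set))"
  by (intro closed_Times finite_imp_closed[OF finite_X] closed_UNIV)

lemma continuous_on_p:
  assumes c: "c \<in> Ch"
  shows "continuous_on UNIV (p c)"
  unfolding continuous_on_iff
proof (intro ballI allI impI)
  fix v :: 'v and e :: real assume "0 < e"
  have "(\<lambda>k. w (1 * \<rho> ^ k)) \<longlonglongrightarrow> 0" by (rule summable_LIMSEQ_zero[OF w_summable])
  then have "\<forall>\<^sub>F k in sequentially. w (1 * \<rho> ^ k) < e" using \<open>0 < e\<close> by (rule order_tendstoD(2))
  then obtain k where k: "w (\<rho> ^ k) < e" by (auto simp: eventually_sequentially)
  obtain C where C: "\<And>v. N v \<le> C * norm v" using N by (auto simp: adapted_norm_def)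
  show "\<exists>d>0. \<forall>u\<in>UNIV. dist u v < d \<longrightarrow> dist (p c u) (p c v) < e"
  proof (intro exI conjI ballI impI)
    show "0 < \<rho> ^ k / (\<bar>C\<bar> + 1)" using \<rho> by simp
    fix u assume "dist u v < \<rho> ^ k / (\<bar>C\<bar> + 1)"
    then have "norm (u - v) * (\<bar>C\<bar> + 1) < \<rho> ^ k" by (simp add: dist_norm pos_less_divide_eq)
    moreover have "N (u - v) \<le> norm (u - v) * (\<bar>C\<bar> + 1)"
      by (rule order.trans[OF C]) (simp add: mult.commute[of C] mult_left_mono)
    ultimately have "(\<Sum>c\<in>Ch. \<bar>p c u - p c v\<bar>) \<le> w (\<rho> ^ k)" by (intro p_modulus) simp
    moreover have "\<bar>p c u - p c v\<bar> \<le> (\<Sum>c\<in>Ch. \<bar>p c u - p c v\<bar>)"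
      using member_le_sum[OF c, of "\<lambda>c. \<bar>p c u - p c v\<bar>"] finite_Ch by simp
    ultimately show "dist (p c u) (p c v) < e" using k by (simp add: dist_real_def)
  qed
qed

lemma continuous_on_p_snd: "c \<in> Ch \<Longrightarrow> continuous_on A (\<lambda>s. p c (snd s))"
  by (rule continuous_on_compose2[OF continuous_on_p continuous_on_snd]) (auto intro: continuous_on_id)

lemma continuous_on_step: "continuous_on (X \<times> UNIV) (\<lambda>s. step s c)"
proof -
  have fst: "continuous_on (X \<times> (UNIV :: 'v set)) fst" by (intro continuous_intros)
  have snd: "continuous_on (X \<times> (UNIV :: 'v set)) snd" by (intro continuous_intros)
  have "continuous_on (X \<times> (UNIV :: 'v set)) (\<lambda>s. T c (fst s))"
    by (rule continuous_on_compose2[OF continuous_on_finite[OF finite_X] fst]) auto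
  moreover have "continuous_on (X \<times> (UNIV :: 'v set)) (\<lambda>s. b (fst s) c)"
    by (rule continuous_on_compose2[OF continuous_on_finite[OF finite_X] fst]) auto
  moreover have "continuous_on (X \<times> (UNIV :: 'v set)) (\<lambda>s. M (snd s))"
    by (rule continuous_on_compose2[OF linear_continuous_on[OF linear_conv_bounded_linear[THEN iffD1, OF linear_M]] snd]) auto
  ultimately show ?thesis unfolding step_def by (intro continuous_intros)
qed

lemma borel_measurable_continuous:
  fixes f :: "'x \<times> 'v \<Rightarrow> 'z::topological_space"
  shows "continuous_on (X \<times> UNIV) f \<Longrightarrow> f \<in> borel_measurable state_space"
  unfolding state_space_def by (rule borel_measurable_continuous_on_restrict)

lemma measurable_step[measurable]:
  assumes "c \<in> Ch"
  shows "(\<lambda>s. step s c) \<in> state_space \<rightarrow>\<^sub>M state_space"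
proof -
  have "(\<lambda>s. step s c) \<in> state_space \<rightarrow>\<^sub>M borel"
    by (rule borel_measurable_continuous[OF continuous_on_step])
  then show ?thesis
    unfolding state_space_def using assms
    by (intro measurable_restrict_space2) (auto simp: space_restrict_space step_def T_closed)
qed

lemma measurable_p[measurable]: "c \<in> Ch \<Longrightarrow> (\<lambda>s. p c (snd s)) \<in> borel_measurable state_space"
  by (rule borel_measurable_continuous[OF continuous_on_p_snd])

lemma step_in_space: "s \<in> space state_space \<Longrightarrow> c \<in> Ch \<Longrightarrow> step s c \<in> space state_space"
  by (auto simp: space_state_space step_def T_closed)

lemma step_point_measure:
  "s \<in> space state_space \<Longrightarrow> step s \<in> point_measure Ch q \<rightarrow>\<^sub>M state_space"
  by (auto simp: step_in_space)

lemma emeasure_kernel: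
  assumes s: "s \<in> space state_space" and B: "B \<in> sets state_space"
  shows "emeasure (kernel s) B = (\<Sum>c\<in>Ch. ennreal (p c (snd s)) * indicator B (step s c))"
proof -
  have "emeasure (kernel s) B = (\<integral>\<^sup>+y. indicator B y \<partial>kernel s)"
    using B by (simp add: kernel_def)
  also have "\<dots> = (\<integral>\<^sup>+c. indicator B (step s c) \<partial>point_measure Ch (\<lambda>c. ennreal (p c (snd s))))"
    unfolding kernel_def using B by (intro nn_integral_distr step_point_measure[OF s]) auto
  also have "\<dots> = (\<Sum>c\<in>Ch. ennreal (p c (snd s)) * indicator B (step s c))"
    by (rule nn_integral_point_measure_finite[OF finite_Ch])
  finally show ?thesis .
qed

sublocale markov_kernel state_space kernel
proof
  show "kernel \<in> state_space \<rightarrow>\<^sub>M prob_algebra state_space"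
  proof (rule measurable_prob_algebraI)
    show prob: "prob_space (kernel s)" if s: "s \<in> space state_space" for s
    proof
      have "emeasure (kernel s) (space (kernel s)) = (\<Sum>c\<in>Ch. ennreal (p c (snd s)))"
        using emeasure_kernel[OF s sets.top] step_in_space[OF s] by (simp add: kernel_def)
      also have "\<dots> = 1" using p_nonneg by (subst sum_ennreal) (auto simp: p_sum)
      finally show "emeasure (kernel s) (space (kernel s)) = 1" .
    qed
    show "kernel \<in> state_space \<rightarrow>\<^sub>M subprob_algebra state_space"
    proof (rule measurable_subprob_algebra)
      show "subprob_space (kernel s)" if "s \<in> space state_space" for s
        using prob[OF that] by (rule prob_space_imp_subprob_space)
      show "sets (kernel s) = sets state_space" for s by (simp add: kernel_def)
      fix B assume B[measurable]: "B \<in> sets state_space"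
      have "(\<lambda>s. \<Sum>c\<in>Ch. ennreal (p c (snd s)) * indicator B (step s c)) \<in> borel_measurable state_space"
        by measurable
      then show "(\<lambda>s. emeasure (kernel s) B) \<in> borel_measurable state_space"
        by (simp add: emeasure_kernel[OF _ B] cong: measurable_cong)
    qed
  qed
qed

lemma next_mean_eq_mean_op:
  assumes s: "s \<in> space state_space" and f: "f \<in> borel_measurable state_space"
  shows "next_mean f s = mean_op f s"
proof -
  have "next_mean f s = (\<integral>c. f (step s c) \<partial>point_measure Ch (\<lambda>c. ennreal (p c (snd s))))"
    unfolding next_mean_def kernel_def by (rule integral_distr[OF step_point_measure[OF s] f])
  also have "\<dots> = mean_op f s"
    unfolding mean_op_def using p_nonneg by (subst lebesgue_integral_point_measure_finite[OF finite_Ch]) auto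
  finally show ?thesis .
qed

lemma measurable_funpow_next_mean: "f \<in> borel_measurable state_space \<Longrightarrow> (next_mean ^^ n) f \<in> borel_measurable state_space"
  by (induction n) auto

lemma funpow_next_mean_eq_mean_op:
  assumes s: "s \<in> space state_space" and f: "f \<in> borel_measurable state_space"
  shows "(next_mean ^^ n) f s = (mean_op ^^ n) f s"
  using s
proof (induction n arbitrary: s)
  case (Suc n)
  have "(next_mean ^^ Suc n) f s = mean_op ((next_mean ^^ n) f) s"
    using next_mean_eq_mean_op[OF Suc.prems measurable_funpow_next_mean[OF f]] by simp
  also have "\<dots> = mean_op ((mean_op ^^ n) f) s"
    unfolding mean_op_def[of "(next_mean ^^ n) f"] mean_op_def[of "(mean_op ^^ n) f"]
    using Suc.IH[OF step_in_space[OF Suc.prems]] by (intro sum.cong) auto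
  finally show ?case by simp
qed simp

lemma region_subset: "region R \<subseteq> X \<times> UNIV" by (auto simp: region_def)

lemma region_borel[measurable]: "region R \<in> sets borel"
  using compact_imp_closed[OF compact_region] by simp

lemma region_sets[measurable]: "region R \<in> sets state_space"
  using region_subset closed_states by (simp add: state_space_def sets_restrict_space_iff)

lemma ex_region:
  assumes "s \<in> X \<times> UNIV"
  obtains R where "admissible_radius R" "s \<in> region R"
proof -
  obtain R where "N (snd s) \<le> R" "admissible_radius R" using ex_admissible_radius by blast
  then show ?thesis using that assms by (auto simp: region_def)
qed

lemma continuous_on_mean_op:
  assumes f: "continuous_on (X \<times> UNIV) f"
  shows "continuous_on (X \<times> UNIV) (mean_op f)"
proof -
  have "continuous_on (X \<times> UNIV) (\<lambda>s. f (step s c))" if "c \<in> Ch" for c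
    by (rule continuous_on_compose2[OF f continuous_on_step]) (use that in \<open>auto simp: step_def T_closed\<close>)
  then show ?thesis
    unfolding mean_op_def[abs_def] by (intro continuous_on_sum continuous_on_mult continuous_on_p_snd) auto
qed

lemma continuous_on_funpow_mean_op:
  "continuous_on (X \<times> UNIV) f \<Longrightarrow> continuous_on (X \<times> UNIV) ((mean_op ^^ n) f)"
  by (induction n) (auto intro: continuous_on_mean_op)

lemma probability_on_return: "s \<in> X \<times> UNIV \<Longrightarrow> probability_on state_space (return state_space s)"
  by (simp add: probability_on_def prob_space_return space_state_space)

lemma integral_law_at_return:
  assumes s: "s \<in> X \<times> UNIV" and f: "f \<in> borel_measurable state_space" "\<And>s. s \<in> space state_space \<Longrightarrow> \<bar>f s\<bar> \<le> B"
  shows "integral\<^sup>L (law_at state_space kernel (return state_space s) k) f = (mean_op ^^ k) f s"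
proof -
  interpret markov_chain state_space kernel "return state_space s"
    by (rule markov_chainI[OF probability_on_return[OF s]])
  have s': "s \<in> space state_space" using s by (simp add: space_state_space)
  have "integral\<^sup>L (law_at state_space kernel (return state_space s) k) f
      = integral\<^sup>L (return state_space s) ((next_mean ^^ k) f)"
    by (rule integral_law_at[OF f])
  also have "\<dots> = (next_mean ^^ k) f s"
    by (rule integral_return[OF s' measurable_funpow_next_mean[OF f(1)]])
  also have "\<dots> = (mean_op ^^ k) f s"
    by (rule funpow_next_mean_eq_mean_op[OF s' f(1)])
  finally show ?thesis .
qed

text \<open>By forward invariance the indicator of the region keeps the mean 1 along the trajectory.\<close>

lemma AE_path_region:
  assumes R: "admissible_radius R" and s: "s \<in> region R"
  shows "AE \<omega> in path_measure state_space kernel (return state_space s). \<forall>k. \<omega> k \<in> region R"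
proof -
  have s': "s \<in> X \<times> UNIV" using s region_subset by auto
  interpret markov_chain state_space kernel "return state_space s"
    by (rule markov_chainI[OF probability_on_return[OF s']])
  have "AE \<omega> in path. \<omega> k \<in> region R" for k
  proof -
    have "1 \<le> (mean_op ^^ k) (indicator (region R)) s"
      by (rule funpow_mean_op_ge[OF R _ s]) auto
    also have "\<dots> = integral\<^sup>L (law_at state_space kernel (return state_space s) k) (indicator (region R))"
      by (rule integral_law_at_return[OF s', symmetric, where B=1]) (auto simp: indicator_def)
    also have "\<dots> = measure (law_at state_space kernel (return state_space s) k) (region R)"
      by (simp add: law_at_def)
    also have "\<dots> = path.prob {\<omega> \<in> space path. \<omega> k \<in> region R}"
      unfolding law_at_def by (subst measure_distr) (auto intro: arg_cong[where f="path.prob"])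
    finally have "path.prob {\<omega> \<in> space path. \<omega> k \<in> region R} = 1"
      using path.prob_le_1 by (intro antisym) auto
    then have "AE \<omega> in path. \<omega> \<in> {\<omega> \<in> space path. \<omega> k \<in> region R}" by (rule path.AE_prob_1)
    then show ?thesis by auto
  qed
  then show ?thesis by (simp add: AE_all_countable)
qed

end

section \<open>Existence of an invariant measure and unique ergodicity\<close>

context contractive_choice_system
begin

text \<open>Drawing the time uniformly from \<open>{..n}\<close> and then the state from its law at that time realizes the average
  of the laws as a probability measure.\<close>

lemma integral_average_of_laws:
  assumes s: "s \<in> X \<times> UNIV"
    and f: "f \<in> borel_measurable borel" "\<And>s. \<bar>f s\<bar> \<le> B"
  defines "law \<equiv> \<lambda>k. distr (law_at state_space kernel (return state_space s) k) borel (\<lambda>s. s)"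
  shows "integral\<^sup>L (measure_pmf (pmf_of_set {..n}) \<bind> law) f = (\<Sum>k\<le>n. (mean_op ^^ k) f s) / real (Suc n)"
    and "prob_space (measure_pmf (pmf_of_set {..n}) \<bind> law)"
    and "sets (measure_pmf (pmf_of_set {..n}) \<bind> law) = sets borel"
proof -
  interpret markov_chain state_space kernel "return state_space s"
    by (rule markov_chainI[OF probability_on_return[OF s]])
  have id[measurable]: "(\<lambda>s. s) \<in> state_space \<rightarrow>\<^sub>M borel"
    by (rule borel_measurable_continuous) (rule continuous_on_id)
  have f'[measurable]: "f \<in> borel_measurable state_space"
    using measurable_compose[OF id f(1)] .
  have law_sets: "sets (law_at state_space kernel (return state_space s) k) = sets state_space" for k
    by (simp add: law_at_def)
  have id'[measurable]: "(\<lambda>s. s) \<in> law_at state_space kernel (return state_space s) k \<rightarrow>\<^sub>M borel" for k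
    using id law_sets by (simp cong: measurable_cong_sets)
  have law_prob: "prob_space (law k)" for k
    unfolding law_def
  proof (rule prob_space.prob_space_distr[OF _ id'])
    show "prob_space (law_at state_space kernel (return state_space s) k)"
      unfolding law_at_def by (rule path.prob_space_distr) measurable
  qed
  have law: "law \<in> measure_pmf q \<rightarrow>\<^sub>M subprob_algebra borel" for q
    using law_prob by (auto simp: law_def space_subprob_algebra intro: prob_space_imp_subprob_space)
  show "prob_space (measure_pmf (pmf_of_set {..n}) \<bind> law)"
    by (rule prob_space.prob_space_bind[OF prob_space_measure_pmf AE_I2 law]) (rule law_prob)
  show "sets (measure_pmf (pmf_of_set {..n}) \<bind> law) = sets borel"
    by (rule sets_bind) (auto simp: law_def)
  have "integral\<^sup>L (measure_pmf (pmf_of_set {..n}) \<bind> law) f = (\<integral>k. integral\<^sup>L (law k) f \<partial>pmf_of_set {..n})"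
  proof (rule integral_bind[OF f(1) f(2) law])
    show "finite_measure (measure_pmf (pmf_of_set {..n}))" by unfold_locales
    show "AE x in measure_pmf (pmf_of_set {..n}). emeasure (law x) (space (law x)) \<le> ennreal 1"
      by (rule AE_I2) (simp add: prob_space.emeasure_space_1[OF law_prob])
  qed
  also have "\<dots> = (\<Sum>k\<le>n. integral\<^sup>L (law k) f) / real (Suc n)"
    by (subst integral_pmf_of_set) auto
  also have "(\<Sum>k\<le>n. integral\<^sup>L (law k) f) = (\<Sum>k\<le>n. (mean_op ^^ k) f s)"
  proof (rule sum.cong[OF refl])
    fix k
    have "integral\<^sup>L (law k) f = integral\<^sup>L (law_at state_space kernel (return state_space s) k) f"
      unfolding law_def by (rule integral_distr[OF id' f(1)])
    also have "\<dots> = (mean_op ^^ k) f s"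
      by (rule integral_law_at_return[OF s f' f(2)])
    finally show "integral\<^sup>L (law k) f = (mean_op ^^ k) f s" .
  qed
  finally show "integral\<^sup>L (measure_pmf (pmf_of_set {..n}) \<bind> law) f = (\<Sum>k\<le>n. (mean_op ^^ k) f s) / real (Suc n)" .
qed

text \<open>The argument of Krylov and Bogoliubov. The means of \<open>f\<close> and of \<open>mean_op f\<close> under the average of the first
  \<open>n + 1\<close> laws differ by a telescoping sum of order \<open>1 / n\<close>, so they agree under a weak limit \<open>Q\<close>.\<close>

theorem ex_invariant_measure:
  assumes R: "admissible_radius R"
  obtains \<mu> where "invariant_measure state_space kernel \<mu>" "AE s in \<mu>. s \<in> region R"
proof -
  obtain s0 where s0: "s0 \<in> region R" using region_nonempty[OF R] by blast
  then have s0': "s0 \<in> X \<times> UNIV" using region_subset by auto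
  define law where "law = (\<lambda>k. distr (law_at state_space kernel (return state_space s0) k) borel (\<lambda>s. s))"
  define m where "m n = measure_pmf (pmf_of_set {..n}) \<bind> law" for n
  note m_int = integral_average_of_laws(1)[OF s0', folded law_def, folded m_def]
  have m_prob: "prob_space (m n)" and m_sets: "sets (m n) = sets borel" for n
    using integral_average_of_laws(2,3)[OF s0', of "\<lambda>_. 0" 0, folded law_def, folded m_def] by auto
  have set_int: "(LINT s:region R|m n. f s) = (\<Sum>k\<le>n. (mean_op ^^ k) f s0) / real (Suc n)"
    if f: "continuous_on (region R) f" for f n
  proof -
    define h where "h s = indicator (region R) s *\<^sub>R f s" for s
    obtain B where B: "0 \<le> B" "\<And>s. s \<in> region R \<Longrightarrow> \<bar>f s\<bar> \<le> B" using bounded_on_region[OF f] by blast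
    have "h \<in> borel_measurable borel"
      unfolding h_def by (rule borel_measurable_continuous_on_indicator[OF region_borel f])
    moreover have "\<bar>h s\<bar> \<le> B" for s using B by (auto simp: h_def indicator_def)
    ultimately have "(LINT s:region R|m n. f s) = (\<Sum>k\<le>n. (mean_op ^^ k) h s0) / real (Suc n)"
      using m_int[of h B n] by (simp add: set_lebesgue_integral_def h_def[abs_def])
    also have "(\<Sum>k\<le>n. (mean_op ^^ k) h s0) = (\<Sum>k\<le>n. (mean_op ^^ k) f s0)"
      by (intro sum.cong refl funpow_mean_op_cong[OF R _ s0]) (simp add: h_def)
    finally show ?thesis .
  qed
  have "AE s in m n. s \<in> region R" for n
  proof -
    interpret m: prob_space "m n" by (rule m_prob)
    have "(LINT s:region R|m n. 1) = (\<Sum>k\<le>n. (mean_op ^^ k) (\<lambda>_. 1) s0) / real (Suc n)"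
      by (rule set_int) (rule continuous_on_const)
    moreover have "(mean_op ^^ k) (\<lambda>_. 1) s0 = 1" for k
      using funpow_mean_op_le[OF R _ s0, of "\<lambda>_. 1" 1 k] funpow_mean_op_ge[OF R _ s0, of 1 "\<lambda>_. 1" k] by simp
    ultimately have "m.prob (region R) = 1"
      using m_sets[of n] by (simp add: set_lebesgue_integral_def)
    then show ?thesis by (rule m.AE_prob_1)
  qed
  from compact_weakly_convergent_subsequence[OF compact_region[of R], of m, OF m_prob m_sets this]
  obtain r Q where r: "strict_mono r" and Q: "prob_space Q" "sets Q = sets borel" "AE s in Q. s \<in> region R"
    and lim: "\<And>f :: 'x \<times> 'v \<Rightarrow> real. continuous_on (region R) f \<Longrightarrow>
       (\<lambda>n. LINT s:region R|m (r n). f s) \<longlonglongrightarrow> (LINT s:region R|Q. f s)"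
    by metis
  interpret Q: prob_space Q by (rule Q)
  have Q_invariant: "(LINT s:region R|Q. mean_op f s) = (LINT s:region R|Q. f s)"
    if f: "continuous_on (X \<times> UNIV) f" for f
  proof -
    have f1: "continuous_on (region R) f" and f2: "continuous_on (region R) (mean_op f)"
      by (rule continuous_on_subset[OF _ region_subset], rule f continuous_on_mean_op[OF f])+
    obtain B where B: "0 \<le> B" "\<And>s. s \<in> region R \<Longrightarrow> \<bar>f s\<bar> \<le> B" using bounded_on_region[OF f1] by blast
    have diff: "(LINT s:region R|m n. mean_op f s) - (LINT s:region R|m n. f s)
        = ((mean_op ^^ Suc n) f s0 - f s0) / real (Suc n)" for n
    proof -
      have "(\<Sum>k\<le>n. (mean_op ^^ k) (mean_op f) s0) = (\<Sum>k\<le>n. (mean_op ^^ Suc k) f s0)"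
        by (simp add: funpow_swap1)
      also have "\<dots> = (\<Sum>k\<le>n. (mean_op ^^ k) f s0) + ((mean_op ^^ Suc n) f s0 - f s0)"
        using sum.atMost_Suc_shift[of "\<lambda>k. (mean_op ^^ k) f s0" n] by simp
      finally show ?thesis unfolding set_int[OF f1] set_int[OF f2] by (simp add: diff_divide_distrib[symmetric] add_divide_distrib del: of_nat_Suc funpow.simps)
    qed
    have "(\<lambda>n. (LINT s:region R|m n. mean_op f s) - (LINT s:region R|m n. f s)) \<longlonglongrightarrow> 0"
      unfolding diff
    proof (rule bounded_divide_Suc_tendsto_0[where B="2 * B"])
      show "\<bar>(mean_op ^^ Suc n) f s0 - f s0\<bar> \<le> 2 * B" for n
        using funpow_mean_op_abs_le[where f=f and B=B and n="Suc n", OF R B(2) s0] B(2)[OF s0] by linarith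
    qed
    from LIMSEQ_subseq_LIMSEQ[OF this r]
    have "(\<lambda>n. (LINT s:region R|m (r n). mean_op f s) - (LINT s:region R|m (r n). f s)) \<longlonglongrightarrow> 0"
      by (simp add: comp_def)
    moreover have "(\<lambda>n. (LINT s:region R|m (r n). mean_op f s) - (LINT s:region R|m (r n). f s))
        \<longlonglongrightarrow> (LINT s:region R|Q. mean_op f s) - (LINT s:region R|Q. f s)"
      by (intro tendsto_diff lim f1 f2)
    ultimately have "0 = (LINT s:region R|Q. mean_op f s) - (LINT s:region R|Q. f s)"
      by (rule LIMSEQ_unique)
    then show ?thesis by simp
  qed
  \<comment> \<open>\<open>Q\<close> is a measure on the whole type; \<open>G\<close> moves it to the state space without changing it on the region.\<close>
  define G where "G s = (if s \<in> region R then s else s0)" for s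
  have G_state: "G s \<in> X \<times> UNIV" and G_region: "G s \<in> region R" for s
    using s0 s0' region_subset by (auto simp: G_def)
  have "G \<in> borel \<rightarrow>\<^sub>M state_space"
    unfolding state_space_def
  proof (rule measurable_restrict_space2)
    show "G \<in> space borel \<rightarrow> X \<times> UNIV" using G_state by auto
    show "G \<in> borel \<rightarrow>\<^sub>M borel"
      unfolding G_def[abs_def] by (intro measurable_If measurable_ident measurable_const) auto
  qed
  then have G[measurable]: "G \<in> Q \<rightarrow>\<^sub>M state_space" using Q by (simp cong: measurable_cong_sets)
  define \<mu> where "\<mu> = distr Q state_space G"
  have \<mu>: "probability_on state_space \<mu>"
    unfolding \<mu>_def probability_on_def by (simp add: Q.prob_space_distr)
  have \<mu>_int: "integral\<^sup>L \<mu> f = (LINT s:region R|Q. f s)" if f: "continuous_on (X \<times> UNIV) f" for f :: "_ \<Rightarrow> real"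
  proof -
    have f1: "continuous_on (region R) f" by (rule continuous_on_subset[OF f region_subset])
    have "integral\<^sup>L \<mu> f = (\<integral>s. f (G s) \<partial>Q)"
      unfolding \<mu>_def by (rule integral_distr[OF G borel_measurable_continuous[OF f]])
    also have "\<dots> = (LINT s:region R|Q. f s)"
      unfolding set_lebesgue_integral_def
    proof (rule integral_cong_AE)
      show "(\<lambda>s. f (G s)) \<in> borel_measurable Q"
        by (rule measurable_compose[OF G borel_measurable_continuous[OF f]])
      show "(\<lambda>s. indicator (region R) s *\<^sub>R f s) \<in> borel_measurable Q"
        using borel_measurable_continuous_on_indicator[OF region_borel f1] Q by (simp cong: measurable_cong_sets)
      show "AE s in Q. f (G s) = indicator (region R) s *\<^sub>R f s"
        using Q(3) by eventually_elim (simp add: G_def)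
    qed
    finally show ?thesis .
  qed
  have "\<mu> \<bind> kernel = \<mu>"
  proof (rule restricted_borel_measures_eqI_continuous[where \<Omega>="X \<times> UNIV"])
    show "X \<times> (UNIV :: 'v set) \<in> sets borel" by (rule borel_closed[OF closed_states])
    show "probability_on (restrict_space borel (X \<times> UNIV)) (\<mu> \<bind> kernel)"
      "probability_on (restrict_space borel (X \<times> UNIV)) \<mu>"
      using probability_on_bind[OF \<mu>] \<mu> by (simp_all add: state_space_def)
    fix f :: "'x \<times> 'v \<Rightarrow> real" assume f: "continuous_on UNIV f" "\<And>s. 0 \<le> f s \<and> f s \<le> 1"
    have f': "continuous_on (X \<times> UNIV) f" by (rule continuous_on_subset[OF f(1)]) simp
    have fm: "f \<in> borel_measurable state_space" by (rule borel_measurable_continuous[OF f'])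
    have "integral\<^sup>L (\<mu> \<bind> kernel) f = integral\<^sup>L \<mu> (next_mean f)"
      by (rule integral_bind_kernel[OF \<mu> fm, where b=1]) (use f(2) in auto)
    also have "\<dots> = integral\<^sup>L \<mu> (mean_op f)"
      using \<mu> fm by (intro Bochner_Integration.integral_cong refl next_mean_eq_mean_op)
        (auto simp: probability_on_def dest: sets_eq_imp_space_eq)
    also have "\<dots> = integral\<^sup>L \<mu> f"
      unfolding \<mu>_int[OF f'] \<mu>_int[OF continuous_on_mean_op[OF f']] by (rule Q_invariant[OF f'])
    finally show "integral\<^sup>L (\<mu> \<bind> kernel) f = integral\<^sup>L \<mu> f" .
  qed
  then have "invariant_measure state_space kernel \<mu>"
    using \<mu> by (simp add: invariant_measure_iff)
  moreover have "AE s in \<mu>. s \<in> region R"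
    unfolding \<mu>_def by (subst AE_distr_iff[OF G]) (use G_region in auto)
  ultimately show ?thesis by (rule that)
qed

end

context mixing_choice_system
begin

text \<open>The limits on different regions agree, because all regions contain the states with vector 0.\<close>

lemma mean_op_converges:
  assumes f: "continuous_on (X \<times> UNIV) f"
  obtains L where "\<And>R. admissible_radius R \<Longrightarrow> uniform_limit (region R) (\<lambda>n. (mean_op ^^ n) f) (\<lambda>_. L) sequentially"
proof -
  obtain x0 where x0: "x0 \<in> X" using X_nonempty by blast
  have s0: "(x0, 0) \<in> region R" if "admissible_radius R" for R
    using x0 admissible_radius_nonneg[OF that] N_0 by (simp add: region_def)
  obtain R0 where R0: "admissible_radius R0" using ex_admissible_radius by blast
  obtain L where L: "uniform_limit (region R0) (\<lambda>n. (mean_op ^^ n) f) (\<lambda>_. L) sequentially"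
    using uniform_limit_mean_op[OF f R0] by blast
  show thesis
  proof (rule that[of L])
    fix R assume R: "admissible_radius R"
    obtain L' where L': "uniform_limit (region R) (\<lambda>n. (mean_op ^^ n) f) (\<lambda>_. L') sequentially"
      using uniform_limit_mean_op[OF f R] by blast
    have "L' = L"
      using tendsto_uniform_limitI[OF L s0[OF R0]] tendsto_uniform_limitI[OF L' s0[OF R]] by (rule LIMSEQ_unique[rotated])
    then show "uniform_limit (region R) (\<lambda>n. (mean_op ^^ n) f) (\<lambda>_. L) sequentially" using L' by simp
  qed
qed

lemma integral_next_mean_tendsto:
  assumes \<nu>: "probability_on state_space \<nu>" and h: "h \<in> borel_measurable state_space" "\<And>s. s \<in> space state_space \<Longrightarrow> \<bar>h s\<bar> \<le> B"
    and lim: "AE s in \<nu>. (\<lambda>n. (mean_op ^^ n) h s) \<longlonglongrightarrow> L"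
  shows "(\<lambda>n. integral\<^sup>L \<nu> ((next_mean ^^ n) h)) \<longlonglongrightarrow> L"
proof -
  interpret \<nu>: prob_space \<nu> using \<nu> by (simp add: probability_on_def)
  have sets: "sets \<nu> = sets state_space" using \<nu> by (simp add: probability_on_def)
  then have space: "space \<nu> = space state_space" by (rule sets_eq_imp_space_eq)
  have bounded: "\<bar>(next_mean ^^ n) h s\<bar> \<le> B" if "s \<in> space state_space" for n s
    using that by (induction n arbitrary: s) (auto intro!: next_mean_bounded measurable_funpow_next_mean h)
  have "(\<lambda>n. integral\<^sup>L \<nu> ((next_mean ^^ n) h)) \<longlonglongrightarrow> integral\<^sup>L \<nu> (\<lambda>_. L)"
  proof (rule integral_dominated_convergence[where w="\<lambda>_. B"])
    show "(next_mean ^^ n) h \<in> borel_measurable \<nu>" for n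
      using measurable_funpow_next_mean[OF h(1)] sets by (simp cong: measurable_cong_sets)
    show "AE s in \<nu>. (\<lambda>n. (next_mean ^^ n) h s) \<longlonglongrightarrow> L"
      using lim AE_space by eventually_elim (simp add: funpow_next_mean_eq_mean_op[OF _ h(1)] space)
    show "AE s in \<nu>. norm ((next_mean ^^ n) h s) \<le> B" for n
      using bounded by (intro AE_I2) (simp add: space)
  qed auto
  then show ?thesis by (simp add: \<nu>.prob_space)
qed

lemma integral_invariant_eq_limit:
  assumes \<mu>: "invariant_measure state_space kernel \<mu>"
    and h: "h \<in> borel_measurable state_space" "\<And>s. s \<in> space state_space \<Longrightarrow> \<bar>h s\<bar> \<le> B"
    and lim: "AE s in \<mu>. (\<lambda>n. (mean_op ^^ n) h s) \<longlonglongrightarrow> L"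
  shows "integral\<^sup>L \<mu> h = L"
proof -
  have "(\<lambda>n. integral\<^sup>L \<mu> ((next_mean ^^ n) h)) \<longlonglongrightarrow> L"
    using \<mu> by (intro integral_next_mean_tendsto[OF _ h lim]) (simp_all add: invariant_measure_def)
  moreover have "integral\<^sup>L \<mu> ((next_mean ^^ n) h) = integral\<^sup>L \<mu> h" for n
    by (rule integral_funpow_next_mean_invariant[OF \<mu> h])
  ultimately show ?thesis by (simp add: LIMSEQ_const_iff)
qed

lemma pointwise_limit:
  assumes "\<And>R. admissible_radius R \<Longrightarrow> uniform_limit (region R) (\<lambda>n. (mean_op ^^ n) f) (\<lambda>_. L) sequentially"
    and "s \<in> X \<times> UNIV"
  shows "(\<lambda>n. (mean_op ^^ n) f s) \<longlonglongrightarrow> L"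
  using ex_region[OF assms(2)] assms(1) tendsto_uniform_limitI by metis

text \<open>The mean of \<open>f\<close> under the law at time \<open>n\<close> is the mean of the \<open>n\<close>-th iterate under the initial law, and
  the iterates converge boundedly to a constant. For an invariant initial law the mean is the same at all times, which
  identifies the constant.\<close>

lemma attractive_if_invariant:
  assumes \<mu>: "invariant_measure state_space kernel \<mu>"
  shows "attractive_measure state_space kernel \<mu>"
  unfolding attractive_measure_def converges_in_distribution_def
proof (intro conjI allI impI \<mu>)
  fix \<nu> and f :: "'a \<times> 'c \<Rightarrow> real"
  assume \<nu>: "probability_on state_space \<nu>" and f: "continuous_on (space state_space) f \<and> bounded (f ` space state_space)"
  interpret markov_chain state_space kernel \<nu> by (rule markov_chainI[OF \<nu>])
  have f': "continuous_on (X \<times> UNIV) f" using f by (simp add: space_state_space)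
  have fm: "f \<in> borel_measurable state_space" by (rule borel_measurable_continuous[OF f'])
  obtain B where B: "\<And>s. s \<in> space state_space \<Longrightarrow> \<bar>f s\<bar> \<le> B" using f by (auto simp: bounded_iff)
  obtain L where L: "\<And>R. admissible_radius R \<Longrightarrow> uniform_limit (region R) (\<lambda>n. (mean_op ^^ n) f) (\<lambda>_. L) sequentially"
    using mean_op_converges[OF f'] by blast
  have lim: "AE s in \<nu>'. (\<lambda>n. (mean_op ^^ n) f s) \<longlonglongrightarrow> L" if "probability_on state_space \<nu>'" for \<nu>'
    using that by (intro AE_I2 pointwise_limit[OF L]) (auto simp: probability_on_def space_state_space dest: sets_eq_imp_space_eq)
  have "integral\<^sup>L \<mu> f = L"
    using \<mu> by (intro integral_invariant_eq_limit[OF \<mu> fm B lim]) (auto simp: invariant_measure_def)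
  moreover have "integral\<^sup>L (law_at state_space kernel \<nu> k) f = integral\<^sup>L \<nu> ((next_mean ^^ k) f)" for k
    by (rule integral_law_at[OF fm B])
  ultimately show "(\<lambda>k. integral\<^sup>L (law_at state_space kernel \<nu> k) f) \<longlonglongrightarrow> integral\<^sup>L \<mu> f"
    using integral_next_mean_tendsto[OF \<nu> fm B lim[OF \<nu>]] by simp
qed

lemma invariant_measure_unique:
  assumes \<mu>: "invariant_measure state_space kernel \<mu>" and \<mu>': "invariant_measure state_space kernel \<mu>'"
  shows "\<mu>' = \<mu>"
proof (rule restricted_borel_measures_eqI_continuous[where \<Omega>="X \<times> UNIV"])
  show "X \<times> (UNIV :: 'c set) \<in> sets borel" by (rule borel_closed[OF closed_states])
  show "probability_on (restrict_space borel (X \<times> UNIV)) \<mu>'" "probability_on (restrict_space borel (X \<times> UNIV)) \<mu>"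
    using \<mu> \<mu>' by (simp_all add: invariant_measure_def state_space_def)
  fix f :: "'a \<times> 'c \<Rightarrow> real" assume f: "continuous_on UNIV f" "\<And>s. 0 \<le> f s \<and> f s \<le> 1"
  have "continuous_on (space state_space) f \<and> bounded (f ` space state_space)"
  proof
    show "continuous_on (space state_space) f" by (rule continuous_on_subset[OF f(1)]) simp
    have "norm (f s) \<le> 1" for s using f(2)[of s] by simp
    then show "bounded (f ` space state_space)" unfolding bounded_iff by blast
  qed
  then have conv: "(\<lambda>k. integral\<^sup>L (law_at state_space kernel \<nu> k) f) \<longlonglongrightarrow> integral\<^sup>L \<mu>'' f"
    if "invariant_measure state_space kernel \<mu>''" "probability_on state_space \<nu>" for \<mu>'' \<nu>
    using attractive_if_invariant[OF that(1)] that(2)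
    unfolding attractive_measure_def converges_in_distribution_def by blast
  have "probability_on state_space \<mu>" using \<mu> by (simp add: invariant_measure_def)
  from conv[OF \<mu> this] conv[OF \<mu>' this] show "integral\<^sup>L \<mu>' f = integral\<^sup>L \<mu> f" by (rule LIMSEQ_unique[rotated])
qed

text \<open>The martingale differences of the functions \<open>mean_op\<^sup>j g\<close>, cut off outside the region to make them
  bounded, show that the time averages of consecutive iterates are asymptotically equal. For large \<open>j\<close> the
  iterate is uniformly close to \<open>L\<close>, and so are its time averages.\<close>

lemma strong_law:
  assumes R: "admissible_radius R" and s: "s \<in> region R" and g: "continuous_on (X \<times> UNIV) g"
    and L: "uniform_limit (region R) (\<lambda>n. (mean_op ^^ n) g) (\<lambda>_. L) sequentially"
  shows "AE \<omega> in path_measure state_space kernel (return state_space s).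
           (\<lambda>k. (\<Sum>\<nu>\<le>k. g (\<omega> \<nu>)) / (real k + 1)) \<longlonglongrightarrow> L"
proof -
  have s': "s \<in> X \<times> UNIV" using s region_subset by auto
  interpret markov_chain state_space kernel "return state_space s"
    by (rule markov_chainI[OF probability_on_return[OF s']])
  define h where "h j s = indicator (region R) s * (mean_op ^^ j) g s" for j s
  have Q_cont: "continuous_on (region R) ((mean_op ^^ j) g)" for j
    by (rule continuous_on_subset[OF continuous_on_funpow_mean_op[OF g] region_subset])
  have h_meas: "h j \<in> borel_measurable state_space" for j
    unfolding h_def
    by (intro borel_measurable_times borel_measurable_indicator region_sets
        borel_measurable_continuous[OF continuous_on_funpow_mean_op[OF g]])
  have h_bounded: "\<exists>B. \<forall>s. \<bar>h j s\<bar> \<le> B" for j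
  proof -
    obtain B where "0 \<le> B" "\<And>s. s \<in> region R \<Longrightarrow> \<bar>(mean_op ^^ j) g s\<bar> \<le> B"
      using bounded_on_region[OF Q_cont] by blast
    then show ?thesis by (intro exI[of _ B]) (auto simp: h_def indicator_def)
  qed
  have h_eq: "h j s = (mean_op ^^ j) g s" if "s \<in> region R" for j s using that by (simp add: h_def)
  have next_h: "next_mean (h j) s = (mean_op ^^ Suc j) g s" if "s \<in> region R" for j s
  proof -
    have "s \<in> space state_space" using that region_subset by (auto simp: space_state_space)
    then have "next_mean (h j) s = mean_op (h j) s" by (rule next_mean_eq_mean_op[OF _ h_meas])
    also have "\<dots> = mean_op ((mean_op ^^ j) g) s" by (rule mean_op_cong[OF R h_eq that])
    finally show ?thesis by simp
  qed
  have "AE \<omega> in path. (\<lambda>n. (\<Sum>k<Suc n. h j (\<omega> (Suc k)) - next_mean (h j) (\<omega> k)) / real (Suc n)) \<longlonglongrightarrow> 0" for j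
    using h_bounded[of j] martingale_strong_law[OF h_meas] by blast
  then have "AE \<omega> in path. \<forall>j. (\<lambda>n. (\<Sum>k<Suc n. h j (\<omega> (Suc k)) - next_mean (h j) (\<omega> k)) / real (Suc n)) \<longlonglongrightarrow> 0"
    by (simp add: AE_all_countable)
  then show ?thesis
    using AE_path_region[OF R s]
  proof eventually_elim
    case (elim \<omega>)
    then have \<omega>: "\<omega> k \<in> region R" for k by simp
    define avg where "avg j n = (\<Sum>k\<le>n. (mean_op ^^ j) g (\<omega> k)) / real (Suc n)" for j n
    have step: "(\<lambda>n. avg j n - avg (Suc j) n) \<longlonglongrightarrow> 0" for j
    proof -
      obtain B where B: "\<And>s. s \<in> region R \<Longrightarrow> \<bar>(mean_op ^^ j) g s\<bar> \<le> B"
        using bounded_on_region[OF Q_cont] by blast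
      let ?q = "\<lambda>k. (mean_op ^^ j) g (\<omega> k)"
      have tele: "(\<Sum>k<Suc n. h j (\<omega> (Suc k)) - next_mean (h j) (\<omega> k)) / real (Suc n)
          = avg j n - avg (Suc j) n + (?q (Suc n) - ?q 0) / real (Suc n)" for n
      proof -
        have "(\<Sum>k<Suc n. h j (\<omega> (Suc k)) - next_mean (h j) (\<omega> k))
            = (\<Sum>k\<le>n. ?q (Suc k)) - (\<Sum>k\<le>n. (mean_op ^^ Suc j) g (\<omega> k))"
          using \<omega> unfolding lessThan_Suc_atMost sum_subtractf by (simp only: h_eq next_h)
        also have "(\<Sum>k\<le>n. ?q (Suc k)) = (\<Sum>k\<le>n. ?q k) + (?q (Suc n) - ?q 0)"
          using sum.atMost_Suc_shift[of ?q n] by simp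
        finally show ?thesis
          unfolding avg_def by (simp only: diff_divide_distrib add_divide_distrib)
      qed
      have "\<bar>?q (Suc n) - ?q 0\<bar> \<le> 2 * B" for n
        using B[OF \<omega>, of "Suc n"] B[OF \<omega>, of 0] by linarith
      from bounded_divide_Suc_tendsto_0[OF this]
      have "(\<lambda>n. (?q (Suc n) - ?q 0) / real (Suc n)) \<longlonglongrightarrow> 0" .
      from tendsto_diff[OF elim(1)[rule_format, of j] this] show ?thesis
        unfolding tele by simp
    qed
    have all: "(\<lambda>n. avg 0 n - avg j n) \<longlonglongrightarrow> 0" for j
    proof (induction j)
      case (Suc j)
      from tendsto_add[OF Suc step[of j]] show ?case by simp
    qed simp
    have "avg 0 \<longlonglongrightarrow> L"
    proof (rule LIMSEQ_I)
      fix \<epsilon> :: real assume "0 < \<epsilon>"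
      then have "0 < \<epsilon> / 2" by simp
      from uniform_limitD[OF L this]
      obtain j where j: "\<And>s. s \<in> region R \<Longrightarrow> dist ((mean_op ^^ j) g s) L < \<epsilon> / 2"
        by (auto simp: eventually_sequentially)
      have avg_j: "\<bar>avg j n - L\<bar> \<le> \<epsilon> / 2" for n
      proof -
        have "avg j n - L = (\<Sum>k\<le>n. (mean_op ^^ j) g (\<omega> k) - L) / real (Suc n)"
          by (simp add: avg_def sum_subtractf diff_divide_distrib del: of_nat_Suc)
        also have "\<bar>\<dots>\<bar> \<le> (\<Sum>k\<le>n. \<epsilon> / 2) / real (Suc n)"
        proof -
          have "\<bar>\<Sum>k\<le>n. (mean_op ^^ j) g (\<omega> k) - L\<bar> \<le> (\<Sum>k\<le>n. \<epsilon> / 2)"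
            by (rule order.trans[OF sum_abs], rule sum_mono)
              (use j[OF \<omega>] in \<open>auto simp: dist_real_def intro: less_imp_le\<close>)
          then show ?thesis unfolding abs_divide by (simp add: divide_right_mono del: of_nat_Suc sum_constant)
        qed
        also have "\<dots> = \<epsilon> / 2" by (simp del: of_nat_Suc)
        finally show ?thesis .
      qed
      from LIMSEQ_D[OF all[of j] \<open>0 < \<epsilon> / 2\<close>]
      obtain n0 where n0: "\<And>n. n \<ge> n0 \<Longrightarrow> \<bar>avg 0 n - avg j n\<bar> < \<epsilon> / 2" by auto
      have "norm (avg 0 n - L) < \<epsilon>" if "n \<ge> n0" for n
        using n0[OF that] avg_j[of n] unfolding real_norm_def by linarith
      then show "\<exists>no. \<forall>n\<ge>no. norm (avg 0 n - L) < \<epsilon>" by blast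
    qed
    then show ?case by (simp add: avg_def[abs_def] add.commute)
  qed
qed

text \<open>A continuous function may be unbounded, but \<open>\<mu>\<close> is carried by a compact region. The function
  \<open>h\<close> agrees with \<open>g\<close> there and is bounded, so \<open>\<mu>\<close> integrates it to the limit of the iterates.\<close>

theorem unique_ergodicity: "uniquely_ergodic state_space kernel"
proof -
  obtain R0 where R0: "admissible_radius R0" using ex_admissible_radius by blast
  obtain \<mu> where \<mu>: "invariant_measure state_space kernel \<mu>" and \<mu>_R0: "AE s in \<mu>. s \<in> region R0"
    using ex_invariant_measure[OF R0] by blast
  have prob: "prob_space \<mu>" and sets: "sets \<mu> = sets state_space"
    using \<mu> by (auto simp: invariant_measure_def probability_on_def)
  interpret \<mu>: prob_space \<mu> by (rule prob)
  have "time_averages_converge state_space kernel \<mu>"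
    unfolding time_averages_converge_def
  proof (intro ballI allI impI)
    fix s and g :: "'a \<times> 'c \<Rightarrow> real" assume s: "s \<in> space state_space" and g0: "continuous_on (space state_space) g"
    have g: "continuous_on (X \<times> UNIV) g" using g0 by (simp add: space_state_space)
    have gm: "g \<in> borel_measurable state_space" by (rule borel_measurable_continuous[OF g])
    then have gm': "g \<in> borel_measurable \<mu>" using sets by (simp cong: measurable_cong_sets)
    obtain B where B: "0 \<le> B" "\<And>s. s \<in> region R0 \<Longrightarrow> \<bar>g s\<bar> \<le> B"
      using bounded_on_region[OF continuous_on_subset[OF g region_subset]] by blast
    have int: "integrable \<mu> g"
      by (rule \<mu>.integrable_const_bound[OF _ gm', of B]) (use \<mu>_R0 in eventually_elim, simp add: B)
    obtain L where L: "\<And>R. admissible_radius R \<Longrightarrow> uniform_limit (region R) (\<lambda>n. (mean_op ^^ n) g) (\<lambda>_. L) sequentially"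
      using mean_op_converges[OF g] by blast
    define h where "h s = indicator (region R0) s * g s" for s
    have h: "h \<in> borel_measurable state_space" "\<bar>h s\<bar> \<le> B" for s
      using B gm by (auto simp: h_def[abs_def] indicator_def)
    have "integral\<^sup>L \<mu> h = L"
    proof (rule integral_invariant_eq_limit[OF \<mu> h])
      show "AE s in \<mu>. (\<lambda>n. (mean_op ^^ n) h s) \<longlonglongrightarrow> L"
        using \<mu>_R0
      proof eventually_elim
        case (elim s)
        have "(mean_op ^^ n) h s = (mean_op ^^ n) g s" for n
          by (rule funpow_mean_op_cong[OF R0 _ elim]) (simp add: h_def)
        then show ?case using tendsto_uniform_limitI[OF L[OF R0] elim] by simp
      qed
    qed
    moreover have "integral\<^sup>L \<mu> h = integral\<^sup>L \<mu> g"
    proof (rule integral_cong_AE)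
      show "h \<in> borel_measurable \<mu>" using h(1) sets by (simp cong: measurable_cong_sets)
      show "AE s in \<mu>. h s = g s" using \<mu>_R0 by eventually_elim (simp add: h_def)
    qed (rule gm')
    ultimately have L_eq: "integral\<^sup>L \<mu> g = L" by simp
    obtain R where R: "admissible_radius R" "s \<in> region R"
      using ex_region s by (auto simp: space_state_space)
    show "integrable \<mu> g \<and> (AE \<omega> in path_measure state_space kernel (return state_space s).
        (\<lambda>k. (\<Sum>\<nu>\<le>k. g (\<omega> \<nu>)) / (real k + 1)) \<longlonglongrightarrow> integral\<^sup>L \<mu> g)"
      unfolding L_eq using int strong_law[OF R g L[OF R(1)]] by simp
  qed
  then show ?thesis
    unfolding uniquely_ergodic_def
    using \<mu> invariant_measure_unique[OF \<mu>] ergodic_if_unique_invariant[OF \<mu> invariant_measure_unique[OF \<mu>]]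
      attractive_if_invariant[OF \<mu>] by blast
qed

end

section \<open>The feedback loop\<close>

lemma sum_PiE_UNIV_prod:
  fixes f :: "'i::finite \<Rightarrow> 'j \<Rightarrow> real"
  assumes "\<And>i. finite (S i)"
  shows "(\<Sum>g\<in>(\<Pi>\<^sub>E i\<in>UNIV. S i). \<Prod>i\<in>UNIV. f i (g i)) = (\<Prod>i\<in>UNIV. \<Sum>j\<in>S i. f i j)"
  using assms by (intro prod_sum_PiE[symmetric]) auto

lemma abs_mult_diff_le:
  fixes a b c d :: real
  assumes "\<bar>b\<bar> \<le> 1" "\<bar>c\<bar> \<le> 1"
  shows "\<bar>a * b - c * d\<bar> \<le> \<bar>a - c\<bar> + \<bar>b - d\<bar>"
proof -
  have "a * b - c * d = (a - c) * b + c * (b - d)" by (simp add: algebra_simps)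
  also have "\<bar>\<dots>\<bar> \<le> \<bar>a - c\<bar> * \<bar>b\<bar> + \<bar>c\<bar> * \<bar>b - d\<bar>"
    by (rule order.trans[OF abs_triangle_ineq]) (simp add: abs_mult)
  also have "\<dots> \<le> \<bar>a - c\<bar> * 1 + 1 * \<bar>b - d\<bar>"
    using assms by (intro add_mono mult_left_mono mult_right_mono) auto
  finally show ?thesis by simp
qed

text \<open>A positive entry of the power has a positive summand, that is, a walk of length \<open>k\<close>, and every arc of the walk
  is realized by some choice of transition maps.\<close>

lemma matrix_power_on_adjacency_pos:
  assumes "matrix_power_on (agent_product A) (adjacency_matrix (agent_graph A)) k x y > 0"
    and x: "x \<in> agent_product A"
  shows "\<exists>js. length js = k \<and> (\<forall>j\<in>set js. \<forall>i. j i \<in> {1..num_trans A i}) \<and>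
    foldl (\<lambda>x j i. trans_map A i (j i) (x i)) x js = y"
  using assms(1)
proof (induction k arbitrary: y)
  case 0
  then show ?case by (auto split: if_splits)
next
  case (Suc k)
  let ?V = "agent_product A" and ?M = "adjacency_matrix (agent_graph A)"
  obtain z where z: "z \<in> ?V" "0 < matrix_power_on ?V ?M k x z * ?M z y"
  proof (rule ccontr)
    assume "\<not> thesis"
    then have "(\<Sum>z\<in>?V. matrix_power_on ?V ?M k x z * ?M z y) \<le> 0"
      using that by (intro sum_nonpos) (metis not_less)
    then show False using Suc.prems by simp
  qed
  then have edge: "(z, y) \<in> parcs (agent_graph A)" and pos: "0 < matrix_power_on ?V ?M k x z"
    by (auto simp: adjacency_matrix_def split: if_splits)
  from Suc.IH[OF pos] obtain js where js: "length js = k" "\<forall>j\<in>set js. \<forall>i. j i \<in> {1..num_trans A i}"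
    "foldl (\<lambda>x j i. trans_map A i (j i) (x i)) x js = z" by blast
  from edge obtain j where "\<forall>i. j i \<in> {1..num_trans A i} \<and> trans_map A i (j i) (z i) = y i"
    by (auto simp: agent_graph_def)
  then show ?case using js by (intro exI[of _ "js @ [j]"]) auto
qed

text \<open>The closed loop with a nonempty set of joint agent states, which strong connectedness of the graph provides.\<close>

locale feedback_loop =
  fixes A :: "'i::finite ensemble"
    and F :: "'f::finite linear_filter"
    and C :: "'c::finite linear_controller"
    and r :: real
    and PI :: "real set"
    and \<delta> \<delta>' :: real
  assumes states_finite: "\<And>i. finite (agent_states A i)"
    and states_nonempty: "agent_product A \<noteq> {}"
    and trans_closed: "\<And>i j. j \<in> {1..num_trans A i} \<Longrightarrow> trans_map A i j \<in> agent_states A i \<rightarrow> agent_states A i"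
    and broadcast_admissible: "\<And>s :: ('i, 'f, 'c) loop_state. s \<in> space (loop_space A) \<Longrightarrow> broadcast F C r s \<in> PI"
    and trans_prob_range: "\<And>i j. j \<in> {1..num_trans A i} \<Longrightarrow> trans_prob A i j \<in> PI \<rightarrow> {0..1}"
    and out_prob_range: "\<And>i l. l \<in> {1..num_out A i} \<Longrightarrow> out_prob A i l \<in> PI \<rightarrow> {0..1}"
    and trans_prob_dini: "\<And>i j. j \<in> {1..num_trans A i} \<Longrightarrow> dini_continuous_on PI (trans_prob A i j)"
    and out_prob_dini: "\<And>i l. l \<in> {1..num_out A i} \<Longrightarrow> dini_continuous_on PI (out_prob A i l)"
    and trans_prob_sum: "\<And>\<pi> i. \<pi> \<in> PI \<Longrightarrow> (\<Sum>j=1..num_trans A i. trans_prob A i j \<pi>) = 1"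
    and out_prob_sum: "\<And>\<pi> i. \<pi> \<in> PI \<Longrightarrow> (\<Sum>l=1..num_out A i. out_prob A i l \<pi>) = 1"
    and \<delta>: "\<delta> > 0" "\<delta>' > 0"
    and trans_prob_lower: "\<And>\<pi> i j. \<pi> \<in> PI \<Longrightarrow> j \<in> {1..num_trans A i} \<Longrightarrow> trans_prob A i j \<pi> \<ge> \<delta>"
    and out_prob_lower: "\<And>\<pi> i l. \<pi> \<in> PI \<Longrightarrow> l \<in> {1..num_out A i} \<Longrightarrow> out_prob A i l \<pi> \<ge> \<delta>'"
    and stable: "stable_controller C" "stable_filter F"
begin

text \<open>The broadcast signal depends on the filter and controller states alone.\<close>

definition signal :: "(real ^ 'f) \<times> (real ^ 'c) \<Rightarrow> real" where
  "signal v = ctrl_C C \<bullet> snd v + ctrl_D C * loop_error F r (fst v)"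

definition linear_part :: "(real ^ 'f) \<times> (real ^ 'c) \<Rightarrow> (real ^ 'f) \<times> (real ^ 'c)" where
  "linear_part = (\<lambda>(u, v). (filt_A F *v u, ctrl_A C *v v - (filt_C F \<bullet> u) *\<^sub>R ctrl_B C))"

definition agent_map :: "('i \<Rightarrow> nat) \<times> ('i \<Rightarrow> nat) \<Rightarrow> ('i \<Rightarrow> nat \<Rightarrow> real) \<Rightarrow> ('i \<Rightarrow> nat \<Rightarrow> real)" where
  "agent_map c x = (\<lambda>i. trans_map A i (fst c i) (x i))"

definition input :: "('i \<Rightarrow> nat \<Rightarrow> real) \<Rightarrow> ('i \<Rightarrow> nat) \<times> ('i \<Rightarrow> nat) \<Rightarrow> (real ^ 'f) \<times> (real ^ 'c)" where
  "input x c = ((\<Sum>i\<in>UNIV. out_map A i (snd c i) (x i)) *\<^sub>R filt_B F, r *\<^sub>R ctrl_B C)"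

definition signal_gain :: real where
  "signal_gain = norm (ctrl_C C) + \<bar>ctrl_D C\<bar> * norm (filt_C F)"

text \<open>The products of probabilities vary at most by the sum of the variations of their factors.\<close>

definition choice_modulus :: "real \<Rightarrow> real" where
  "choice_modulus t = (\<Sum>c\<in>loop_choices A.
     (\<Sum>i\<in>UNIV. real_modulus PI (trans_prob A i (fst c i)) (signal_gain * t)) +
     (\<Sum>i\<in>UNIV. real_modulus PI (out_prob A i (snd c i)) (signal_gain * t)))"

lemma choice_ranges:
  "c \<in> loop_choices A \<Longrightarrow> fst c i \<in> {1..num_trans A i}" "c \<in> loop_choices A \<Longrightarrow> snd c i \<in> {1..num_out A i}"
  by (auto simp: loop_choices_def)

lemma signal_PI: "signal v \<in> PI"
proof -
  obtain x where "x \<in> agent_product A" using states_nonempty by blast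
  then have "(x, v) \<in> space (loop_space A)" by (simp add: loop_space_def space_restrict_space mem_Times_iff)
  from broadcast_admissible[OF this] show ?thesis by (simp add: broadcast_def signal_def split_beta)
qed

lemma prob_unit:
  assumes c: "c \<in> loop_choices A"
  shows "trans_prob A i (fst c i) (signal v) \<in> {0..1}" "out_prob A i (snd c i) (signal v) \<in> {0..1}"
  by (rule funcset_mem[OF trans_prob_range[OF choice_ranges(1)[OF c]] signal_PI])
    (rule funcset_mem[OF out_prob_range[OF choice_ranges(2)[OF c]] signal_PI])

lemma signal_lipschitz: "\<bar>signal u - signal v\<bar> \<le> signal_gain * norm (u - v)"
proof -
  have "signal u - signal v = ctrl_C C \<bullet> snd (u - v) - ctrl_D C * (filt_C F \<bullet> fst (u - v))"
    by (simp add: signal_def loop_error_def inner_diff_right algebra_simps)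
  also have "\<bar>\<dots>\<bar> \<le> \<bar>ctrl_C C \<bullet> snd (u - v)\<bar> + \<bar>ctrl_D C\<bar> * \<bar>filt_C F \<bullet> fst (u - v)\<bar>"
    by (rule order.trans[OF abs_triangle_ineq4]) (simp add: abs_mult)
  also have "\<dots> \<le> norm (ctrl_C C) * norm (u - v) + \<bar>ctrl_D C\<bar> * (norm (filt_C F) * norm (u - v))"
    using norm_fst_le[of "fst (u - v)" "snd (u - v)"] norm_snd_le[of "snd (u - v)" "fst (u - v)"]
    by (intro add_mono mult_left_mono order.trans[OF Cauchy_Schwarz_ineq2] mult_left_mono) (auto simp del: fst_diff snd_diff)
  finally show ?thesis by (simp add: signal_gain_def algebra_simps)
qed

lemma choice_prob_diff:
  assumes c: "c \<in> loop_choices A" and t: "norm (u - v) \<le> t"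
  shows "\<bar>choice_prob A (signal u) c - choice_prob A (signal v) c\<bar>
    \<le> (\<Sum>i\<in>UNIV. real_modulus PI (trans_prob A i (fst c i)) (signal_gain * t)) +
      (\<Sum>i\<in>UNIV. real_modulus PI (out_prob A i (snd c i)) (signal_gain * t))"
proof -
  let ?a = "\<lambda>v i. trans_prob A i (fst c i) (signal v)" and ?b = "\<lambda>v i. out_prob A i (snd c i) (signal v)"
  have near: "\<bar>signal u - signal v\<bar> \<le> signal_gain * t"
  proof (rule order.trans[OF signal_lipschitz])
    show "signal_gain * norm (u - v) \<le> signal_gain * t"
      using t by (intro mult_left_mono) (auto simp: signal_gain_def)
  qed
  have unit: "\<bar>\<Prod>i\<in>UNIV. ?a v i\<bar> \<le> 1" "\<bar>\<Prod>i\<in>UNIV. ?b v i\<bar> \<le> 1" for v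
    using prob_unit(1)[OF c, where v=v] prob_unit(2)[OF c, where v=v] by (auto simp: abs_prod intro!: prod_le_1)
  have "\<bar>(\<Prod>i\<in>UNIV. ?a u i) - (\<Prod>i\<in>UNIV. ?a v i)\<bar> \<le> (\<Sum>i\<in>UNIV. \<bar>?a u i - ?a v i\<bar>)"
    using norm_prod_diff[of UNIV "?a u" "?a v"] prob_unit(1)[OF c] by simp
  also have "\<dots> \<le> (\<Sum>i\<in>UNIV. real_modulus PI (trans_prob A i (fst c i)) (signal_gain * t))"
    by (intro sum_mono real_modulus_bound trans_prob_range choice_ranges(1)[OF c] signal_PI near)
  finally have a: "\<bar>(\<Prod>i\<in>UNIV. ?a u i) - (\<Prod>i\<in>UNIV. ?a v i)\<bar>
      \<le> (\<Sum>i\<in>UNIV. real_modulus PI (trans_prob A i (fst c i)) (signal_gain * t))" .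
  have "\<bar>(\<Prod>i\<in>UNIV. ?b u i) - (\<Prod>i\<in>UNIV. ?b v i)\<bar> \<le> (\<Sum>i\<in>UNIV. \<bar>?b u i - ?b v i\<bar>)"
    using norm_prod_diff[of UNIV "?b u" "?b v"] prob_unit(2)[OF c] by simp
  also have "\<dots> \<le> (\<Sum>i\<in>UNIV. real_modulus PI (out_prob A i (snd c i)) (signal_gain * t))"
    by (intro sum_mono real_modulus_bound out_prob_range choice_ranges(2)[OF c] signal_PI near)
  finally have b: "\<bar>(\<Prod>i\<in>UNIV. ?b u i) - (\<Prod>i\<in>UNIV. ?b v i)\<bar>
      \<le> (\<Sum>i\<in>UNIV. real_modulus PI (out_prob A i (snd c i)) (signal_gain * t))" .
  show ?thesis
    using abs_mult_diff_le[OF unit(2)[of u] unit(1)[of v]] a b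
    by (simp add: choice_prob_def split_beta) (meson add_mono order.trans)
qed

lemma ex_loop_norm:
  obtains \<rho> N where "0 < \<rho>" "\<rho> < 1" "adapted_norm linear_part \<rho> N"
proof -
  obtain \<rho>1 N1 where f: "0 < \<rho>1" "\<rho>1 < 1" "adapted_norm ((*v) (filt_A F)) \<rho>1 N1"
    using ex_adapted_norm[OF matrix_vector_mul_linear schur_powers_tendsto_0] stable by (metis stable_filter_def)
  obtain \<rho>2 N2 where c: "0 < \<rho>2" "\<rho>2 < 1" "adapted_norm ((*v) (ctrl_A C)) \<rho>2 N2"
    using ex_adapted_norm[OF matrix_vector_mul_linear schur_powers_tendsto_0] stable by (metis stable_controller_def)
  obtain \<rho> N where "0 < \<rho>" "\<rho> < 1" "adapted_norm linear_part \<rho> N"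
    using cascade_adapted_norm[OF f(3,1,2) c(3,1,2), of "filt_C F" "ctrl_B C"]
    unfolding linear_part_def by blast
  then show thesis by (rule that)
qed

lemma contractive:
  assumes \<rho>: "0 < \<rho>" "\<rho> < 1" and N: "adapted_norm linear_part \<rho> N"
  shows "contractive_choice_system (agent_product A) (loop_choices A) (\<lambda>c v. choice_prob A (signal v) c)
    agent_map linear_part N \<rho> (\<delta> ^ CARD('i) * \<delta>' ^ CARD('i)) choice_modulus"
  unfolding contractive_choice_system_def
proof (intro conjI allI impI)
  show "finite (agent_product A)"
    unfolding agent_product_def by (intro finite_PiE states_finite) simp
  show "agent_product A \<noteq> {}" by (rule states_nonempty)
  show "finite (loop_choices A)"
    unfolding loop_choices_def by (intro finite_cartesian_product finite_PiE) auto
  show "agent_map c x \<in> agent_product A" if "c \<in> loop_choices A" "x \<in> agent_product A" for c x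
    using that trans_closed[OF choice_ranges(1)[OF that(1)]] by (auto simp: agent_map_def agent_product_def PiE_iff)
  show "(\<Sum>c\<in>loop_choices A. choice_prob A (signal v) c) = 1" for v
  proof -
    have "(\<Sum>c\<in>loop_choices A. choice_prob A (signal v) c)
        = (\<Sum>j\<in>(\<Pi>\<^sub>E i\<in>UNIV. {1..num_trans A i}). \<Prod>i\<in>UNIV. trans_prob A i (j i) (signal v)) *
          (\<Sum>l\<in>(\<Pi>\<^sub>E i\<in>UNIV. {1..num_out A i}). \<Prod>i\<in>UNIV. out_prob A i (l i) (signal v))"
      unfolding loop_choices_def choice_prob_def sum_product sum.cartesian_product ..
    also have "\<dots> = 1"
      using sum_PiE_UNIV_prod[of "\<lambda>i. {1..num_trans A i}" "\<lambda>i j. trans_prob A i j (signal v)"]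
        sum_PiE_UNIV_prod[of "\<lambda>i. {1..num_out A i}" "\<lambda>i l. out_prob A i l (signal v)"]
        trans_prob_sum[OF signal_PI] out_prob_sum[OF signal_PI] by simp
    finally show ?thesis .
  qed
  show "\<delta> ^ CARD('i) * \<delta>' ^ CARD('i) \<le> choice_prob A (signal v) c" if c: "c \<in> loop_choices A" for c v
  proof -
    have "\<delta> ^ CARD('i) \<le> (\<Prod>i\<in>UNIV. trans_prob A i (fst c i) (signal v))"
      using prod_mono[of UNIV "\<lambda>_. \<delta>" "\<lambda>i. trans_prob A i (fst c i) (signal v)"]
        trans_prob_lower[OF signal_PI choice_ranges(1)[OF c]] \<delta> by simp
    moreover have "\<delta>' ^ CARD('i) \<le> (\<Prod>i\<in>UNIV. out_prob A i (snd c i) (signal v))"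
      using prod_mono[of UNIV "\<lambda>_. \<delta>'" "\<lambda>i. out_prob A i (snd c i) (signal v)"]
        out_prob_lower[OF signal_PI choice_ranges(2)[OF c]] \<delta> by simp
    ultimately show ?thesis
      using \<delta> by (simp add: choice_prob_def split_beta mult_mono')
  qed
  show "0 < \<delta> ^ CARD('i) * \<delta>' ^ CARD('i)" using \<delta> by simp
  show "linear linear_part"
    unfolding linear_part_def
    by (rule linearI) (auto simp: matrix_vector_right_distrib inner_right_distrib matrix_vector_mult_scaleR algebra_simps)
  show "0 < \<rho>" "\<rho> < 1" by (fact \<rho>)+
  show "adapted_norm linear_part \<rho> N" by (rule N)
  show "(\<Sum>c\<in>loop_choices A. \<bar>choice_prob A (signal u) c - choice_prob A (signal v) c\<bar>) \<le> choice_modulus t"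
    if "N (u - v) \<le> t" for u v t
    unfolding choice_modulus_def
    using order.trans[OF adapted_normD(3)[OF N] that] by (intro sum_mono choice_prob_diff)
  show "summable (\<lambda>k. choice_modulus (t * \<rho> ^ k))" for t
    unfolding choice_modulus_def mult.assoc[symmetric]
    by (intro summable_sum summable_add dini_summable trans_prob_dini out_prob_dini trans_prob_range
        out_prob_range choice_ranges \<rho>)
qed

text \<open>The closed loop is the choice system in which the constant reference \<open>r\<close> belongs to the input and the coupling of
  filter and controller belongs to the linear part.\<close>

lemma loop_system_eq:
  assumes "contractive_choice_system (agent_product A) (loop_choices A) (\<lambda>c v. choice_prob A (signal v) c)
    agent_map linear_part N \<rho> \<eta> w"
  shows "(loop_space A :: ('i, 'f, 'c) loop_state measure) = contractive_choice_system.state_space (agent_product A)"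
    and "loop_kernel A F C r = contractive_choice_system.kernel (agent_product A) (loop_choices A)
      (\<lambda>c v. choice_prob A (signal v) c) agent_map linear_part input"
proof -
  interpret contractive_choice_system "agent_product A" "loop_choices A" "\<lambda>c v. choice_prob A (signal v) c"
    agent_map linear_part input N \<rho> \<eta> w by (rule assms)
  show space: "(loop_space A :: ('i, 'f, 'c) loop_state measure) = state_space"
    by (simp add: loop_space_def state_space_def)
  have "loop_step A F C r s = step s" for s
    unfolding step_def fun_eq_iff
    by (auto simp: loop_step_def agent_map_def linear_part_def input_def loop_error_def
        split_beta algebra_simps)
  moreover have "broadcast F C r s = signal (snd s)" for s :: "('i, 'f, 'c) loop_state"
    by (simp add: broadcast_def signal_def split_beta)
  ultimately show "loop_kernel A F C r = kernel"
    by (intro ext) (simp add: loop_kernel_def kernel_def space)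
qed

lemma out_choice: "(\<lambda>i. 1) \<in> (\<Pi>\<^sub>E i\<in>UNIV. {1..num_out A i})"
proof -
  have "num_out A i \<noteq> 0" for i
  proof
    assume "num_out A i = 0"
    then show False using out_prob_sum[OF signal_PI[of undefined], of i] by simp
  qed
  then show ?thesis by (simp add: PiE_iff Suc_le_eq)
qed

text \<open>The choice of output maps does not affect the agent states, so any fixed one will do.\<close>

lemma reach_of_primitive:
  assumes "primitive_matrix_on (agent_product A) (adjacency_matrix (agent_graph A))"
  obtains J where "\<And>x y. x \<in> agent_product A \<Longrightarrow> y \<in> agent_product A \<Longrightarrow>
    \<exists>cs. length cs = J \<and> set cs \<subseteq> loop_choices A \<and> foldl (\<lambda>x c. agent_map c x) x cs = y"
proof -
  obtain J where J: "\<forall>x\<in>agent_product A. \<forall>y\<in>agent_product A.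
      matrix_power_on (agent_product A) (adjacency_matrix (agent_graph A)) J x y > 0"
    using assms unfolding primitive_matrix_on_def by blast
  show thesis
  proof (rule that[of J])
    fix x y assume xy: "x \<in> agent_product A" "y \<in> agent_product A"
    obtain js where js: "length js = J" "\<forall>j\<in>set js. \<forall>i. j i \<in> {1..num_trans A i}"
      "foldl (\<lambda>x j i. trans_map A i (j i) (x i)) x js = y"
      using matrix_power_on_adjacency_pos[OF J[rule_format, OF xy] xy(1)] by blast
    let ?cs = "map (\<lambda>j. (j, \<lambda>i. 1)) js"
    have "foldl (\<lambda>x c. agent_map c x) x ?cs = y"
      using js(3) by (simp add: foldl_map agent_map_def)
    moreover have "set ?cs \<subseteq> loop_choices A"
      using js(2) out_choice by (auto simp: loop_choices_def PiE_iff)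
    ultimately show "\<exists>cs. length cs = J \<and> set cs \<subseteq> loop_choices A \<and> foldl (\<lambda>x c. agent_map c x) x cs = y"
      using js(1) by (intro exI[of _ ?cs]) auto
  qed
qed

theorem loop_invariant_measure: "\<exists>\<mu>. invariant_measure (loop_space A) (loop_kernel A F C r) \<mu>"
proof -
  obtain \<rho> N where "0 < \<rho>" "\<rho> < 1" "adapted_norm linear_part \<rho> N" by (rule ex_loop_norm)
  note c = contractive[OF this]
  interpret contractive_choice_system "agent_product A" "loop_choices A" "\<lambda>c v. choice_prob A (signal v) c"
    agent_map linear_part input N \<rho> "\<delta> ^ CARD('i) * \<delta>' ^ CARD('i)" choice_modulus by (rule c)
  obtain R where "admissible_radius R" using ex_admissible_radius by blast
  then show ?thesis unfolding loop_system_eq[OF c] using ex_invariant_measure by blast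
qed

theorem loop_uniquely_ergodic:
  assumes "primitive_matrix_on (agent_product A) (adjacency_matrix (agent_graph A))"
  shows "(\<forall>\<mu>. invariant_measure (loop_space A) (loop_kernel A F C r) \<mu> \<longrightarrow>
            attractive_measure (loop_space A) (loop_kernel A F C r) \<mu>) \<and>
         uniquely_ergodic (loop_space A) (loop_kernel A F C r)"
proof -
  obtain \<rho> N where "0 < \<rho>" "\<rho> < 1" "adapted_norm linear_part \<rho> N" by (rule ex_loop_norm)
  note c = contractive[OF this]
  obtain J where J: "\<And>x y. x \<in> agent_product A \<Longrightarrow> y \<in> agent_product A \<Longrightarrow>
    \<exists>cs. length cs = J \<and> set cs \<subseteq> loop_choices A \<and> foldl (\<lambda>x c. agent_map c x) x cs = y"
    using reach_of_primitive[OF assms] by blast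
  interpret mixing_choice_system "agent_product A" "loop_choices A" "\<lambda>c v. choice_prob A (signal v) c"
    agent_map linear_part input N \<rho> "\<delta> ^ CARD('i) * \<delta>' ^ CARD('i)" choice_modulus J
    using c J by (simp add: mixing_choice_system_def mixing_choice_system_axioms_def)
  show ?thesis
    unfolding loop_system_eq[OF c] using attractive_if_invariant unique_ergodicity by blast
qed

end

theorem theorem18:
  fixes A :: "'i::finite ensemble"
    and F :: "'f::finite linear_filter"
    and C :: "'c::finite linear_controller"
    and r :: real
    and PI :: "real set"
    and \<delta> \<delta>' :: real
  assumes states_dim: "\<forall>i. agent_states A i \<subseteq> {..<agent_dim A i} \<rightarrow>\<^sub>E UNIV"
    and states_finite: "\<forall>i. finite (agent_states A i)"
    and trans_closed: "\<forall>i. \<forall>j\<in>{1..num_trans A i}. trans_map A i j \<in> agent_states A i \<rightarrow> agent_states A i"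
    and broadcast_admissible:
      "\<forall>s \<in> space (loop_space A :: ('i, 'f, 'c) loop_state measure). broadcast F C r s \<in> PI"
    and trans_prob_range: "\<forall>i. \<forall>j\<in>{1..num_trans A i}. trans_prob A i j \<in> PI \<rightarrow> {0..1}"
    and out_prob_range: "\<forall>i. \<forall>l\<in>{1..num_out A i}. out_prob A i l \<in> PI \<rightarrow> {0..1}"
    and trans_prob_dini: "\<forall>i. \<forall>j\<in>{1..num_trans A i}. dini_continuous_on PI (trans_prob A i j)"
    and out_prob_dini: "\<forall>i. \<forall>l\<in>{1..num_out A i}. dini_continuous_on PI (out_prob A i l)"
    and trans_prob_sum: "\<forall>\<pi>\<in>PI. \<forall>i. (\<Sum>j=1..num_trans A i. trans_prob A i j \<pi>) = 1"
    and out_prob_sum: "\<forall>\<pi>\<in>PI. \<forall>i. (\<Sum>l=1..num_out A i. out_prob A i l \<pi>) = 1"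
    and "\<delta> > 0" and "\<delta>' > 0"
    and trans_prob_lower: "\<forall>\<pi>\<in>PI. \<forall>i. \<forall>j\<in>{1..num_trans A i}. trans_prob A i j \<pi> \<ge> \<delta>"
    and out_prob_lower: "\<forall>\<pi>\<in>PI. \<forall>i. \<forall>l\<in>{1..num_out A i}. out_prob A i l \<pi> \<ge> \<delta>'"
    and "stable_controller C"
    and "stable_filter F"
  shows "(strongly_connected (with_proj (agent_graph A)) \<longrightarrow>
           (\<exists>\<mu>. invariant_measure (loop_space A) (loop_kernel A F C r) \<mu>)) \<and>
         (strongly_connected (with_proj (agent_graph A)) \<and>
          primitive_matrix_on (agent_product A) (adjacency_matrix (agent_graph A)) \<longrightarrow>
           (\<forall>\<mu>. invariant_measure (loop_space A) (loop_kernel A F C r) \<mu> \<longrightarrow>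
                attractive_measure (loop_space A) (loop_kernel A F C r) \<mu>) \<and>
           uniquely_ergodic (loop_space A) (loop_kernel A F C r))"
proof -
  have loop: "feedback_loop A F C r PI \<delta> \<delta>'" if "strongly_connected (with_proj (agent_graph A))"
    using that assms unfolding feedback_loop_def strongly_connected_def by (auto simp: agent_graph_def)
  show ?thesis
    using feedback_loop.loop_invariant_measure[OF loop] feedback_loop.loop_uniquely_ergodic[OF loop] by blast
qed

end
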